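(* Let $B\subset A$ be an irreducible inclusion of simple unital $C^*$-algebras (i.e. $B'\cap A=\mathbb{C}$) with a conditional expectation $E:A\to B$ of finite index, and let $e\in B'\cap A_1$ be a nonzero biprojection. Write $\mathcal{F}_1(e)=t\,[\mathcal{F}(e)]$ with $t>0$ a scalar and $[\mathcal{F}(e)]\in A'\cap A_2$ a projection. Then $P:=\{[\mathcal{F}(e)]\}'\cap A_1$ is an intermediate $C^*$-subalgebra of $A\subset A_1$, and $[\mathcal{F}(e)]$ implements a conditional expectation from $A_1$ onto $P$, i.e. there is a conditional expectation $E_P:A_1\to P$ with $[\mathcal{F}(e)]\,x\,[\mathcal{F}(e)]=E_P(x)\,[\mathcal{F}(e)]$ for all $x\in A_1$. Moreover, $$P=AeA,\qquad [\mathcal{F}(e)]=e_P,\qquad [A_1:P]_0=\mathrm{tr}\big([\mathcal{F}(e)]\big)^{-1},$$ where $AeA=\mathrm{span}\{aeb: a,b\in A\}$.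
   Context: All inclusions of unital $C^*$-algebras have common identity. A conditional expectation $E:A\to B$ is a positive norm-one projection onto $B$ with $E(axb)=aE(x)b$ for $a,b\in B$, $x\in A$. It has finite index if there is a finite set $\{\lambda_i\}\subset A$ (a quasi-basis) with $x=\sum_i\lambda_iE(\lambda_i^*x)=\sum_i E(x\lambda_i)\lambda_i^*$ for all $x\in A$; then $\mathrm{Ind}(E)=\sum_i\lambda_i\lambda_i^*$, independent of the quasi-basis. If $A,B$ are simple unital and some finite-index conditional expectation $A\to B$ exists, then all finite-index ones have scalar index and there is a unique one, $E_0=E^A_B$, with minimal index (the minimal conditional expectation); $[A:B]_0:=\mathrm{Ind}(E^A_B)$ and $\tau:=[A:B]_0^{-1}$. (If $B\subset A$ is irreducible, $E^A_B$ is the only conditional expectation $A\to B$.) Basic construction: $A$ is a Hilbert $B$-module with $\langle x,y\rangle_B=E_0(x^*y)$; $A$ acts on it by left multiplication; $e_1=e_B$ is the projection $x\mapsto E_0(x)$; $A_1$ is the $C^*$-algebra of adjointable $B$-linear maps on $A$ generated by $A$ and $e_1$. It is simple and unital, with minimal (dual) conditional expectation $E_1:A_1\to A$, $E_1(xe_1y)=\tau xy$ for $x,y\in A$, and $[A_1:A]_0=[A:B]_0$. Iterating, with $A_{-1}=B$, $A_0=A$, one gets a tower $B\subset A\subset A_1\subset A_2\subset\cdots$ with minimal conditional expectations $E_k:A_k\to A_{k-1}$ and Jones projections $e_k\in A_k$ implementing $E_{k-1}$. Let $\mathrm{tr}=(E_0\circ E_1\circ\cdots\circ E_k)|_{B'\cap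 A_k}$; these are consistent faithful tracial states on the finite dimensional algebras $B'\cap A_k$. Let $E^{B'\cap A_2}_{A'\cap A_2}$ be the $\mathrm{tr}$-preserving conditional expectation. Fourier transform: $\mathcal{F}_1:B'\cap A_1\to A'\cap A_2$, $\mathcal{F}_1(x)=\tau^{-3/2}E^{B'\cap A_2}_{A'\cap A_2}(xe_2e_1)$. A projection $e\in B'\cap A_1$ is a biprojection if $\mathcal{F}_1(e)$ is a multiple of a projection; if $\mathcal{F}_1(e)=tf$ with $t>0$ and $f$ a projection, $[\mathcal{F}(e)]$ denotes $f$. For an intermediate $C^*$-subalgebra $P$ of the irreducible inclusion $A\subset A_1$, the Jones projection $e_P$ is the element of $A_2$ acting on the Hilbert $A$-module $A_1$ (with $\langle x,y\rangle_A=E_1(x^*y)$) by $x\mapsto E_P(x)$, where $E_P:A_1\to P$ is the unique (minimal) conditional expectation. *)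

theory Defs
  imports "HOL-Analysis.Abstract_Metric_Spaces" "HOL-Algebra.Algebra"
begin

section \<open>Unital C*-algebras with explicit carrier\<close>

text \<open>
  The algebras occurring in the Jones tower are sets of maps on the preceding algebra, so a
  C*-algebra is a record with a carrier, extending the ring and module records of HOL-Algebra.
\<close>

record 'a cstar = "(complex, 'a) module" +
  star :: "'a \<Rightarrow> 'a"
  nrm :: "'a \<Rightarrow> real"

definition complex_ring :: "complex ring" where
  "complex_ring = \<lparr>carrier = UNIV, monoid.mult = (*), one = 1, ring.zero = 0, ring.add = (+)\<rparr>"

text \<open>
  The value outside the carrier is fixed because \<^locale>\<open>Metric_space\<close> demands
  non-negativity and symmetry on the whole type.
\<close>

definition cstar_dist :: "'a cstar \<Rightarrow> 'a \<Rightarrow> 'a \<Rightarrow> real" where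
  "cstar_dist A x y =
     (if x \<in> carrier A \<and> y \<in> carrier A then nrm A (x \<ominus>\<^bsub>A\<^esub> y) else 0)"

definition norm_closed :: "'a cstar \<Rightarrow> 'a set \<Rightarrow> bool" where
  "norm_closed A S \<longleftrightarrow> closedin (Metric_space.mtopology (carrier A) (cstar_dist A)) S"

locale cstar_algebra = ring A for A :: "'a cstar" (structure) +
  assumes module: "Module.module complex_ring A"
    and smult_mult_left: "\<lbrakk>x \<in> carrier A; y \<in> carrier A\<rbrakk> \<Longrightarrow> (c \<odot> x) \<otimes> y = c \<odot> (x \<otimes> y)"
    and smult_mult_right: "\<lbrakk>x \<in> carrier A; y \<in> carrier A\<rbrakk> \<Longrightarrow> x \<otimes> (c \<odot> y) = c \<odot> (x \<otimes> y)"
    and star_closed: "x \<in> carrier A \<Longrightarrow> star A x \<in> carrier A"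
    and star_star: "x \<in> carrier A \<Longrightarrow> star A (star A x) = x"
    and star_add: "\<lbrakk>x \<in> carrier A; y \<in> carrier A\<rbrakk> \<Longrightarrow> star A (x \<oplus> y) = star A x \<oplus> star A y"
    and star_smult: "x \<in> carrier A \<Longrightarrow> star A (c \<odot> x) = cnj c \<odot> star A x"
    and star_mult: "\<lbrakk>x \<in> carrier A; y \<in> carrier A\<rbrakk> \<Longrightarrow> star A (x \<otimes> y) = star A y \<otimes> star A x"
    and nrm_nonneg: "x \<in> carrier A \<Longrightarrow> 0 \<le> nrm A x"
    and nrm_eq_0: "x \<in> carrier A \<Longrightarrow> nrm A x = 0 \<longleftrightarrow> x = \<zero>"
    and nrm_triangle: "\<lbrakk>x \<in> carrier A; y \<in> carrier A\<rbrakk> \<Longrightarrow> nrm A (x \<oplus> y) \<le> nrm A x + nrm A y"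
    and nrm_smult: "x \<in> carrier A \<Longrightarrow> nrm A (c \<odot> x) = cmod c * nrm A x"
    and nrm_mult: "\<lbrakk>x \<in> carrier A; y \<in> carrier A\<rbrakk> \<Longrightarrow> nrm A (x \<otimes> y) \<le> nrm A x * nrm A y"
    and nrm_cstar: "x \<in> carrier A \<Longrightarrow> nrm A (star A x \<otimes> x) = (nrm A x)\<^sup>2"
    and complete: "Metric_space.mcomplete (carrier A) (cstar_dist A)"

text \<open>
  Unital inclusions with common identity. A subalgebra is a subset; as an algebra in its own right
  it is \<open>A\<lparr>carrier := B\<rparr>\<close>.
\<close>

definition cstar_subalgebra :: "'a set \<Rightarrow> 'a cstar \<Rightarrow> bool" where
  "cstar_subalgebra B A \<longleftrightarrow>
     subring B A \<and> (\<forall>c. \<forall>x\<in>B. c \<odot>\<^bsub>A\<^esub> x \<in> B) \<and> (\<forall>x\<in>B. star A x \<in> B) \<and> norm_closed A B"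

definition simple_cstar :: "'a cstar \<Rightarrow> bool" where
  "simple_cstar A \<longleftrightarrow> \<one>\<^bsub>A\<^esub> \<noteq> \<zero>\<^bsub>A\<^esub> \<and>
     (\<forall>I. ideal I A \<and> norm_closed A I \<longrightarrow> I = {\<zero>\<^bsub>A\<^esub>} \<or> I = carrier A)"

definition cstar_generated :: "'a cstar \<Rightarrow> 'a set \<Rightarrow> 'a set" where
  "cstar_generated A S = \<Inter>{C. cstar_subalgebra C A \<and> S \<subseteq> C}"

definition relative_commutant :: "'a set \<Rightarrow> 'a cstar \<Rightarrow> 'a set" where
  "relative_commutant S A = {x \<in> carrier A. \<forall>y\<in>S. x \<otimes>\<^bsub>A\<^esub> y = y \<otimes>\<^bsub>A\<^esub> x}"

definition complex_span :: "'a cstar \<Rightarrow> 'a set \<Rightarrow> 'a set" where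
  "complex_span A S = {(\<Oplus>\<^bsub>A\<^esub>v\<in>T. c v \<odot>\<^bsub>A\<^esub> v) | T c. finite T \<and> T \<subseteq> S}"

definition positive :: "'a cstar \<Rightarrow> 'a \<Rightarrow> bool" where
  "positive A x \<longleftrightarrow> (\<exists>y\<in>carrier A. x = star A y \<otimes>\<^bsub>A\<^esub> y)"

definition projection :: "'a cstar \<Rightarrow> 'a \<Rightarrow> bool" where
  "projection A p \<longleftrightarrow> p \<in> carrier A \<and> star A p = p \<and> p \<otimes>\<^bsub>A\<^esub> p = p"


section \<open>Conditional expectations and index\<close>

text \<open>
  Since \<open>E \<one> = \<one>\<close>, the contractivity clause says that \<open>E\<close> has norm one (for \<open>A \<noteq> 0\<close>).
  Expectations are extensional functions, so that they are determined by their values on \<open>A\<close>.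
\<close>

definition conditional_expectation :: "'a cstar \<Rightarrow> 'a set \<Rightarrow> ('a \<Rightarrow> 'a) \<Rightarrow> bool" where
  "conditional_expectation A B E \<longleftrightarrow>
     cstar_subalgebra B A \<and>
     E \<in> carrier A \<rightarrow>\<^sub>E B \<and>
     (\<forall>x\<in>carrier A. \<forall>y\<in>carrier A. E (x \<oplus>\<^bsub>A\<^esub> y) = E x \<oplus>\<^bsub>A\<^esub> E y) \<and>
     (\<forall>c. \<forall>x\<in>carrier A. E (c \<odot>\<^bsub>A\<^esub> x) = c \<odot>\<^bsub>A\<^esub> E x) \<and>
     (\<forall>b\<in>B. E b = b) \<and>
     (\<forall>x. positive A x \<longrightarrow> positive (A\<lparr>carrier := B\<rparr>) (E x)) \<and>
     (\<forall>x\<in>carrier A. nrm A (E x) \<le> nrm A x) \<and>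
     (\<forall>a\<in>B. \<forall>b\<in>B. \<forall>x\<in>carrier A. E (a \<otimes>\<^bsub>A\<^esub> x \<otimes>\<^bsub>A\<^esub> b) = a \<otimes>\<^bsub>A\<^esub> E x \<otimes>\<^bsub>A\<^esub> b)"

definition quasi_basis :: "'a cstar \<Rightarrow> ('a \<Rightarrow> 'a) \<Rightarrow> 'a set \<Rightarrow> bool" where
  "quasi_basis A E L \<longleftrightarrow> finite L \<and> L \<subseteq> carrier A \<and>
     (\<forall>x\<in>carrier A.
        x = (\<Oplus>\<^bsub>A\<^esub>l\<in>L. l \<otimes>\<^bsub>A\<^esub> E (star A l \<otimes>\<^bsub>A\<^esub> x)) \<and>
        x = (\<Oplus>\<^bsub>A\<^esub>l\<in>L. E (x \<otimes>\<^bsub>A\<^esub> l) \<otimes>\<^bsub>A\<^esub> star A l))"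

definition finite_index_expectation :: "'a cstar \<Rightarrow> 'a set \<Rightarrow> ('a \<Rightarrow> 'a) \<Rightarrow> bool" where
  "finite_index_expectation A B E \<longleftrightarrow> conditional_expectation A B E \<and> (\<exists>L. quasi_basis A E L)"

text \<open>\<open>Ind(E)\<close>; the value does not depend on the quasi-basis.\<close>

definition index_element :: "'a cstar \<Rightarrow> ('a \<Rightarrow> 'a) \<Rightarrow> 'a" where
  "index_element A E = (\<Oplus>\<^bsub>A\<^esub>l\<in>(SOME L. quasi_basis A E L). l \<otimes>\<^bsub>A\<^esub> star A l)"

definition minimal_expectation :: "'a cstar \<Rightarrow> 'a set \<Rightarrow> ('a \<Rightarrow> 'a) \<Rightarrow> bool" where
  "minimal_expectation A B E \<longleftrightarrow>
     finite_index_expectation A B E \<and>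
     (\<exists>r. index_element A E = complex_of_real r \<odot>\<^bsub>A\<^esub> \<one>\<^bsub>A\<^esub> \<and>
       (\<forall>E' r'. finite_index_expectation A B E' \<and>
                index_element A E' = complex_of_real r' \<odot>\<^bsub>A\<^esub> \<one>\<^bsub>A\<^esub> \<longrightarrow> r \<le> r'))"

text \<open>\<open>E\<^sup>A\<^sub>B\<close> and \<open>[A:B]\<^sub>0\<close>.\<close>

definition min_expectation :: "'a cstar \<Rightarrow> 'a set \<Rightarrow> 'a \<Rightarrow> 'a" where
  "min_expectation A B = (THE E. minimal_expectation A B E)"

definition min_index :: "'a cstar \<Rightarrow> 'a set \<Rightarrow> real" where
  "min_index A B =
     (THE r. index_element A (min_expectation A B) = complex_of_real r \<odot>\<^bsub>A\<^esub> \<one>\<^bsub>A\<^esub>)"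


section \<open>Basic construction\<close>

text \<open>
  \<open>A\<close> as a Hilbert \<open>B\<close>-module for an expectation \<open>E\<close>, with inner product linear in the second
  variable, and the algebra of its adjointable \<open>B\<close>-linear maps with the operator norm.
\<close>

definition hinner :: "'a cstar \<Rightarrow> ('a \<Rightarrow> 'a) \<Rightarrow> 'a \<Rightarrow> 'a \<Rightarrow> 'a" where
  "hinner A E x y = E (star A x \<otimes>\<^bsub>A\<^esub> y)"

definition hnorm :: "'a cstar \<Rightarrow> ('a \<Rightarrow> 'a) \<Rightarrow> 'a \<Rightarrow> real" where
  "hnorm A E x = sqrt (nrm A (hinner A E x x))"

definition is_adjoint :: "'a cstar \<Rightarrow> ('a \<Rightarrow> 'a) \<Rightarrow> ('a \<Rightarrow> 'a) \<Rightarrow> ('a \<Rightarrow> 'a) \<Rightarrow> bool" where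
  "is_adjoint A E T S \<longleftrightarrow> S \<in> carrier A \<rightarrow>\<^sub>E carrier A \<and>
     (\<forall>x\<in>carrier A. \<forall>y\<in>carrier A. hinner A E (T x) y = hinner A E x (S y))"

definition adjointable_maps :: "'a cstar \<Rightarrow> 'a set \<Rightarrow> ('a \<Rightarrow> 'a) \<Rightarrow> ('a \<Rightarrow> 'a) cstar" where
  "adjointable_maps A B E =
     \<lparr>carrier = {T \<in> carrier A \<rightarrow>\<^sub>E carrier A.
        (\<forall>x\<in>carrier A. \<forall>y\<in>carrier A. T (x \<oplus>\<^bsub>A\<^esub> y) = T x \<oplus>\<^bsub>A\<^esub> T y) \<and>
        (\<forall>x\<in>carrier A. \<forall>b\<in>B. T (x \<otimes>\<^bsub>A\<^esub> b) = T x \<otimes>\<^bsub>A\<^esub> b) \<and>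
        (\<exists>S. is_adjoint A E T S)},
      monoid.mult = (\<lambda>S T. compose (carrier A) S T),
      one = (\<lambda>x\<in>carrier A. x),
      ring.zero = (\<lambda>x\<in>carrier A. \<zero>\<^bsub>A\<^esub>),
      ring.add = (\<lambda>S T. \<lambda>x\<in>carrier A. S x \<oplus>\<^bsub>A\<^esub> T x),
      smult = (\<lambda>c T. \<lambda>x\<in>carrier A. c \<odot>\<^bsub>A\<^esub> T x),
      star = (\<lambda>T. THE S. is_adjoint A E T S),
      nrm = (\<lambda>T. SUP x\<in>{x \<in> carrier A. hnorm A E x \<le> 1}. hnorm A E (T x))\<rparr>"

definition left_mult :: "'a cstar \<Rightarrow> 'a \<Rightarrow> 'a \<Rightarrow> 'a" where
  "left_mult A a = (\<lambda>x\<in>carrier A. a \<otimes>\<^bsub>A\<^esub> x)"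

text \<open>
  The Jones projection \<open>e\<^sub>B\<close>, and \<open>A\<^sub>1\<close>. The inclusion of \<open>A\<close> in \<open>A\<^sub>1\<close> is
  \<^term>\<open>left_mult A\<close>.
\<close>

definition jones_projection :: "'a cstar \<Rightarrow> 'a set \<Rightarrow> 'a \<Rightarrow> 'a" where
  "jones_projection A B = (\<lambda>x\<in>carrier A. min_expectation A B x)"

definition basic_construction :: "'a cstar \<Rightarrow> 'a set \<Rightarrow> ('a \<Rightarrow> 'a) cstar" where
  "basic_construction A B =
     (let M = adjointable_maps A B (min_expectation A B)
      in M\<lparr>carrier := cstar_generated M (left_mult A ` carrier A \<union> {jones_projection A B})\<rparr>)"

text \<open>
  The minimal expectation of \<open>A\<^sub>1\<close> onto the copy of \<open>A\<close> inside it, regarded as taking values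
  in \<open>A\<close> itself.
\<close>

definition next_expectation :: "'a cstar \<Rightarrow> 'a set \<Rightarrow> ('a \<Rightarrow> 'a) \<Rightarrow> 'a" where
  "next_expectation A B T =
     inv_into (carrier A) (left_mult A)
       (min_expectation (basic_construction A B) (left_mult A ` carrier A) T)"


section \<open>The tower up to the second step and the Fourier transform\<close>

definition image1 :: "'a cstar \<Rightarrow> 'a set \<Rightarrow> ('a \<Rightarrow> 'a) set" where
  "image1 A S = left_mult A ` S"

definition tower1 :: "'a cstar \<Rightarrow> 'a set \<Rightarrow> ('a \<Rightarrow> 'a) cstar" where
  "tower1 A B = basic_construction A B"

definition tower2 :: "'a cstar \<Rightarrow> 'a set \<Rightarrow> (('a \<Rightarrow> 'a) \<Rightarrow> 'a \<Rightarrow> 'a) cstar" where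
  "tower2 A B = basic_construction (tower1 A B) (image1 A (carrier A))"

text \<open>The inclusion of \<open>A\<^sub>1\<close> in \<open>A\<^sub>2\<close>, and the copy in \<open>A\<^sub>2\<close> of a subset of \<open>A\<close>.\<close>

definition incl12 :: "'a cstar \<Rightarrow> 'a set \<Rightarrow> ('a \<Rightarrow> 'a) \<Rightarrow> ('a \<Rightarrow> 'a) \<Rightarrow> 'a \<Rightarrow> 'a" where
  "incl12 A B = left_mult (tower1 A B)"

definition image2 :: "'a cstar \<Rightarrow> 'a set \<Rightarrow> 'a set \<Rightarrow> (('a \<Rightarrow> 'a) \<Rightarrow> 'a \<Rightarrow> 'a) set" where
  "image2 A B S = incl12 A B ` image1 A S"

definition jones1 :: "'a cstar \<Rightarrow> 'a set \<Rightarrow> 'a \<Rightarrow> 'a" where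
  "jones1 A B = jones_projection A B"

definition jones2 :: "'a cstar \<Rightarrow> 'a set \<Rightarrow> ('a \<Rightarrow> 'a) \<Rightarrow> 'a \<Rightarrow> 'a" where
  "jones2 A B = jones_projection (tower1 A B) (image1 A (carrier A))"

text \<open>\<open>tr = E\<^sub>0 \<circ> E\<^sub>1 \<circ> E\<^sub>2\<close> on \<open>B' \<inter> A\<^sub>2\<close>, where it takes values in \<open>\<complex>\<one>\<close>.\<close>

definition tower_trace ::
    "'a cstar \<Rightarrow> 'a set \<Rightarrow> (('a \<Rightarrow> 'a) \<Rightarrow> 'a \<Rightarrow> 'a) \<Rightarrow> complex" where
  "tower_trace A B x =
     (THE c. min_expectation A B
               (next_expectation A B
                 (next_expectation (tower1 A B) (image1 A (carrier A)) x)) = c \<odot>\<^bsub>A\<^esub> \<one>\<^bsub>A\<^esub>)"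

definition commutant_B1 :: "'a cstar \<Rightarrow> 'a set \<Rightarrow> ('a \<Rightarrow> 'a) set" where
  "commutant_B1 A B = relative_commutant (image1 A B) (tower1 A B)"

definition commutant_B2 :: "'a cstar \<Rightarrow> 'a set \<Rightarrow> (('a \<Rightarrow> 'a) \<Rightarrow> 'a \<Rightarrow> 'a) set" where
  "commutant_B2 A B = relative_commutant (image2 A B B) (tower2 A B)"

definition commutant_A2 :: "'a cstar \<Rightarrow> 'a set \<Rightarrow> (('a \<Rightarrow> 'a) \<Rightarrow> 'a \<Rightarrow> 'a) set" where
  "commutant_A2 A B = relative_commutant (image2 A B (carrier A)) (tower2 A B)"

definition trace_expectation ::
    "'a cstar \<Rightarrow> 'a set \<Rightarrow> (('a \<Rightarrow> 'a) \<Rightarrow> 'a \<Rightarrow> 'a) \<Rightarrow> (('a \<Rightarrow> 'a) \<Rightarrow> 'a \<Rightarrow> 'a)" where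
  "trace_expectation A B =
     (THE F. conditional_expectation ((tower2 A B)\<lparr>carrier := commutant_B2 A B\<rparr>)
               (commutant_A2 A B) F \<and>
             (\<forall>x\<in>commutant_B2 A B. tower_trace A B (F x) = tower_trace A B x))"

definition fourier1 ::
    "'a cstar \<Rightarrow> 'a set \<Rightarrow> ('a \<Rightarrow> 'a) \<Rightarrow> (('a \<Rightarrow> 'a) \<Rightarrow> 'a \<Rightarrow> 'a)" where
  "fourier1 A B x =
     complex_of_real (inverse (min_index A B) powr (-3/2)) \<odot>\<^bsub>tower2 A B\<^esub>
       trace_expectation A B
         (incl12 A B x \<otimes>\<^bsub>tower2 A B\<^esub> jones2 A B \<otimes>\<^bsub>tower2 A B\<^esub> incl12 A B (jones1 A B))"

definition biprojection :: "'a cstar \<Rightarrow> 'a set \<Rightarrow> ('a \<Rightarrow> 'a) \<Rightarrow> bool" where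
  "biprojection A B e \<longleftrightarrow> e \<in> commutant_B1 A B \<and> projection (tower1 A B) e \<and>
     (\<exists>(c::complex) p. projection (tower2 A B) p \<and> fourier1 A B e = c \<odot>\<^bsub>tower2 A B\<^esub> p)"

text \<open>\<open>[\<F>(e)]\<close>; the projection is uniquely determined when \<open>\<F>\<^sub>1(e) \<noteq> 0\<close>.\<close>

definition fourier_projection ::
    "'a cstar \<Rightarrow> 'a set \<Rightarrow> ('a \<Rightarrow> 'a) \<Rightarrow> (('a \<Rightarrow> 'a) \<Rightarrow> 'a \<Rightarrow> 'a)" where
  "fourier_projection A B e =
     (THE p. projection (tower2 A B) p \<and>
             (\<exists>t>0. fourier1 A B e = complex_of_real t \<odot>\<^bsub>tower2 A B\<^esub> p))"

end

theory Submission
  imports Defs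
begin

text \<open>
  Write \<open>l\<close> for the members of a quasi-basis of \<open>E\<close>, \<open>\<tau>\<close> for the inverse of the index, and identify an
  algebra with its copies higher up in the tower. Irreducibility makes the tower explicit. Two
  expectations \<open>E\<close>, \<open>E'\<close> onto \<open>B\<close> satisfy \<open>E'(x) = E(x h)\<close> with \<open>h = \<Sum> l E'(l\<^sup>*)\<close> in \<open>B' \<inter> A = \<complex>\<close>, so they
  agree, and the minimal expectation is the only one (\<open>expectation_unique\<close>). Every right \<open>B\<close>-linear map
  \<open>T\<close> on \<open>A\<close> equals \<open>\<Sum> T(l) e\<^sub>1 l\<^sup>*\<close>, so \<open>A\<^sub>1\<close> consists of all these maps; the expectation of \<open>A\<^sub>1\<close>
  onto \<open>A\<close> is \<open>T \<mapsto> \<tau> \<Sum> T(l) l\<^sup>*\<close>, and \<open>A \<subseteq> A\<^sub>1\<close> is again irreducible of the same index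
  (\<open>dual_inclusion\<close>), so the step can be repeated to get \<open>A\<^sub>2\<close>. The trace-preserving expectation of
  \<open>B' \<inter> A\<^sub>2\<close> onto \<open>A' \<inter> A\<^sub>2\<close> is the average \<open>x \<mapsto> \<tau> \<Sum> l x l\<^sup>*\<close> (\<open>trace_expectation_eq\<close>). Evaluating the
  definition then shows that \<open>\<F>\<^sub>1(e)\<close> is a positive multiple of the map \<open>a e\<^sub>1 b \<mapsto> a e b\<close> on \<open>A\<^sub>1\<close>
  (\<open>fourier1_apply\<close>).

  So a nonzero biprojection \<open>e\<close> yields a self-adjoint idempotent \<open>A\<close>-\<open>A\<close>-bimodule map \<open>p\<close> on \<open>A\<^sub>1\<close>
  with \<open>p(e\<^sub>1) = s e\<close>, whose range is \<open>A e A\<close>. Self-adjointness of \<open>p\<close>, tested on \<open>e\<^sub>1\<close>, forces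
  \<open>s > 0\<close> and \<open>e e\<^sub>1 = e\<^sub>1\<close>, and then \<open>p(1) = 1\<close>. The point is that \<open>A e A\<close> is closed under products.
  Regard \<open>e\<close> as an idempotent map on \<open>A\<close>. It commutes with the involution, and \<open>p(e) = e\<close> reads
  \<open>s \<Sum> e(l) e e(l)\<^sup>* = e\<close>. Compressing this identity with \<open>1 - e\<close> gives a sum of positive elements
  that vanishes, so \<open>(1 - e) e(l) e = 0\<close> for each \<open>l\<close> (\<open>e_absorbs_basis\<close>): left multiplication by
  \<open>e(l)\<close> preserves the range of \<open>e\<close>. Hence this range is a *-algebra over which \<open>e\<close> is linear, which
  is the exchange relation \<open>e a e = e(a) e\<close>, and this says that \<open>p\<close> commutes with left multiplication
  by \<open>e\<close> (\<open>p_left_e\<close>). The algebra \<open>P\<close> of all elements whose left multiplication commutes with \<open>p\<close>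
  therefore contains \<open>A e A\<close>, and it is contained in the range \<open>A e A\<close> of \<open>p\<close> because \<open>p(1) = 1\<close>.
  Consequently \<open>p\<close> is the expectation onto \<open>P\<close>; the elements \<open>s\<^sup>-\<^sup>1\<^sup>/\<^sup>2 l e\<^sub>1\<close> form a quasi-basis for
  it, its index is \<open>1/s\<close>, and the trace of \<open>p\<close> is \<open>s\<close>.

  The analysis behind this is the order structure of a C*-algebra, developed from the axioms without
  spectral theory: square roots come from a convergent iteration, positivity is a condition on the
  norm that is visibly stable under sums, and \<open>x\<^sup>* x\<close> satisfies it (\<open>pos_star_mult\<close>). It gives the
  Cauchy-Schwarz inequality, hence the C*-norm on \<open>A\<^sub>1\<close>, and the positivity of all the expectations
  above, each of which maps \<open>T\<^sup>* T\<close> to an explicit sum of such squares.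
\<close>

section \<open>Linear structure and norm\<close>

text \<open>
  Moves maps between different algebras of the tower through finite sums; over an infinite \<open>I\<close> both sums
  are zero by convention.
\<close>

lemma additive_finsum:
  assumes R: "abelian_group R" and S: "abelian_group S"
    and h: "h \<in> carrier R \<rightarrow> carrier S"
    and add: "\<And>x y. \<lbrakk>x \<in> carrier R; y \<in> carrier R\<rbrakk> \<Longrightarrow> h (x \<oplus>\<^bsub>R\<^esub> y) = h x \<oplus>\<^bsub>S\<^esub> h y"
    and g: "g \<in> I \<rightarrow> carrier R"
  shows "h (\<Oplus>\<^bsub>R\<^esub>i\<in>I. g i) = (\<Oplus>\<^bsub>S\<^esub>i\<in>I. h (g i))"
proof -
  interpret R: abelian_group R by (rule R)
  interpret S: abelian_group S by (rule S)
  have z: "h \<zero>\<^bsub>R\<^esub> = \<zero>\<^bsub>S\<^esub>"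
  proof -
    have c: "h \<zero>\<^bsub>R\<^esub> \<in> carrier S" using h by auto
    have "h \<zero>\<^bsub>R\<^esub> \<oplus>\<^bsub>S\<^esub> h \<zero>\<^bsub>R\<^esub> = h \<zero>\<^bsub>R\<^esub>" using add[of "\<zero>\<^bsub>R\<^esub>" "\<zero>\<^bsub>R\<^esub>"] by simp
    with c show ?thesis by (metis S.add.r_cancel_one')
  qed
  show ?thesis
  proof (cases "finite I")
    case True
    then show ?thesis using g
    proof (induction I rule: finite_induct)
      case empty then show ?case by (simp add: z)
    next
      case (insert i I)
      then have *: "g \<in> I \<rightarrow> carrier R" "g i \<in> carrier R" by auto
      then have "(\<lambda>i. h (g i)) \<in> I \<rightarrow> carrier S" "h (g i) \<in> carrier S" using h by auto
      with * insert show ?case by (simp add: add)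
    qed
  qed (simp add: z)
qed

context cstar_algebra
begin

lemma smult_closed [simp]: "x \<in> carrier A \<Longrightarrow> c \<odot> x \<in> carrier A"
  using module.smult_closed[OF module, of c x] by (simp add: complex_ring_def)

lemma smult_add_left: "x \<in> carrier A \<Longrightarrow> (a + b) \<odot> x = a \<odot> x \<oplus> b \<odot> x"
  using module.smult_l_distr[OF module, of a b x] by (simp add: complex_ring_def)

lemma smult_add_right: "\<lbrakk>x \<in> carrier A; y \<in> carrier A\<rbrakk> \<Longrightarrow> c \<odot> (x \<oplus> y) = c \<odot> x \<oplus> c \<odot> y"
  using module.smult_r_distr[OF module, of c x y] by (simp add: complex_ring_def)

lemma smult_smult [simp]: "x \<in> carrier A \<Longrightarrow> a \<odot> (b \<odot> x) = (a * b) \<odot> x"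
  using module.smult_assoc1[OF module, of a b x] by (simp add: complex_ring_def)

lemma smult_1 [simp]: "x \<in> carrier A \<Longrightarrow> 1 \<odot> x = x"
  using module.smult_one[OF module, of x] by (simp add: complex_ring_def)

lemma smult_0 [simp]: "x \<in> carrier A \<Longrightarrow> 0 \<odot> x = \<zero>"
  using module.smult_l_null[OF module, of x] by (simp add: complex_ring_def)

lemma smult_zero [simp]: "c \<odot> \<zero> = \<zero>"
  using module.smult_r_null[OF module, of c] by (simp add: complex_ring_def)

lemma smult_minus_right: "x \<in> carrier A \<Longrightarrow> c \<odot> (\<ominus> x) = \<ominus> (c \<odot> x)"
  using module.smult_r_minus[OF module, of c x] by (simp add: complex_ring_def)

lemma smult_minus_left: "x \<in> carrier A \<Longrightarrow> (- c) \<odot> x = \<ominus> (c \<odot> x)"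
proof -
  assume x: "x \<in> carrier A"
  have "(- c) \<odot> x \<oplus> c \<odot> x = \<zero>" using smult_add_left[OF x, of "-c" c] x by simp
  then show ?thesis using x by (simp add: minus_equality)
qed

lemma smult_diff_left: "x \<in> carrier A \<Longrightarrow> (a - b) \<odot> x = a \<odot> x \<ominus> b \<odot> x"
  using smult_add_left[of x a "-b"] by (simp add: smult_minus_left minus_eq)

lemma smult_diff_right: "\<lbrakk>x \<in> carrier A; y \<in> carrier A\<rbrakk> \<Longrightarrow> c \<odot> (x \<ominus> y) = c \<odot> x \<ominus> c \<odot> y"
  by (simp add: minus_eq smult_add_right smult_minus_right)

lemma minus_eq_smult: "x \<in> carrier A \<Longrightarrow> \<ominus> x = (- 1) \<odot> x"
  by (simp add: smult_minus_left)

lemma smult_cancel: "\<lbrakk>x \<in> carrier A; y \<in> carrier A; c \<noteq> 0; c \<odot> x = c \<odot> y\<rbrakk> \<Longrightarrow> x = y"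
  by (metis (no_types) left_inverse smult_1 smult_smult)

lemma smult_eq_zero: "\<lbrakk>x \<in> carrier A; c \<odot> x = \<zero>\<rbrakk> \<Longrightarrow> c = 0 \<or> x = \<zero>"
  using smult_cancel[of x "\<zero>" c] by auto

lemma smult_one_mult: "x \<in> carrier A \<Longrightarrow> (c \<odot> \<one>) \<otimes> x = c \<odot> x"
  by (simp add: smult_mult_left)

lemma smult_mult_one: "x \<in> carrier A \<Longrightarrow> x \<otimes> (c \<odot> \<one>) = c \<odot> x"
  by (simp add: smult_mult_right)

lemma minus_distrib_left: "\<lbrakk>x \<in> carrier A; y \<in> carrier A; z \<in> carrier A\<rbrakk> \<Longrightarrow> (x \<ominus> y) \<otimes> z = x \<otimes> z \<ominus> y \<otimes> z"
  by (simp add: minus_eq l_distr l_minus)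

lemma minus_distrib_right: "\<lbrakk>x \<in> carrier A; y \<in> carrier A; z \<in> carrier A\<rbrakk> \<Longrightarrow> z \<otimes> (x \<ominus> y) = z \<otimes> x \<ominus> z \<otimes> y"
  by (simp add: minus_eq r_distr r_minus)

lemma minus_eq_zero_iff: "\<lbrakk>x \<in> carrier A; y \<in> carrier A\<rbrakk> \<Longrightarrow> x \<ominus> y = \<zero> \<longleftrightarrow> x = y"
  by (metis a_inv_closed minus_equality minus_eq minus_minus r_neg)

lemma minus_swap: "\<lbrakk>x \<in> carrier A; y \<in> carrier A\<rbrakk> \<Longrightarrow> \<ominus> (x \<ominus> y) = y \<ominus> x"
  by (simp add: minus_eq minus_add a_comm)

lemma minus_add_cancel: "\<lbrakk>x \<in> carrier A; y \<in> carrier A\<rbrakk> \<Longrightarrow> (x \<ominus> y) \<oplus> y = x"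
  by (simp add: minus_eq a_assoc l_neg)

lemma minus_trans: "\<lbrakk>x \<in> carrier A; y \<in> carrier A; z \<in> carrier A\<rbrakk> \<Longrightarrow> x \<ominus> z = (x \<ominus> y) \<oplus> (y \<ominus> z)"
  by (simp add: minus_eq a_assoc r_neg1)

lemma add_minus_add: "\<lbrakk>x \<in> carrier A; y \<in> carrier A; z \<in> carrier A; w \<in> carrier A\<rbrakk>
    \<Longrightarrow> (x \<oplus> y) \<ominus> (z \<oplus> w) = (x \<ominus> z) \<oplus> (y \<ominus> w)"
  by (simp add: minus_eq minus_add a_ac)

lemma star_zero [simp]: "star A \<zero> = \<zero>"
  using star_smult[of "\<zero>" 0] star_closed[of \<zero>] by simp

lemma star_one [simp]: "star A \<one> = \<one>"
  by (metis one_closed r_one l_one star_closed star_mult star_star)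

lemma star_minus: "x \<in> carrier A \<Longrightarrow> star A (\<ominus> x) = \<ominus> (star A x)"
  using star_smult[of x "-1"] by (simp add: smult_minus_left star_closed)

lemma star_diff: "\<lbrakk>x \<in> carrier A; y \<in> carrier A\<rbrakk> \<Longrightarrow> star A (x \<ominus> y) = star A x \<ominus> star A y"
  by (simp add: minus_eq star_add star_minus)

declare star_closed [simp] star_star [simp]

lemma abelian_group: "abelian_group A" ..

lemma finsum_additive:
  assumes "h \<in> carrier A \<rightarrow> carrier A" "g \<in> I \<rightarrow> carrier A"
    and "\<And>x y. \<lbrakk>x \<in> carrier A; y \<in> carrier A\<rbrakk> \<Longrightarrow> h (x \<oplus> y) = h x \<oplus> h y"
  shows "h (\<Oplus>i\<in>I. g i) = (\<Oplus>i\<in>I. h (g i))"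
  using assms additive_finsum[OF abelian_group abelian_group, of h g I] by blast

lemma star_finsum: "g \<in> I \<rightarrow> carrier A \<Longrightarrow> star A (\<Oplus>i\<in>I. g i) = (\<Oplus>i\<in>I. star A (g i))"
  by (rule finsum_additive) (auto simp: star_add)

lemma smult_finsum: "g \<in> I \<rightarrow> carrier A \<Longrightarrow> c \<odot> (\<Oplus>i\<in>I. g i) = (\<Oplus>i\<in>I. c \<odot> (g i))"
  by (rule finsum_additive) (auto simp: smult_add_right)

lemma mult_finsum_right: "\<lbrakk>g \<in> I \<rightarrow> carrier A; a \<in> carrier A\<rbrakk> \<Longrightarrow> a \<otimes> (\<Oplus>i\<in>I. g i) = (\<Oplus>i\<in>I. a \<otimes> g i)"
  by (rule finsum_additive) (auto simp: r_distr)

lemma mult_finsum_left: "\<lbrakk>g \<in> I \<rightarrow> carrier A; a \<in> carrier A\<rbrakk> \<Longrightarrow> (\<Oplus>i\<in>I. g i) \<otimes> a = (\<Oplus>i\<in>I. g i \<otimes> a)"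
  by (rule finsum_additive[of "\<lambda>x. x \<otimes> a"]) (auto simp: l_distr)

lemma finsum_swap:
  assumes "finite I" "finite J" and g: "\<And>i j. \<lbrakk>i \<in> I; j \<in> J\<rbrakk> \<Longrightarrow> g i j \<in> carrier A"
  shows "(\<Oplus>i\<in>I. \<Oplus>j\<in>J. g i j) = (\<Oplus>j\<in>J. \<Oplus>i\<in>I. g i j)"
  using assms(1) g
proof (induction I rule: finite_induct)
  case empty
  then show ?case by simp
next
  case (insert i I)
  then have 1: "(\<lambda>i. \<Oplus>j\<in>J. g i j) \<in> I \<rightarrow> carrier A" and 2: "(\<Oplus>j\<in>J. g i j) \<in> carrier A"
    by (auto intro!: finsum_closed)
  have "(\<Oplus>j\<in>J. \<Oplus>i\<in>insert i I. g i j) = (\<Oplus>j\<in>J. g i j \<oplus> (\<Oplus>i\<in>I. g i j))"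
    using insert by (intro finsum_cong') (auto intro!: finsum_closed)
  also have "\<dots> = (\<Oplus>j\<in>J. g i j) \<oplus> (\<Oplus>j\<in>J. \<Oplus>i\<in>I. g i j)"
    using insert by (intro finsum_addf) (auto intro!: finsum_closed)
  finally show ?case using insert 1 2 by simp
qed

lemma nrm_zero [simp]: "nrm A \<zero> = 0"
  by (simp add: nrm_eq_0)

lemma nrm_uminus [simp]: "x \<in> carrier A \<Longrightarrow> nrm A (\<ominus> x) = nrm A x"
  by (simp add: minus_eq_smult nrm_smult)

lemma nrm_minus_commute: "\<lbrakk>x \<in> carrier A; y \<in> carrier A\<rbrakk> \<Longrightarrow> nrm A (x \<ominus> y) = nrm A (y \<ominus> x)"
  using nrm_uminus[of "x \<ominus> y"] by (simp add: minus_swap)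

lemma nrm_diff: "\<lbrakk>x \<in> carrier A; y \<in> carrier A\<rbrakk> \<Longrightarrow> nrm A (x \<ominus> y) \<le> nrm A x + nrm A y"
  using nrm_triangle[of x "\<ominus> y"] by (simp add: minus_eq)

lemma nrm_diff_triangle: "\<lbrakk>x \<in> carrier A; y \<in> carrier A; z \<in> carrier A\<rbrakk>
    \<Longrightarrow> nrm A (x \<ominus> z) \<le> nrm A (x \<ominus> y) + nrm A (y \<ominus> z)"
  using nrm_triangle[of "x \<ominus> y" "y \<ominus> z"] minus_trans[of x y z] by simp

text \<open>
  The C*-identity and submultiplicativity give \<open>\<parallel>x\<parallel>\<^sup>2 \<le> \<parallel>x\<^sup>*\<parallel> \<parallel>x\<parallel>\<close>, and likewise for \<open>x\<^sup>*\<close>.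
\<close>

lemma nrm_star [simp]:
  assumes x: "x \<in> carrier A" shows "nrm A (star A x) = nrm A x"
proof -
  have le: "nrm A y \<le> nrm A (star A y)" if y: "y \<in> carrier A" for y
  proof (cases "nrm A y = 0")
    case False
    have "nrm A y * nrm A y \<le> nrm A (star A y) * nrm A y"
      using nrm_cstar[OF y] nrm_mult[of "star A y" y] y by (simp add: power2_eq_square)
    then show ?thesis using False nrm_nonneg[OF y] by simp
  qed (simp add: nrm_nonneg y)
  from le[OF x] le[of "star A x"] x show ?thesis by simp
qed

lemma nrm_finsum: "\<lbrakk>finite I; g \<in> I \<rightarrow> carrier A\<rbrakk> \<Longrightarrow> nrm A (\<Oplus>i\<in>I. g i) \<le> (\<Sum>i\<in>I. nrm A (g i))"
proof (induction I rule: finite_induct)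
  case (insert i I)
  then have g: "g \<in> I \<rightarrow> carrier A" "g i \<in> carrier A" by auto
  then have "nrm A (g i \<oplus> (\<Oplus>i\<in>I. g i)) \<le> nrm A (g i) + nrm A (\<Oplus>i\<in>I. g i)"
    by (intro nrm_triangle finsum_closed)
  with insert g show ?case by simp
qed simp

lemma nrm_one_le: "nrm A \<one> \<le> 1"
proof (cases "nrm A \<one> = 0")
  case False
  have "nrm A \<one> = (nrm A \<one>)\<^sup>2" using nrm_cstar[of "\<one>"] by simp
  with False show ?thesis by (simp add: power2_eq_square)
qed simp

lemma nrm_real_one: "0 \<le> t \<Longrightarrow> nrm A (of_real t \<odot> \<one>) \<le> t"
  using nrm_one_le mult_left_mono[of "nrm A \<one>" 1 t] by (simp add: nrm_smult)

lemma nrm_sa_square: "\<lbrakk>x \<in> carrier A; star A x = x\<rbrakk> \<Longrightarrow> nrm A (x \<otimes> x) = (nrm A x)\<^sup>2"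
  using nrm_cstar[of x] by simp

lemma star_mult_zero: "\<lbrakk>x \<in> carrier A; star A x \<otimes> x = \<zero>\<rbrakk> \<Longrightarrow> x = \<zero>"
  using nrm_cstar[of x] nrm_eq_0[of x] by simp

section \<open>Convergence\<close>

text \<open>
  Sequential convergence spelled out in the norm; \<open>limitin_iff_tends\<close> and \<open>norm_closed_iff\<close> translate to
  and from the topology of the metric space.
\<close>

definition tends :: "(nat \<Rightarrow> 'a) \<Rightarrow> 'a \<Rightarrow> bool" where
  "tends s x \<longleftrightarrow> (\<forall>n. s n \<in> carrier A) \<and> x \<in> carrier A \<and> (\<lambda>n. nrm A (s n \<ominus> x)) \<longlonglongrightarrow> 0"

lemma tendsD: "tends s x \<Longrightarrow> s n \<in> carrier A" "tends s x \<Longrightarrow> x \<in> carrier A"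
  "tends s x \<Longrightarrow> (\<lambda>n. nrm A (s n \<ominus> x)) \<longlonglongrightarrow> 0"
  by (auto simp: tends_def)

lemma tendsI:
  assumes "\<And>n. s n \<in> carrier A" "x \<in> carrier A" "\<And>n. nrm A (s n \<ominus> x) \<le> c n" "c \<longlonglongrightarrow> 0"
  shows "tends s x"
  unfolding tends_def using assms
  by (auto intro!: real_tendsto_sandwich[OF _ _ tendsto_const assms(4)] always_eventually nrm_nonneg)

lemma tends_const: "x \<in> carrier A \<Longrightarrow> tends (\<lambda>_. x) x"
  by (rule tendsI[where c = "\<lambda>_. 0"]) (auto simp: minus_eq r_neg)

lemma tends_unique:
  assumes s: "tends s x" and r: "tends s y" shows "x = y"
proof -
  note [simp] = tendsD[OF s] tendsD[OF r]
  have "(\<lambda>n. nrm A (s n \<ominus> x) + nrm A (s n \<ominus> y)) \<longlonglongrightarrow> 0 + 0"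
    by (intro tendsto_add) simp_all
  moreover have "nrm A (x \<ominus> y) \<le> nrm A (s n \<ominus> x) + nrm A (s n \<ominus> y)" for n
    using nrm_diff_triangle[of x "s n" y] nrm_minus_commute[of "s n" x] by simp
  ultimately have "nrm A (x \<ominus> y) \<le> 0 + 0"
    by (intro LIMSEQ_le_const) auto
  then have "x \<ominus> y = \<zero>" using nrm_nonneg[of "x \<ominus> y"] nrm_eq_0[of "x \<ominus> y"] by simp
  then show ?thesis by (simp add: minus_eq_zero_iff)
qed

lemma tends_add:
  assumes s: "tends s x" and r: "tends r y" shows "tends (\<lambda>n. s n \<oplus> r n) (x \<oplus> y)"
proof (rule tendsI)
  note [simp] = tendsD[OF s] tendsD[OF r]
  show "nrm A (s n \<oplus> r n \<ominus> (x \<oplus> y)) \<le> nrm A (s n \<ominus> x) + nrm A (r n \<ominus> y)" for n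
    using nrm_triangle[of "s n \<ominus> x" "r n \<ominus> y"] by (simp add: add_minus_add)
  show "(\<lambda>n. nrm A (s n \<ominus> x) + nrm A (r n \<ominus> y)) \<longlonglongrightarrow> 0"
    using tendsto_add[OF tendsD(3)[OF s] tendsD(3)[OF r]] by simp
qed (use tendsD[OF s] tendsD[OF r] in auto)

lemma tends_linear:
  assumes s: "tends s x" and h: "h \<in> carrier A \<rightarrow> carrier A"
    and d: "\<And>x y. \<lbrakk>x \<in> carrier A; y \<in> carrier A\<rbrakk> \<Longrightarrow> h (x \<ominus> y) = h x \<ominus> h y"
    and b: "\<And>x. x \<in> carrier A \<Longrightarrow> nrm A (h x) \<le> C * nrm A x"
  shows "tends (\<lambda>n. h (s n)) (h x)"
proof (rule tendsI)
  note [simp] = tendsD[OF s]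
  show "nrm A (h (s n) \<ominus> h x) \<le> C * nrm A (s n \<ominus> x)" for n
    using b[of "s n \<ominus> x"] by (simp add: d)
  show "(\<lambda>n. C * nrm A (s n \<ominus> x)) \<longlonglongrightarrow> 0"
    using tendsto_mult_left[OF tendsD(3)[OF s], of C] by simp
qed (use tendsD[OF s] h in auto)

lemma tends_star: "tends s x \<Longrightarrow> tends (\<lambda>n. star A (s n)) (star A x)"
  by (erule tends_linear[where C = 1]) (auto simp: star_diff)

lemma tends_smult: "tends s x \<Longrightarrow> tends (\<lambda>n. c \<odot> (s n)) (c \<odot> x)"
  by (erule tends_linear[where C = "cmod c"]) (auto simp: smult_diff_right nrm_smult)

lemma tends_mult_left: "\<lbrakk>tends s x; a \<in> carrier A\<rbrakk> \<Longrightarrow> tends (\<lambda>n. a \<otimes> s n) (a \<otimes> x)"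
  by (erule tends_linear[where C = "nrm A a"]) (auto simp: minus_distrib_right nrm_mult)

lemma tends_mult_right: "\<lbrakk>tends s x; a \<in> carrier A\<rbrakk> \<Longrightarrow> tends (\<lambda>n. s n \<otimes> a) (x \<otimes> a)"
  by (erule tends_linear[where C = "nrm A a"])
     (auto simp: minus_distrib_left nrm_mult mult.commute[of "nrm A a"])

lemma tends_square:
  assumes s: "tends s x" and b: "\<And>n. nrm A (s n) \<le> C"
  shows "tends (\<lambda>n. s n \<otimes> s n) (x \<otimes> x)"
proof (rule tendsI)
  note [simp] = tendsD[OF s]
  show "nrm A (s n \<otimes> s n \<ominus> x \<otimes> x) \<le> (C + nrm A x) * nrm A (s n \<ominus> x)" for n
  proof -
    have "s n \<otimes> s n \<ominus> x \<otimes> x = s n \<otimes> (s n \<ominus> x) \<oplus> (s n \<ominus> x) \<otimes> x"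
      using minus_trans[of "s n \<otimes> s n" "s n \<otimes> x" "x \<otimes> x"]
      by (simp add: minus_distrib_left minus_distrib_right)
    then have "nrm A (s n \<otimes> s n \<ominus> x \<otimes> x) \<le> nrm A (s n \<otimes> (s n \<ominus> x)) + nrm A ((s n \<ominus> x) \<otimes> x)"
      by (simp add: nrm_triangle)
    also have "\<dots> \<le> nrm A (s n) * nrm A (s n \<ominus> x) + nrm A (s n \<ominus> x) * nrm A x"
      by (intro add_mono nrm_mult) simp_all
    also have "\<dots> \<le> (C + nrm A x) * nrm A (s n \<ominus> x)"
      using mult_right_mono[OF b[of n], of "nrm A (s n \<ominus> x)"] by (simp add: nrm_nonneg algebra_simps)
    finally show ?thesis .
  qed
  show "(\<lambda>n. (C + nrm A x) * nrm A (s n \<ominus> x)) \<longlonglongrightarrow> 0"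
    using tendsto_mult_left[OF tendsD(3)[OF s]] by simp
qed (use tendsD[OF s] in auto)

lemma tends_Suc: "tends s x \<Longrightarrow> tends (\<lambda>n. s (Suc n)) x"
  unfolding tends_def using LIMSEQ_Suc[of "\<lambda>n. nrm A (s n \<ominus> x)" 0] by auto

lemma metric: "Metric_space (carrier A) (cstar_dist A)"
proof
  fix x y z
  show "0 \<le> cstar_dist A x y" by (simp add: cstar_dist_def nrm_nonneg)
  show "cstar_dist A x y = cstar_dist A y x" by (simp add: cstar_dist_def nrm_minus_commute)
  show "cstar_dist A x y = 0 \<longleftrightarrow> x = y" if "x \<in> carrier A" "y \<in> carrier A"
    using that by (simp add: cstar_dist_def nrm_eq_0 minus_eq_zero_iff)
  show "cstar_dist A x z \<le> cstar_dist A x y + cstar_dist A y z"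
    if "x \<in> carrier A" "y \<in> carrier A" "z \<in> carrier A"
    using that by (simp add: cstar_dist_def nrm_diff_triangle)
qed

lemma limitin_iff_tends:
  assumes "\<And>n. s n \<in> carrier A"
  shows "limitin (Metric_space.mtopology (carrier A) (cstar_dist A)) s x sequentially \<longleftrightarrow> tends s x"
proof (cases "x \<in> carrier A")
  case True
  then show ?thesis using assms nrm_nonneg
    by (auto simp: Metric_space.limitin_metric_dist_null[OF metric] cstar_dist_def tends_def)
next
  case False
  then show ?thesis by (auto simp: Metric_space.limitin_metric[OF metric] tends_def)
qed

lemma cauchy_tends:
  assumes s: "\<And>n. s n \<in> carrier A"
    and C: "\<And>\<epsilon>. 0 < \<epsilon> \<Longrightarrow> \<exists>N. \<forall>m\<ge>N. \<forall>n\<ge>N. nrm A (s m \<ominus> s n) < \<epsilon>"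
  obtains x where "tends s x"
proof -
  have "Metric_space.MCauchy (carrier A) (cstar_dist A) s"
    unfolding Metric_space.MCauchy_def[OF metric]
    using s C by (auto simp: cstar_dist_def)
  with complete obtain x where
    "limitin (Metric_space.mtopology (carrier A) (cstar_dist A)) s x sequentially"
    unfolding Metric_space.mcomplete_def[OF metric] by blast
  with s that show ?thesis by (simp add: limitin_iff_tends)
qed

lemma norm_closed_iff:
  "norm_closed A S \<longleftrightarrow> S \<subseteq> carrier A \<and> (\<forall>s x. range s \<subseteq> S \<and> tends s x \<longrightarrow> x \<in> S)"
proof -
  have "range s \<subseteq> S \<Longrightarrow> S \<subseteq> carrier A \<Longrightarrow>
     limitin (Metric_space.mtopology (carrier A) (cstar_dist A)) s x sequentially \<longleftrightarrow> tends s x" for s x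
    by (rule limitin_iff_tends) auto
  then show ?thesis
    unfolding norm_closed_def Metric_space.metric_closedin_iff_sequentially_closed[OF metric] by blast
qed

lemma norm_closed_tends: "\<lbrakk>norm_closed A S; \<And>n. s n \<in> S; tends s x\<rbrakk> \<Longrightarrow> x \<in> S"
  unfolding norm_closed_iff by blast

end

section \<open>Square roots and positivity\<close>

lemma cstar_subalgebraD:
  assumes "cstar_subalgebra C A"
  shows "subring C A" "C \<subseteq> carrier A" "\<one>\<^bsub>A\<^esub> \<in> C" "\<zero>\<^bsub>A\<^esub> \<in> C"
    "\<And>x y. \<lbrakk>x \<in> C; y \<in> C\<rbrakk> \<Longrightarrow> x \<oplus>\<^bsub>A\<^esub> y \<in> C"
    "\<And>x y. \<lbrakk>x \<in> C; y \<in> C\<rbrakk> \<Longrightarrow> x \<otimes>\<^bsub>A\<^esub> y \<in> C"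
    "\<And>x. x \<in> C \<Longrightarrow> \<ominus>\<^bsub>A\<^esub> x \<in> C"
    "\<And>x y. \<lbrakk>x \<in> C; y \<in> C\<rbrakk> \<Longrightarrow> x \<ominus>\<^bsub>A\<^esub> y \<in> C"
    "\<And>c x. x \<in> C \<Longrightarrow> c \<odot>\<^bsub>A\<^esub> x \<in> C"
    "\<And>x. x \<in> C \<Longrightarrow> star A x \<in> C"
    "norm_closed A C"
  using assms subringE[of C A] unfolding cstar_subalgebra_def by (auto simp: a_minus_def)

text \<open>
  The scalar case \<open>u = 1\<close> of the iteration \<open>y \<mapsto> (u + y\<^sup>2)/2\<close>. Its increments bound those of the iteration
  in the algebra for every \<open>u\<close> of norm at most 1, and they are summable because the sequence is
  monotone and bounded.
\<close>

fun sqrt_majorant :: "nat \<Rightarrow> real" where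
  "sqrt_majorant 0 = 0"
| "sqrt_majorant (Suc n) = (1 + (sqrt_majorant n)\<^sup>2) / 2"

lemma majorant_difference:
  fixes p q r :: real
  assumes r: "r = (1 + q\<^sup>2) / 2" and q: "q = (1 + p\<^sup>2) / 2"
  shows "(q - p) * (q + p) = 2 * (r - q)"
proof -
  have "2 * r = 1 + q\<^sup>2" by (simp add: r)
  moreover have "2 * q = 1 + p\<^sup>2" by (simp add: q)
  moreover have "(q - p) * (q + p) = q\<^sup>2 - p\<^sup>2" by (simp add: power2_eq_square algebra_simps)
  ultimately show ?thesis by (simp only: right_diff_distrib)
qed

lemma sqrt_majorant_bounds: "0 \<le> sqrt_majorant n \<and> sqrt_majorant n \<le> 1"
proof (induction n)
  case (Suc n)
  then have "(sqrt_majorant n)\<^sup>2 \<le> 1" by (simp add: power_le_one)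
  then show ?case by simp
qed simp

lemma sqrt_majorant_Suc_le: "sqrt_majorant n \<le> sqrt_majorant (Suc n)"
  using zero_le_power2[of "1 - sqrt_majorant n"] by (simp add: power2_eq_square algebra_simps)

lemma sqrt_majorant_convergent: "convergent sqrt_majorant"
proof (rule Bseq_monoseq_convergent)
  show "Bseq sqrt_majorant"
    by (rule BseqI'[where K = 1]) (use sqrt_majorant_bounds in auto)
  show "monoseq sqrt_majorant"
    by (rule incseq_imp_monoseq) (use sqrt_majorant_Suc_le in \<open>auto simp: incseq_Suc_iff\<close>)
qed

context cstar_algebra
begin

lemma minus_self: "x \<in> carrier A \<Longrightarrow> x \<ominus> x = \<zero>"
  by (simp add: minus_eq r_neg)

text \<open>
  A fixed point \<open>y = (u + y\<^sup>2)/2\<close> satisfies \<open>(1 - y)\<^sup>2 = 1 - u\<close>.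
\<close>

fun sqrt_iterate :: "'a \<Rightarrow> nat \<Rightarrow> 'a" where
  "sqrt_iterate u 0 = \<zero>"
| "sqrt_iterate u (Suc n) = (1/2) \<odot> (u \<oplus> sqrt_iterate u n \<otimes> sqrt_iterate u n)"

lemma sqrt_iterate_closed [simp]: "u \<in> carrier A \<Longrightarrow> sqrt_iterate u n \<in> carrier A"
  by (induction n) auto

lemma sqrt_iterate_star: "\<lbrakk>u \<in> carrier A; star A u = u\<rbrakk> \<Longrightarrow> star A (sqrt_iterate u n) = sqrt_iterate u n"
  by (induction n) (auto simp: star_smult star_add star_mult)

lemma sqrt_iterate_subalgebra: "\<lbrakk>cstar_subalgebra C A; u \<in> C\<rbrakk> \<Longrightarrow> sqrt_iterate u n \<in> C"
  by (induction n) (auto simp: cstar_subalgebraD)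

lemma commute_square:
  assumes "z \<in> carrier A" "y \<in> carrier A" "z \<otimes> y = y \<otimes> z"
  shows "z \<otimes> (y \<otimes> y) = (y \<otimes> y) \<otimes> z"
  using assms by (metis m_assoc)

lemma sqrt_iterate_commute:
  assumes "u \<in> carrier A" "z \<in> carrier A" "z \<otimes> u = u \<otimes> z"
  shows "z \<otimes> sqrt_iterate u n = sqrt_iterate u n \<otimes> z"
proof (induction n)
  case (Suc n)
  then show ?case using assms commute_square[OF assms(2) _ Suc]
    by (simp add: smult_mult_left smult_mult_right l_distr r_distr)
qed (use assms in simp)

lemma sqrt_iterate_bound:
  assumes u: "u \<in> carrier A" "nrm A u \<le> 1"
  shows "nrm A (sqrt_iterate u n) \<le> sqrt_majorant n"
proof (induction n)
  case (Suc n)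
  let ?y = "sqrt_iterate u n"
  have "nrm A (u \<oplus> ?y \<otimes> ?y) \<le> nrm A u + nrm A ?y * nrm A ?y"
    using nrm_triangle[of u "?y \<otimes> ?y"] nrm_mult[of ?y ?y] u by simp
  also have "\<dots> \<le> 1 + sqrt_majorant n * sqrt_majorant n"
    using u Suc by (intro add_mono mult_mono) (auto simp: nrm_nonneg sqrt_majorant_bounds)
  finally show ?case using u by (simp add: nrm_smult power2_eq_square)
qed simp

text \<open>
  All iterates commute, so the difference of two consecutive squares factors as for numbers and the
  bound propagates by induction.
\<close>

lemma sqrt_iterate_step:
  assumes u: "u \<in> carrier A" "nrm A u \<le> 1"
  shows "nrm A (sqrt_iterate u (Suc n) \<ominus> sqrt_iterate u n) \<le> sqrt_majorant (Suc n) - sqrt_majorant n"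
proof (induction n)
  case 0
  have "(1/2) \<odot> (u \<oplus> \<zero> \<otimes> \<zero>) \<ominus> \<zero> = (1/2) \<odot> u" using u by (simp add: minus_eq)
  then show ?case using u by (simp add: nrm_smult)
next
  case (Suc n)
  let ?x = "sqrt_iterate u n" and ?y = "sqrt_iterate u (Suc n)"
  have c: "?x \<in> carrier A" "?y \<in> carrier A" using u by (simp_all del: sqrt_iterate.simps)
  have "?x \<otimes> u = u \<otimes> ?x" by (rule sqrt_iterate_commute[OF u(1) u(1) refl, symmetric])
  then have comm: "?x \<otimes> ?y = ?y \<otimes> ?x" by (rule sqrt_iterate_commute[OF u(1) c(1)])
  have "?y \<otimes> ?y \<ominus> ?x \<otimes> ?x = (?y \<otimes> ?y \<ominus> ?x \<otimes> ?y) \<oplus> (?x \<otimes> ?y \<ominus> ?x \<otimes> ?x)"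
    using c by (intro minus_trans m_closed)
  also have "\<dots> = (?y \<ominus> ?x) \<otimes> (?y \<oplus> ?x)"
    using c comm by (simp add: minus_distrib_left minus_distrib_right r_distr del: sqrt_iterate.simps)
  finally have prod: "?y \<otimes> ?y \<ominus> ?x \<otimes> ?x = (?y \<ominus> ?x) \<otimes> (?y \<oplus> ?x)" .
  have "sqrt_iterate u (Suc (Suc n)) \<ominus> ?y = (1/2) \<odot> ((u \<oplus> ?y \<otimes> ?y) \<ominus> (u \<oplus> ?x \<otimes> ?x))"
    using u c by (simp add: smult_diff_right)
  also have "(u \<oplus> ?y \<otimes> ?y) \<ominus> (u \<oplus> ?x \<otimes> ?x) = ?y \<otimes> ?y \<ominus> ?x \<otimes> ?x"
    using u c by (simp add: add_minus_add minus_self del: sqrt_iterate.simps)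
  finally have eq: "sqrt_iterate u (Suc (Suc n)) \<ominus> ?y = (1/2) \<odot> ((?y \<ominus> ?x) \<otimes> (?y \<oplus> ?x))"
    using prod by simp
  have "nrm A ((?y \<ominus> ?x) \<otimes> (?y \<oplus> ?x)) \<le> nrm A (?y \<ominus> ?x) * nrm A (?y \<oplus> ?x)"
    using c by (intro nrm_mult) (simp_all del: sqrt_iterate.simps)
  also have "\<dots> \<le> (sqrt_majorant (Suc n) - sqrt_majorant n) * (sqrt_majorant (Suc n) + sqrt_majorant n)"
  proof (rule mult_mono[OF Suc])
    show "nrm A (?y \<oplus> ?x) \<le> sqrt_majorant (Suc n) + sqrt_majorant n"
      using nrm_triangle[OF c(2,1)] sqrt_iterate_bound[OF u, of n] sqrt_iterate_bound[OF u, of "Suc n"]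
      by linarith
    show "0 \<le> sqrt_majorant (Suc n) - sqrt_majorant n" using sqrt_majorant_Suc_le[of n] by linarith
    show "0 \<le> nrm A (?y \<oplus> ?x)" using c by (intro nrm_nonneg) (simp del: sqrt_iterate.simps)
  qed
  also have "\<dots> = 2 * (sqrt_majorant (Suc (Suc n)) - sqrt_majorant (Suc n))"
    by (rule majorant_difference[OF sqrt_majorant.simps(2) sqrt_majorant.simps(2)])
  finally show ?case unfolding eq using c by (simp add: nrm_smult del: sqrt_iterate.simps sqrt_majorant.simps)
qed

lemma sqrt_iterate_diff:
  assumes u: "u \<in> carrier A" "nrm A u \<le> 1" and mn: "m \<le> n"
  shows "nrm A (sqrt_iterate u n \<ominus> sqrt_iterate u m) \<le> sqrt_majorant n - sqrt_majorant m"
  using mn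
proof (induction n rule: dec_induct)
  case base
  then show ?case using u by (simp add: minus_eq r_neg)
next
  case (step n)
  then show ?case
    using sqrt_iterate_step[OF u, of n] u
      nrm_diff_triangle[of "sqrt_iterate u (Suc n)" "sqrt_iterate u n" "sqrt_iterate u m"]
    by (simp del: sqrt_iterate.simps sqrt_majorant.simps)
qed

text \<open>
  The root is a limit of polynomials in \<open>u\<close>, which is why it commutes with everything that commutes
  with \<open>u\<close> and lies in every C*-subalgebra containing \<open>u\<close>. The norm bound makes the root itself positive.
\<close>

lemma sqrt_one_minus:
  assumes u: "u \<in> carrier A" "star A u = u" "nrm A u \<le> 1"
  obtains s where "s \<in> carrier A" "star A s = s" "s \<otimes> s = \<one> \<ominus> u" "nrm A (\<one> \<ominus> s) \<le> 1"
    "\<And>z. \<lbrakk>z \<in> carrier A; z \<otimes> u = u \<otimes> z\<rbrakk> \<Longrightarrow> z \<otimes> s = s \<otimes> z"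
    "\<And>C. \<lbrakk>cstar_subalgebra C A; u \<in> C\<rbrakk> \<Longrightarrow> s \<in> C"
proof -
  let ?y = "sqrt_iterate u"
  have "\<exists>N. \<forall>m\<ge>N. \<forall>n\<ge>N. nrm A (?y m \<ominus> ?y n) < \<epsilon>" if "0 < \<epsilon>" for \<epsilon>
  proof -
    have "Cauchy sqrt_majorant" using sqrt_majorant_convergent by (rule convergent_Cauchy)
    then obtain N where N: "\<And>m n. \<lbrakk>m \<ge> N; n \<ge> N\<rbrakk> \<Longrightarrow> \<bar>sqrt_majorant m - sqrt_majorant n\<bar> < \<epsilon>"
      using \<open>0 < \<epsilon>\<close> unfolding Cauchy_def dist_real_def by metis
    have "nrm A (?y m \<ominus> ?y n) < \<epsilon>" if "m \<ge> N" "n \<ge> N" for m n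
      using sqrt_iterate_diff[OF u(1,3), of m n] sqrt_iterate_diff[OF u(1,3), of n m] N[OF that]
        nrm_minus_commute[of "?y m" "?y n"] u by (cases "m \<le> n") auto
    then show ?thesis by blast
  qed
  then obtain y where y: "tends ?y y" using cauchy_tends[of ?y] sqrt_iterate_closed[OF u(1)] by blast
  note yc [simp] = tendsD(2)[OF y]
  have "tends (\<lambda>n. ?y n \<otimes> ?y n) (y \<otimes> y)"
    by (rule tends_square[OF y, of 1]) (meson order_trans sqrt_iterate_bound[OF u(1,3)] sqrt_majorant_bounds)
  then have "tends (\<lambda>n. (1/2) \<odot> (u \<oplus> ?y n \<otimes> ?y n)) ((1/2) \<odot> (u \<oplus> y \<otimes> y))"
    using u by (intro tends_smult tends_add tends_const)
  then have "tends (\<lambda>n. ?y (Suc n)) ((1/2) \<odot> (u \<oplus> y \<otimes> y))" by simp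
  then have yeq: "y = (1/2) \<odot> (u \<oplus> y \<otimes> y)" using tends_unique tends_Suc[OF y] by blast
  have ystar: "star A y = y"
    using tends_unique[OF tends_star[OF y]] y u by (simp add: sqrt_iterate_star)
  have two: "y \<oplus> y = u \<oplus> y \<otimes> y"
  proof -
    have "y \<oplus> y = (2::complex) \<odot> y" using smult_add_left[of y 1 1] by simp
    also have "\<dots> = (2::complex) \<odot> ((1/2) \<odot> (u \<oplus> y \<otimes> y))" using yeq by simp
    also have "\<dots> = u \<oplus> y \<otimes> y" using u by (subst smult_smult) auto
    finally show ?thesis .
  qed
  show ?thesis
  proof (rule that[of "\<one> \<ominus> y"])
    have "(\<lambda>n. 1 + nrm A (?y n \<ominus> y)) \<longlonglongrightarrow> 1 + 0"
      by (intro tendsto_add tendsto_const tendsD(3)[OF y])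
    moreover have "nrm A y \<le> 1 + nrm A (?y n \<ominus> y)" for n
    proof -
      have "y = ?y n \<ominus> (?y n \<ominus> y)" using u by (simp add: minus_eq minus_add r_neg1 flip: a_assoc) (simp add: r_neg)
      then have "nrm A y \<le> nrm A (?y n) + nrm A (?y n \<ominus> y)"
        using nrm_diff[of "?y n" "?y n \<ominus> y"] u by simp
      then show ?thesis using sqrt_iterate_bound[OF u(1,3), of n] sqrt_majorant_bounds[of n] by linarith
    qed
    ultimately have "nrm A y \<le> 1" using LIMSEQ_le_const[of "\<lambda>n. 1 + nrm A (?y n \<ominus> y)" 1 "nrm A y"] by auto
    moreover have "\<one> \<ominus> (\<one> \<ominus> y) = y" by (simp add: minus_eq minus_add r_neg1 flip: a_assoc) (simp add: r_neg)
    ultimately show "nrm A (\<one> \<ominus> (\<one> \<ominus> y)) \<le> 1" by simp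
    show "star A (\<one> \<ominus> y) = \<one> \<ominus> y" by (simp add: star_diff ystar)
    have "(\<one> \<ominus> y) \<otimes> (\<one> \<ominus> y) = \<one> \<oplus> y \<otimes> y \<oplus> \<ominus> (y \<oplus> y)"
      by (simp add: minus_eq l_distr r_distr l_minus r_minus minus_add a_ac)
    also have "\<dots> = \<one> \<ominus> u" unfolding two using u by (simp add: minus_eq minus_add a_ac r_neg1 r_neg2 r_neg l_neg)
    finally show "(\<one> \<ominus> y) \<otimes> (\<one> \<ominus> y) = \<one> \<ominus> u" .
    show "z \<otimes> (\<one> \<ominus> y) = (\<one> \<ominus> y) \<otimes> z" if z: "z \<in> carrier A" "z \<otimes> u = u \<otimes> z" for z
    proof -
      have "tends (\<lambda>n. z \<otimes> ?y n) (z \<otimes> y)" "tends (\<lambda>n. ?y n \<otimes> z) (y \<otimes> z)"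
        using y z by (auto intro: tends_mult_left tends_mult_right)
      then have "z \<otimes> y = y \<otimes> z"
        using tends_unique sqrt_iterate_commute[OF u(1) z] by (metis (no_types, lifting) ext)
      then show ?thesis using z by (simp add: minus_distrib_left minus_distrib_right)
    qed
    show "\<one> \<ominus> y \<in> C" if C: "cstar_subalgebra C A" "u \<in> C" for C
    proof -
      have "y \<in> C" by (rule norm_closed_tends[OF cstar_subalgebraD(11)[OF C(1)] sqrt_iterate_subalgebra[OF C] y])
      then show ?thesis using C by (simp add: cstar_subalgebraD)
    qed
  qed simp
qed

text \<open>
  Taking this as the definition of positivity makes the positive elements a convex cone by the triangle
  inequality alone. That they are exactly the elements \<open>y\<^sup>* y\<close> is \<open>positive_iff_pos\<close>.
\<close>

definition pos :: "'a \<Rightarrow> bool" where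
  "pos a \<longleftrightarrow> a \<in> carrier A \<and> star A a = a \<and>
     (\<exists>t\<ge>0. nrm A (of_real t \<odot> \<one> \<ominus> a) \<le> t)"

lemma posD: "pos a \<Longrightarrow> a \<in> carrier A" "pos a \<Longrightarrow> star A a = a"
  by (auto simp: pos_def)

lemma pos_zero [simp]: "pos \<zero>"
  unfolding pos_def by (auto intro!: exI[of _ 0] simp: minus_eq)

lemma pos_add: assumes a: "pos a" and b: "pos b" shows "pos (a \<oplus> b)"
proof -
  obtain t where t: "t \<ge> 0" "nrm A (of_real t \<odot> \<one> \<ominus> a) \<le> t" using a by (auto simp: pos_def)
  obtain r where r: "r \<ge> 0" "nrm A (of_real r \<odot> \<one> \<ominus> b) \<le> r" using b by (auto simp: pos_def)
  note [simp] = posD[OF a] posD[OF b]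
  have "of_real (t + r) \<odot> \<one> \<ominus> (a \<oplus> b)
      = (of_real t \<odot> \<one> \<ominus> a) \<oplus> (of_real r \<odot> \<one> \<ominus> b)"
    by (simp add: smult_add_left add_minus_add)
  then have "nrm A (of_real (t + r) \<odot> \<one> \<ominus> (a \<oplus> b)) \<le> t + r"
    using nrm_triangle[of "of_real t \<odot> \<one> \<ominus> a" "of_real r \<odot> \<one> \<ominus> b"] t r by simp
  with t r show ?thesis unfolding pos_def by (auto simp: star_add intro!: exI[of _ "t + r"])
qed

lemma pos_smult: assumes a: "pos a" and c: "0 \<le> c" shows "pos (of_real c \<odot> a)"
proof -
  obtain t where t: "t \<ge> 0" "nrm A (of_real t \<odot> \<one> \<ominus> a) \<le> t" using a by (auto simp: pos_def)
  note [simp] = posD[OF a]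
  have "of_real (c * t) \<odot> \<one> \<ominus> of_real c \<odot> a
      = of_real c \<odot> (of_real t \<odot> \<one> \<ominus> a)"
    by (simp add: smult_diff_right)
  then have "nrm A (of_real (c * t) \<odot> \<one> \<ominus> of_real c \<odot> a) \<le> c * t"
    using t c by (simp add: nrm_smult mult_left_mono)
  with t c show ?thesis unfolding pos_def by (auto simp: star_smult intro!: exI[of _ "c * t"])
qed

lemma pos_finsum: "\<lbrakk>finite I; \<And>i. i \<in> I \<Longrightarrow> pos (g i)\<rbrakk> \<Longrightarrow> pos (\<Oplus>i\<in>I. g i)"
proof (induction I rule: finite_induct)
  case (insert i I)
  then have "g \<in> I \<rightarrow> carrier A" "g i \<in> carrier A" by (auto dest: posD)
  with insert show ?case by (simp add: pos_add)
qed simp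

lemma pos_sqrt:
  assumes a: "pos a"
  obtains b where "b \<in> carrier A" "star A b = b" "b \<otimes> b = a" "pos b"
    "\<And>z. \<lbrakk>z \<in> carrier A; z \<otimes> a = a \<otimes> z\<rbrakk> \<Longrightarrow> z \<otimes> b = b \<otimes> z"
    "\<And>C. \<lbrakk>cstar_subalgebra C A; a \<in> C\<rbrakk> \<Longrightarrow> b \<in> C"
proof -
  obtain t where t: "t \<ge> 0" "nrm A (of_real t \<odot> \<one> \<ominus> a) \<le> t" using a by (auto simp: pos_def)
  note [simp] = posD[OF a]
  show ?thesis
  proof (cases "t = 0")
    case True
    then have "nrm A (\<zero> \<ominus> a) = 0" using t nrm_nonneg[of "\<zero> \<ominus> a"] by simp
    then have "a = \<zero>" using nrm_eq_0[of "\<zero> \<ominus> a"] minus_eq_zero_iff[of "\<zero>" a] by simp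
    then show ?thesis by (intro that[of "\<zero>"]) (auto simp: cstar_subalgebraD)
  next
    case False
    with t have tp: "t > 0" by simp
    define u where "u = \<one> \<ominus> of_real (1/t) \<odot> a"
    have ueq: "u = of_real (1/t) \<odot> (of_real t \<odot> \<one> \<ominus> a)"
      using tp by (simp add: u_def smult_diff_right flip: of_real_mult)
    have uc: "u \<in> carrier A" "star A u = u" by (simp_all add: u_def star_diff star_smult)
    have "nrm A u \<le> 1" unfolding ueq using tp t by (simp add: nrm_smult norm_divide divide_simps)
    with uc obtain s where s: "s \<in> carrier A" "star A s = s" "s \<otimes> s = \<one> \<ominus> u" "nrm A (\<one> \<ominus> s) \<le> 1"
      and comm: "\<And>z. \<lbrakk>z \<in> carrier A; z \<otimes> u = u \<otimes> z\<rbrakk> \<Longrightarrow> z \<otimes> s = s \<otimes> z"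
      and C: "\<And>C. \<lbrakk>cstar_subalgebra C A; u \<in> C\<rbrakk> \<Longrightarrow> s \<in> C"
      using sqrt_one_minus[of u] by blast
    have ua: "\<one> \<ominus> u = of_real (1/t) \<odot> a"
      unfolding u_def by (simp add: minus_eq minus_add r_neg1 flip: a_assoc) (simp add: r_neg)
    show ?thesis
    proof (rule that[of "of_real (sqrt t) \<odot> s"])
      have "(of_real (sqrt t) \<odot> s) \<otimes> (of_real (sqrt t) \<odot> s) = of_real t \<odot> (s \<otimes> s)"
        using s(1) t by (simp add: smult_mult_left smult_mult_right flip: of_real_mult)
      also have "\<dots> = a" unfolding s(3) ua using tp by (simp flip: of_real_mult)
      finally show "(of_real (sqrt t) \<odot> s) \<otimes> (of_real (sqrt t) \<odot> s) = a" .
      have "pos s" using s unfolding pos_def by (auto intro!: exI[of _ 1])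
      then show "pos (of_real (sqrt t) \<odot> s)" using t by (intro pos_smult) auto
      show "z \<otimes> (of_real (sqrt t) \<odot> s) = of_real (sqrt t) \<odot> s \<otimes> z"
        if z: "z \<in> carrier A" "z \<otimes> a = a \<otimes> z" for z
      proof -
        have "z \<otimes> u = u \<otimes> z" using z
          by (simp add: u_def minus_distrib_left minus_distrib_right smult_mult_left smult_mult_right)
        then show ?thesis using comm[OF z(1)] z s by (simp add: smult_mult_left smult_mult_right)
      qed
      show "of_real (sqrt t) \<odot> s \<in> C" if "cstar_subalgebra C A" "a \<in> C" for C
        using that C[of C] by (simp add: u_def cstar_subalgebraD)
    qed (use s in \<open>auto simp: star_smult\<close>)
  qed
qed

lemma unitary_norm: "\<lbrakk>u \<in> carrier A; star A u \<otimes> u = of_real t \<odot> \<one>; 0 \<le> t\<rbrakk> \<Longrightarrow> (nrm A u)\<^sup>2 \<le> t"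
  using nrm_cstar[of u] nrm_real_one[of t] by simp

text \<open>
  The elements \<open>b + i c\<close> and \<open>b - i c\<close> are multiples of unitaries, so their norm is known, and \<open>c\<close> is half
  their difference up to the factor \<open>i\<close>.
\<close>

lemma sum_square_norm:
  assumes b: "b \<in> carrier A" "star A b = b" and c: "c \<in> carrier A" "star A c = c"
    and comm: "b \<otimes> c = c \<otimes> b" and eq: "b \<otimes> b \<oplus> c \<otimes> c = of_real t \<odot> \<one>" and t: "0 \<le> t"
  shows "(nrm A c)\<^sup>2 \<le> t"
proof -
  let ?u = "b \<oplus> \<i> \<odot> c" and ?v = "b \<ominus> \<i> \<odot> c"
  have sv: "star A ?u = ?v" using b c by (simp add: star_add star_smult smult_minus_left minus_eq)
  have su: "star A ?v = ?u" using b c by (simp add: star_diff star_smult smult_minus_left) (simp add: minus_eq)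
  have vu: "?v \<otimes> ?u = of_real t \<odot> \<one>"
    using b c comm unfolding eq[symmetric]
    by (simp add: minus_eq l_distr r_distr l_minus smult_mult_left smult_mult_right smult_minus_left
        smult_minus_right smult_add_right minus_add r_neg a_ac r_neg1 r_neg2)
  have uv: "?u \<otimes> ?v = of_real t \<odot> \<one>"
    using b c comm unfolding eq[symmetric]
    by (simp add: minus_eq l_distr r_distr r_minus smult_mult_left smult_mult_right smult_minus_left
        smult_minus_right smult_add_right minus_add r_neg a_ac r_neg1 r_neg2)
  have "(nrm A ?u)\<^sup>2 \<le> t" "(nrm A ?v)\<^sup>2 \<le> t"
    using unitary_norm[of ?u t] unitary_norm[of ?v t] b c t sv su vu uv by auto
  then have n: "nrm A ?u \<le> sqrt t" "nrm A ?v \<le> sqrt t" by (auto intro: real_le_rsqrt)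
  have "(2 * \<i>) \<odot> c = \<i> \<odot> c \<oplus> \<i> \<odot> c" using smult_add_left[of c \<i> \<i>] c by simp
  also have "\<dots> = ?u \<ominus> ?v" using b c
    by (simp add: minus_eq minus_add a_ac r_neg1 r_neg2 smult_minus_left)
  finally have "nrm A ((2 * \<i>) \<odot> c) = nrm A (?u \<ominus> ?v)" by simp
  then have "2 * nrm A c \<le> nrm A ?u + nrm A ?v"
    using nrm_diff[of ?u ?v] b c by (simp add: nrm_smult norm_mult)
  then have "nrm A c \<le> sqrt t" using n by simp
  then show ?thesis using nrm_nonneg[OF c(1)] t by (metis power_mono real_sqrt_pow2)
qed

text \<open>
  For \<open>b\<close> of norm at most 1, the root \<open>s\<close> of \<open>1 - b\<^sup>2\<close> makes \<open>b + i s\<close> unitary. So \<open>s\<close> has norm at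
  most 1, and so has \<open>1 - b\<^sup>2 = s\<^sup>2\<close>.
\<close>

lemma pos_square:
  assumes b: "b \<in> carrier A" "star A b = b" shows "pos (b \<otimes> b)"
proof -
  have contr: "nrm A (\<one> \<ominus> b \<otimes> b) \<le> 1" if b: "b \<in> carrier A" "star A b = b" "nrm A b \<le> 1" for b
  proof -
    have "nrm A (b \<otimes> b) \<le> 1" using nrm_sa_square[OF b(1,2)] b nrm_nonneg[OF b(1)] by (simp add: power_le_one)
    then obtain s where s: "s \<in> carrier A" "star A s = s" "s \<otimes> s = \<one> \<ominus> b \<otimes> b"
      and comm: "\<And>z. \<lbrakk>z \<in> carrier A; z \<otimes> (b \<otimes> b) = (b \<otimes> b) \<otimes> z\<rbrakk> \<Longrightarrow> z \<otimes> s = s \<otimes> z"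
      using sqrt_one_minus[of "b \<otimes> b"] b by (metis m_closed star_mult)
    have "b \<otimes> s = s \<otimes> b" using comm[of b] b by (simp add: m_assoc)
    moreover have "b \<otimes> b \<oplus> s \<otimes> s = of_real 1 \<odot> \<one>"
      using s b by (simp add: a_comm[of "b \<otimes> b"] minus_add_cancel)
    ultimately have "(nrm A s)\<^sup>2 \<le> 1" using sum_square_norm[of b s 1] b s by simp
    then show ?thesis using nrm_sa_square[OF s(1,2)] s by simp
  qed
  show ?thesis
  proof (cases "nrm A b = 0")
    case True
    then have "b = \<zero>" using b nrm_eq_0 by blast
    then show ?thesis by simp
  next
    case False
    define n where "n = nrm A b"
    have n: "n > 0" using False nrm_nonneg[OF b(1)] by (simp add: n_def)
    define c where "c = of_real (1/n) \<odot> b"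
    have c: "c \<in> carrier A" "star A c = c" "nrm A c \<le> 1"
      using b n by (simp_all add: c_def star_smult nrm_smult norm_divide) (simp add: n_def)
    have cc: "star A (c \<otimes> c) = c \<otimes> c" using c by (simp add: star_mult)
    have "pos (c \<otimes> c)" using contr[OF c] c cc unfolding pos_def by (auto intro!: exI[of _ 1])
    then have "pos (of_real (n * n) \<odot> (c \<otimes> c))" using n by (intro pos_smult) auto
    also have "of_real (n * n) \<odot> (c \<otimes> c) = b \<otimes> b"
      using n b by (simp add: c_def smult_mult_left smult_mult_right)
    finally show ?thesis .
  qed
qed

text \<open>
  The defining inequality holds with \<open>t = \<parallel>a\<parallel>\<close>, because \<open>t - (t - a) = a\<close>.
\<close>

lemma pos_norm_minus: "\<lbrakk>a \<in> carrier A; star A a = a\<rbrakk> \<Longrightarrow> pos (of_real (nrm A a) \<odot> \<one> \<ominus> a)"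
proof -
  assume a: "a \<in> carrier A" "star A a = a"
  have "of_real (nrm A a) \<odot> \<one> \<ominus> (of_real (nrm A a) \<odot> \<one> \<ominus> a) = a"
    using a smult_closed[of "\<one>"] by algebra
  then show ?thesis unfolding pos_def using a nrm_nonneg[OF a(1)]
    by (auto simp: star_diff star_smult intro!: exI[of _ "nrm A a"])
qed

text \<open>
  The roots \<open>b\<close> of \<open>a\<close> and \<open>c\<close> of \<open>t - a\<close> commute and their squares add up to \<open>t\<close>.
\<close>

lemma pos_le_norm:
  assumes a: "pos a" and ta: "pos (of_real t \<odot> \<one> \<ominus> a)" and t: "0 \<le> t"
  shows "nrm A a \<le> t"
proof -
  note [simp] = posD[OF a]
  obtain b where b: "b \<in> carrier A" "star A b = b" "b \<otimes> b = a"
    and bc: "\<And>z. \<lbrakk>z \<in> carrier A; z \<otimes> a = a \<otimes> z\<rbrakk> \<Longrightarrow> z \<otimes> b = b \<otimes> z" using pos_sqrt[OF a] by metis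
  obtain c where c: "c \<in> carrier A" "star A c = c" "c \<otimes> c = of_real t \<odot> \<one> \<ominus> a"
    and cc: "\<And>z. \<lbrakk>z \<in> carrier A; z \<otimes> (of_real t \<odot> \<one> \<ominus> a) = (of_real t \<odot> \<one> \<ominus> a) \<otimes> z\<rbrakk>
       \<Longrightarrow> z \<otimes> c = c \<otimes> z" using pos_sqrt[OF ta] by metis
  have "a \<otimes> c = c \<otimes> a"
    by (rule cc) (simp_all add: minus_distrib_left minus_distrib_right smult_mult_left smult_mult_right)
  then have "c \<otimes> b = b \<otimes> c" using bc[of c] c by simp
  moreover have "c \<otimes> c \<oplus> b \<otimes> b = of_real t \<odot> \<one>"
    unfolding b c by (simp add: minus_add_cancel)
  ultimately have "(nrm A b)\<^sup>2 \<le> t" using sum_square_norm[of c b t] b c t by simp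
  then show ?thesis using nrm_sa_square[OF b(1,2)] b by simp
qed

lemma pos_antisym:
  assumes a: "pos a" and b: "pos (\<ominus> a)" shows "a = \<zero>"
proof -
  note [simp] = posD[OF a]
  have "nrm A a \<le> 0" using pos_le_norm[OF a, of 0] b by (simp add: minus_eq)
  then show ?thesis using nrm_nonneg[of a] nrm_eq_0[of a] by simp
qed

lemma norm_mono:
  assumes a: "pos a" and ab: "pos (b \<ominus> a)" and b: "b \<in> carrier A"
  shows "nrm A a \<le> nrm A b"
proof (rule pos_le_norm[OF a])
  note [simp] = posD[OF a] b
  have "b = (b \<ominus> a) \<oplus> a" by (simp add: minus_add_cancel)
  then have "pos b" using pos_add[OF ab a] by simp
  then have "pos ((of_real (nrm A b) \<odot> \<one> \<ominus> b) \<oplus> (b \<ominus> a))"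
    using ab by (intro pos_add pos_norm_minus) (auto dest: posD)
  then show "pos (of_real (nrm A b) \<odot> \<one> \<ominus> a)"
    using minus_trans[of "of_real (nrm A b) \<odot> \<one>" b a] by simp
qed (simp add: nrm_nonneg b)

lemma nrm_sa_power:
  assumes a: "a \<in> carrier A" "star A a = a"
  shows "nrm A (a [^] (2 ^ k :: nat)) = nrm A a ^ (2 ^ k)" "star A (a [^] (2 ^ k :: nat)) = a [^] (2 ^ k :: nat)"
proof (induction k)
  case (Suc k)
  have "a [^] (2 ^ Suc k :: nat) = a [^] (2 ^ k :: nat) \<otimes> a [^] (2 ^ k :: nat)"
    using a by (simp add: nat_pow_mult mult_2)
  then show "nrm A (a [^] (2 ^ Suc k :: nat)) = nrm A a ^ (2 ^ Suc k)"
    "star A (a [^] (2 ^ Suc k :: nat)) = a [^] (2 ^ Suc k :: nat)"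
    using Suc a by (simp_all add: nrm_sa_square star_mult power_mult mult.commute[of 2])
qed (use a in simp_all)

text \<open>
  A substitute for the equality of the spectra of \<open>y y\<^sup>*\<close> and \<open>y\<^sup>* y\<close> away from zero:
  powers of \<open>1 + y y\<^sup>*\<close> grow at most linearly if \<open>1 + y\<^sup>* y\<close> is a contraction. Since the norm of a
  self-adjoint element is multiplicative on powers with exponent \<open>2\<^sup>k\<close>, this makes \<open>1 + y y\<^sup>*\<close> a
  contraction too.
\<close>

lemma power_swap:
  assumes y: "y \<in> carrier A" and le: "nrm A (\<one> \<oplus> star A y \<otimes> y) \<le> 1"
  shows "\<exists>q\<in>carrier A. (\<one> \<oplus> y \<otimes> star A y) [^] (n::nat) = \<one> \<oplus> y \<otimes> q \<otimes> star A y \<and> nrm A q \<le> real n"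
proof (induction n)
  case 0
  show ?case using y by (intro bexI[of _ "\<zero>"]) auto
next
  case (Suc n)
  then obtain q where q: "q \<in> carrier A" "(\<one> \<oplus> y \<otimes> star A y) [^] n = \<one> \<oplus> y \<otimes> q \<otimes> star A y"
    "nrm A q \<le> real n" by blast
  let ?q = "\<one> \<oplus> q \<otimes> (\<one> \<oplus> star A y \<otimes> y)"
  have "(\<one> \<oplus> y \<otimes> star A y) [^] Suc n = (\<one> \<oplus> y \<otimes> q \<otimes> star A y) \<otimes> (\<one> \<oplus> y \<otimes> star A y)"
    using q by simp
  also have "\<dots> = \<one> \<oplus> y \<otimes> ?q \<otimes> star A y"
    using q y by (simp add: l_distr r_distr m_assoc a_ac)
  finally have eq: "(\<one> \<oplus> y \<otimes> star A y) [^] Suc n = \<one> \<oplus> y \<otimes> ?q \<otimes> star A y" .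
  have "nrm A ?q \<le> nrm A \<one> + nrm A (q \<otimes> (\<one> \<oplus> star A y \<otimes> y))"
    using q y by (intro nrm_triangle) auto
  also have "\<dots> \<le> 1 + nrm A q * nrm A (\<one> \<oplus> star A y \<otimes> y)"
    using q y by (intro add_mono nrm_one_le nrm_mult) auto
  also have "\<dots> \<le> 1 + real n * 1"
    using q y le by (intro add_mono mult_mono nrm_nonneg) auto
  finally show ?case using eq q y by (intro bexI[of _ ?q]) auto
qed

text \<open>
  Exponential growth beats linear growth: if \<open>N = (1 + d)\<^sup>2\<close> then Bernoulli's inequality, squared, gives
  quadratic growth of \<open>N\<^sup>m\<close>.
\<close>

lemma pow_linear_bound:
  fixes N K :: real
  assumes K: "0 \<le> K" and bd: "\<And>k. N ^ (2 ^ k) \<le> 1 + 2 ^ k * K"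
  shows "N \<le> 1"
proof (rule ccontr)
  assume "\<not> N \<le> 1"
  define d where "d = sqrt N - 1"
  have d: "d > 0" using \<open>\<not> N \<le> 1\<close> by (simp add: d_def)
  have N: "N = (1 + d)\<^sup>2" using \<open>\<not> N \<le> 1\<close> by (simp add: d_def)
  obtain k where k: "(1 + K) / d\<^sup>2 < 2 ^ k" using real_arch_pow[of 2] by auto
  let ?m = "2 ^ k :: nat"
  have "real ?m * d \<le> (1 + d) ^ ?m" using Bernoulli_inequality[of d ?m] d by simp
  then have "(real ?m * d)\<^sup>2 \<le> ((1 + d) ^ ?m)\<^sup>2" using d by (intro power_mono) auto
  also have "\<dots> = N ^ ?m" unfolding N by (simp add: power_mult[symmetric] mult.commute)
  also have "\<dots> \<le> 1 + 2 ^ k * K" by (rule bd)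
  also have "\<dots> \<le> 2 ^ k * (1 + K)" by (simp add: algebra_simps)
  finally have "2 ^ k * (2 ^ k * d\<^sup>2) \<le> 2 ^ k * (1 + K)" by (simp add: power2_eq_square algebra_simps)
  then have "2 ^ k * d\<^sup>2 \<le> 1 + K" by simp
  with k d show False by (simp add: divide_simps)
qed

lemma pos_minus_swap:
  assumes y: "y \<in> carrier A" and neg: "pos (\<ominus> (star A y \<otimes> y))"
  shows "pos (\<ominus> (y \<otimes> star A y))"
proof -
  obtain t where t: "t \<ge> 0" "nrm A (of_real t \<odot> \<one> \<ominus> \<ominus> (star A y \<otimes> y)) \<le> t"
    using neg by (auto simp: pos_def)
  show ?thesis
  proof (cases "t = 0")
    case True
    then have "nrm A (\<zero> \<ominus> \<ominus> (star A y \<otimes> y)) = 0" using t y nrm_nonneg[of "\<zero> \<ominus> \<ominus> (star A y \<otimes> y)"] by simp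
    then have "star A y \<otimes> y = \<zero>" using y by (simp add: nrm_eq_0 minus_eq)
    then have "y = \<zero>" using y star_mult_zero by blast
    then show ?thesis by simp
  next
    case False
    with t have tp: "t > 0" by simp
    define z where "z = of_real (1 / sqrt t) \<odot> y"
    have zc: "z \<in> carrier A" using y by (simp add: z_def)
    have tt: "complex_of_real (sqrt t) * complex_of_real (sqrt t) = complex_of_real t"
      using t(1) by (simp flip: of_real_mult)
    have zz: "star A z \<otimes> z = of_real (1 / t) \<odot> (star A y \<otimes> y)"
      "z \<otimes> star A z = of_real (1 / t) \<odot> (y \<otimes> star A y)"
      using y tt by (simp_all add: z_def star_smult smult_mult_left smult_mult_right)
    have "\<one> \<oplus> star A z \<otimes> z = of_real (1/t) \<odot> (of_real t \<odot> \<one> \<ominus> \<ominus> (star A y \<otimes> y))"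
      using y tp by (simp add: zz minus_eq smult_add_right flip: of_real_mult)
    then have "nrm A (\<one> \<oplus> star A z \<otimes> z) \<le> 1" using t tp y by (simp add: nrm_smult norm_divide)
    then have q: "\<exists>q\<in>carrier A. (\<one> \<oplus> z \<otimes> star A z) [^] (n::nat) = \<one> \<oplus> z \<otimes> q \<otimes> star A z \<and> nrm A q \<le> real n" for n
      by (rule power_swap[OF zc])
    let ?N = "nrm A (\<one> \<oplus> z \<otimes> star A z)"
    have "?N ^ (2 ^ k) \<le> 1 + 2 ^ k * (nrm A z * nrm A z)" for k
    proof -
      obtain q where q: "q \<in> carrier A" "nrm A q \<le> 2 ^ k"
        "(\<one> \<oplus> z \<otimes> star A z) [^] (2^k::nat) = \<one> \<oplus> z \<otimes> q \<otimes> star A z" using q[of "2^k"] by auto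
      have "?N ^ (2 ^ k) = nrm A ((\<one> \<oplus> z \<otimes> star A z) [^] (2^k::nat))"
        using zc by (intro nrm_sa_power(1)[symmetric]) (auto simp: star_add star_mult)
      also have "\<dots> \<le> nrm A \<one> + nrm A (z \<otimes> q \<otimes> star A z)"
        unfolding q using q zc by (intro nrm_triangle) auto
      also have "\<dots> \<le> 1 + nrm A (z \<otimes> q) * nrm A (star A z)"
        using q zc by (intro add_mono nrm_one_le nrm_mult) auto
      also have "\<dots> \<le> 1 + (nrm A z * nrm A q) * nrm A (star A z)"
        using q zc by (intro add_mono mult_right_mono nrm_mult nrm_nonneg) auto
      also have "\<dots> \<le> 1 + (nrm A z * 2 ^ k) * nrm A z"
        using q zc by (auto intro!: add_mono mult_right_mono mult_left_mono nrm_nonneg)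
      finally show ?thesis by (simp add: algebra_simps)
    qed
    then have "?N \<le> 1" using nrm_nonneg[OF zc] by (intro pow_linear_bound[of "nrm A z * nrm A z"]) auto
    then have "pos (\<ominus> (z \<otimes> star A z))"
      unfolding pos_def using zc by (auto intro!: exI[of _ 1] simp: star_minus star_mult minus_eq)
    then have "pos (of_real t \<odot> (\<ominus> (z \<otimes> star A z)))" using t by (intro pos_smult)
    also have "of_real t \<odot> (\<ominus> (z \<otimes> star A z)) = \<ominus> (y \<otimes> star A y)"
      using y tp by (simp add: zz smult_minus_right)
    finally show ?thesis .
  qed
qed

lemma pos_sum_zero:
  assumes a: "pos a" and b: "pos b" and ab: "a \<oplus> b = \<zero>" shows "a = \<zero>"
proof (rule pos_antisym[OF a])
  have "b = \<ominus> a" using ab posD[OF a] posD[OF b] by (metis minus_equality minus_minus)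
  then show "pos (\<ominus> a)" using b by simp
qed

text \<open>
  If \<open>-y\<^sup>* y\<close> is positive then so is \<open>-y y\<^sup>*\<close>. But \<open>2 (y\<^sup>* y + y y\<^sup>*)\<close> is the sum of the squares of the
  self-adjoint elements \<open>y + y\<^sup>*\<close> and \<open>i (y - y\<^sup>*)\<close>, so both squares vanish.
\<close>

lemma neg_star_mult_zero:
  assumes y: "y \<in> carrier A" and neg: "pos (\<ominus> (star A y \<otimes> y))"
  shows "y = \<zero>"
proof -
  define p where "p = y \<oplus> star A y"
  define m where "m = \<i> \<odot> (y \<ominus> star A y)"
  have c: "p \<in> carrier A" "star A p = p" "m \<in> carrier A" "star A m = m"
    using y by (auto simp: p_def m_def star_add star_smult star_diff a_comm smult_minus_left)
      (simp add: smult_diff_right minus_eq minus_add smult_minus_right smult_add_right a_comm)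
  let ?S = "star A y \<otimes> y \<oplus> y \<otimes> star A y"
  have mm: "m \<otimes> m = ?S \<ominus> (y \<otimes> y \<oplus> star A y \<otimes> star A y)"
    using y by (simp add: m_def smult_mult_left smult_mult_right minus_eq l_distr r_distr l_minus r_minus
       smult_minus_left smult_add_right smult_minus_right minus_add a_ac)
  have pp: "p \<otimes> p = ?S \<oplus> (y \<otimes> y \<oplus> star A y \<otimes> star A y)"
    using y by (simp add: p_def l_distr r_distr a_ac)
  have "p \<otimes> p \<oplus> m \<otimes> m = ?S \<oplus> ?S"
  proof -
    have "(u \<oplus> v) \<oplus> (u \<ominus> v) = u \<oplus> u" if "u \<in> carrier A" "v \<in> carrier A" for u v
      using that by (simp add: minus_eq a_ac r_neg1 r_neg2 r_neg)
    from this[of ?S "y \<otimes> y \<oplus> star A y \<otimes> star A y"] show ?thesis unfolding mm pp using y by simp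
  qed
  moreover have "pos (\<ominus> ?S)"
    using pos_add[OF neg pos_minus_swap[OF y neg]] y by (simp add: minus_add)
  then have "pos (\<ominus> ?S \<oplus> \<ominus> ?S)" by (intro pos_add)
  then have "pos (\<ominus> (?S \<oplus> ?S))" using y by (simp add: minus_add)
  ultimately have neg': "pos (\<ominus> (p \<otimes> p \<oplus> m \<otimes> m))" by simp
  have "pos (p \<otimes> p)" "pos (m \<otimes> m)" using c by (auto intro: pos_square)
  then have s: "p \<otimes> p \<oplus> m \<otimes> m = \<zero>" using neg' by (intro pos_antisym pos_add)
  then have "p \<otimes> p = \<zero>" using pos_sum_zero[OF \<open>pos (p \<otimes> p)\<close> \<open>pos (m \<otimes> m)\<close>] by simp
  moreover have "m \<otimes> m = \<zero>" using s \<open>p \<otimes> p = \<zero>\<close> c by simp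
  ultimately have "p = \<zero>" "m = \<zero>" using c star_mult_zero by metis+
  then have "y \<ominus> star A y = \<zero>" using smult_eq_zero[of "y \<ominus> star A y" \<i>] y by (simp add: m_def)
  then have "star A y = y" using y minus_eq_zero_iff by simp
  then have "2 \<odot> y = \<zero>" using \<open>p = \<zero>\<close> y smult_add_left[of y 1 1] by (simp add: p_def)
  then show ?thesis using smult_eq_zero[of y 2] y by simp
qed

text \<open>
  With \<open>h = x\<^sup>* x\<close>, \<open>k = \<bar>h\<bar>\<close> the root of \<open>h\<^sup>2\<close> and \<open>n = k - h\<close>, the relation \<open>h n = -k n\<close> shows that
  \<open>y = x n\<close> has \<open>y\<^sup>* y = n h n = -n k n\<close>, the negative of a square. So \<open>y = 0\<close>, which unwinds to \<open>n = 0\<close>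
  and \<open>h = k\<close>.
\<close>

theorem pos_star_mult:
  assumes x: "x \<in> carrier A" shows "pos (star A x \<otimes> x)"
proof -
  define h where "h = star A x \<otimes> x"
  have h: "h \<in> carrier A" "star A h = h" using x by (simp_all add: h_def star_mult)
  obtain k where k: "k \<in> carrier A" "star A k = k" "k \<otimes> k = h \<otimes> h" "pos k"
    and kc: "\<And>z. \<lbrakk>z \<in> carrier A; z \<otimes> (h \<otimes> h) = (h \<otimes> h) \<otimes> z\<rbrakk> \<Longrightarrow> z \<otimes> k = k \<otimes> z"
    using pos_sqrt[OF pos_square[OF h]] by metis
  have hk: "h \<otimes> k = k \<otimes> h" using kc[of h] h by (simp add: m_assoc)
  obtain r where r: "r \<in> carrier A" "star A r = r" "r \<otimes> r = k"
    and rc: "\<And>z. \<lbrakk>z \<in> carrier A; z \<otimes> k = k \<otimes> z\<rbrakk> \<Longrightarrow> z \<otimes> r = r \<otimes> z"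
    using pos_sqrt[OF k(4)] by metis
  define n where "n = k \<ominus> h"
  have n: "n \<in> carrier A" "star A n = n" using k h by (simp_all add: n_def star_diff)
  have "n \<otimes> k = k \<otimes> n" using k h hk by (simp add: n_def minus_distrib_left minus_distrib_right)
  then have nr: "n \<otimes> r = r \<otimes> n" using rc n by blast
  have hn: "h \<otimes> n = \<ominus> (k \<otimes> n)"
    using k(1-3) h hk by (simp add: n_def minus_distrib_right minus_swap)
  define w where "w = r \<otimes> n"
  have w: "w \<in> carrier A" "star A w = w" using r n nr by (simp_all add: w_def star_mult)
  define y where "y = x \<otimes> n"
  have "star A y \<otimes> y = n \<otimes> (h \<otimes> n)" using x n by (simp add: y_def h_def star_mult m_assoc)
  also have "\<dots> = \<ominus> (n \<otimes> (r \<otimes> r \<otimes> n))" using hn n r k by (simp add: r_minus)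
  also have "n \<otimes> (r \<otimes> r \<otimes> n) = (n \<otimes> r) \<otimes> (r \<otimes> n)" using n(1) r(1) by (simp add: m_assoc)
  also have "\<dots> = w \<otimes> w" by (simp add: nr w_def)
  finally have yy: "star A y \<otimes> y = \<ominus> (w \<otimes> w)" .
  have "y = \<zero>"
    by (rule neg_star_mult_zero) (use yy w x n in \<open>auto simp: y_def intro: pos_square\<close>)
  then have "w \<otimes> w = \<zero>" using yy w by simp (metis m_closed minus_minus minus_zero)
  then have "w = \<zero>" using star_mult_zero[of w] w by simp
  moreover have "k \<otimes> n = r \<otimes> w" using r n by (simp add: w_def flip: m_assoc)
  ultimately have kn: "k \<otimes> n = \<zero>" using r by simp
  have "n \<otimes> n = k \<otimes> n \<ominus> h \<otimes> n" using n k h by (simp add: minus_distrib_left n_def)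
  also have "\<dots> = \<zero>" using hn kn by (simp add: minus_eq)
  finally have "n = \<zero>" using star_mult_zero[of n] n by simp
  then have "h = k" using k h by (simp add: n_def minus_eq_zero_iff)
  then show ?thesis using k by (simp add: h_def)
qed

lemma positive_iff_pos: "positive A x \<longleftrightarrow> pos x"
  using pos_star_mult pos_sqrt unfolding positive_def by metis

lemma pos_in_subalgebra:
  assumes "pos x" "x \<in> C" "cstar_subalgebra C A"
  shows "positive (A\<lparr>carrier := C\<rparr>) x"
  using pos_sqrt[OF assms(1)] assms(2,3) unfolding positive_def by (simp) metis

lemma pos_conj:
  assumes a: "pos a" and x: "x \<in> carrier A" shows "pos (star A x \<otimes> a \<otimes> x)"
proof -
  obtain b where b: "b \<in> carrier A" "star A b = b" "b \<otimes> b = a" using pos_sqrt[OF a] by metis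
  have "star A x \<otimes> a \<otimes> x = star A (b \<otimes> x) \<otimes> (b \<otimes> x)"
    unfolding b(3)[symmetric] using b(1,2) x by (simp add: star_mult m_assoc)
  then show ?thesis using pos_star_mult[of "b \<otimes> x"] b(1) x by simp
qed

lemma pos_norm_conj:
  assumes x: "x \<in> carrier A" and a: "a \<in> carrier A" "star A a = a"
  shows "pos (of_real (nrm A a) \<odot> (star A x \<otimes> x) \<ominus> star A x \<otimes> a \<otimes> x)"
  using pos_conj[OF pos_norm_minus[OF a] x] a x
  by (simp add: minus_distrib_left minus_distrib_right smult_mult_left smult_mult_right)

lemma finsum_pos_zero:
  assumes "finite I" and "\<And>i. i \<in> I \<Longrightarrow> pos (g i)" and "(\<Oplus>i\<in>I. g i) = \<zero>" and "i \<in> I"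
  shows "g i = \<zero>"
proof -
  have c: "g i \<in> carrier A" "g \<in> I - {i} \<rightarrow> carrier A" using assms(2,4) by (auto dest: posD)
  have I: "insert i (I - {i}) = I" "finite (I - {i})" using assms by auto
  have "(\<Oplus>i\<in>I. g i) = g i \<oplus> (\<Oplus>j\<in>I - {i}. g j)"
    using finsum_insert[OF I(2), of i g] c unfolding I(1) by simp
  then show ?thesis using assms I pos_sum_zero[of "g i" "\<Oplus>j\<in>I - {i}. g j"] pos_finsum[OF I(2)] by auto
qed

end

section \<open>Conditional expectations\<close>

context cstar_algebra
begin

text \<open>
  A positive map sends self-adjoint elements \<open>h = \<parallel>h\<parallel> - (\<parallel>h\<parallel> - h)\<close> to differences of positive elements,
  which are self-adjoint, and every element is a combination of two self-adjoint ones.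
\<close>

lemma pos_map_star:
  assumes E: "E \<in> carrier A \<rightarrow> carrier A"
    and add: "\<And>x y. \<lbrakk>x \<in> carrier A; y \<in> carrier A\<rbrakk> \<Longrightarrow> E (x \<oplus> y) = E x \<oplus> E y"
    and smult: "\<And>c x. x \<in> carrier A \<Longrightarrow> E (c \<odot> x) = c \<odot> E x"
    and pos: "\<And>x. pos x \<Longrightarrow> pos (E x)"
    and x: "x \<in> carrier A"
  shows "E (star A x) = star A (E x)"
proof -
  have Ec [simp]: "E y \<in> carrier A" if "y \<in> carrier A" for y using E that by auto
  have diff: "E (y \<ominus> z) = E y \<ominus> E z" if "y \<in> carrier A" "z \<in> carrier A" for y z
    using that add[of y "(-1) \<odot> z"] smult[of z "-1"] by (simp add: minus_eq minus_eq_smult)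
  have sa: "star A (E h) = E h" if h: "h \<in> carrier A" "star A h = h" for h
  proof -
    let ?n = "of_real (nrm A h) \<odot> \<one>"
    have "pos ?n" using pos_square[of "\<one>"] pos_smult[of "\<one>" "nrm A h"] nrm_nonneg[OF h(1)] by simp
    then have "pos (E ?n)" "pos (E (?n \<ominus> h))" using pos pos_norm_minus[OF h] by auto
    moreover have "E h = E ?n \<ominus> E (?n \<ominus> h)"
      using diff[of ?n h] h by (simp add: minus_eq minus_add r_neg1 flip: a_assoc) (simp add: r_neg)
    ultimately show ?thesis using h by (metis Ec minus_closed one_closed posD(2) smult_closed star_diff)
  qed
  define a where "a = E x"
  define b where "b = E (star A x)"
  have ab: "a \<in> carrier A" "b \<in> carrier A" using x by (simp_all add: a_def b_def)
  have "star A (E (x \<oplus> star A x)) = E (x \<oplus> star A x)" using x by (intro sa) (auto simp: star_add a_comm)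
  then have 1: "star A a \<oplus> star A b = a \<oplus> b" using x ab by (simp add: add star_add a_def b_def)
  have "star A (\<i> \<odot> (x \<ominus> star A x)) = \<i> \<odot> (x \<ominus> star A x)"
    using x by (simp add: star_smult star_add star_minus smult_minus_left smult_add_right smult_minus_right minus_eq a_comm)
  then have "star A (E (\<i> \<odot> (x \<ominus> star A x))) = E (\<i> \<odot> (x \<ominus> star A x))" using x by (intro sa) auto
  then have "(- \<i>) \<odot> (star A a \<ominus> star A b) = \<i> \<odot> (a \<ominus> b)"
    using x by (simp add: smult diff star_smult star_diff a_def b_def)
  then have "\<i> \<odot> (star A b \<ominus> star A a) = \<i> \<odot> (a \<ominus> b)"
    using ab by (simp add: smult_minus_left minus_swap flip: smult_minus_right)
  then have 2: "star A b \<ominus> star A a = a \<ominus> b" using ab smult_cancel[of _ _ \<i>] by auto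
  have "(star A a \<oplus> star A b) \<ominus> (star A b \<ominus> star A a) = (a \<oplus> b) \<ominus> (a \<ominus> b)" using 1 2 by simp
  moreover have "(p \<oplus> q) \<ominus> (q \<ominus> p) = p \<oplus> p" "(p \<oplus> q) \<ominus> (p \<ominus> q) = q \<oplus> q"
    if "p \<in> carrier A" "q \<in> carrier A" for p q using that by algebra+
  ultimately have "star A a \<oplus> star A a = b \<oplus> b" using ab by simp
  then have "2 \<odot> star A a = 2 \<odot> b" using ab smult_add_left[of _ 1 1] by simp
  then have "star A a = b" using ab smult_cancel[of "star A a" b 2] by simp
  then show ?thesis by (simp add: a_def b_def)
qed

text \<open>
  Contractivity is automatic. Positivity at \<open>x - E x\<close> gives \<open>E(x)\<^sup>* E(x) \<le> E(x\<^sup>* x)\<close>, and positivity at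
  \<open>\<parallel>x\<parallel>\<^sup>2 - x\<^sup>* x\<close> gives \<open>E(x\<^sup>* x) \<le> \<parallel>x\<parallel>\<^sup>2\<close>.
\<close>

lemma conditional_expectationI:
  assumes B: "cstar_subalgebra B A" and E: "E \<in> carrier A \<rightarrow>\<^sub>E B"
    and add: "\<And>x y. \<lbrakk>x \<in> carrier A; y \<in> carrier A\<rbrakk> \<Longrightarrow> E (x \<oplus> y) = E x \<oplus> E y"
    and smult: "\<And>c x. x \<in> carrier A \<Longrightarrow> E (c \<odot> x) = c \<odot> E x"
    and fix_B: "\<And>b. b \<in> B \<Longrightarrow> E b = b"
    and left: "\<And>a x. \<lbrakk>a \<in> B; x \<in> carrier A\<rbrakk> \<Longrightarrow> E (a \<otimes> x) = a \<otimes> E x"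
    and right: "\<And>x b. \<lbrakk>x \<in> carrier A; b \<in> B\<rbrakk> \<Longrightarrow> E (x \<otimes> b) = E x \<otimes> b"
    and pos: "\<And>x. x \<in> carrier A \<Longrightarrow> pos (E (star A x \<otimes> x))"
  shows "conditional_expectation A B E"
proof -
  note Bsub = cstar_subalgebraD[OF B]
  have EB [simp]: "E x \<in> B" if "x \<in> carrier A" for x using E that by auto
  have Ec [simp]: "E x \<in> carrier A" if "x \<in> carrier A" for x using EB[OF that] Bsub by blast
  have pos': "pos (E x)" if "pos x" for x
    using that pos_sqrt pos by metis
  have star: "E (star A x) = star A (E x)" if "x \<in> carrier A" for x
    by (rule pos_map_star[OF _ add smult pos' that]) (use Ec in auto)
  have diff: "E (y \<ominus> z) = E y \<ominus> E z" if "y \<in> carrier A" "z \<in> carrier A" for y z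
    using that add[of y "(-1) \<odot> z"] smult[of z "-1"] by (simp add: minus_eq minus_eq_smult)
  have contr: "nrm A (E x) \<le> nrm A x" if x: "x \<in> carrier A" for x
  proof -
    let ?y = "x \<ominus> E x"
    have sE: "star A (E x) \<in> B" using x Bsub by simp
    have Ex: "E (star A x \<otimes> E x) = star A (E x) \<otimes> E x"
      using x right[of "star A x" "E x"] by (simp add: star)
    have xE: "E (star A (E x) \<otimes> x) = star A (E x) \<otimes> E x"
      using x left[OF sE] by simp
    have EE: "E (star A (E x) \<otimes> E x) = star A (E x) \<otimes> E x" using x sE Bsub(6) by (intro fix_B) auto
    have "star A ?y \<otimes> ?y = (star A x \<otimes> x \<ominus> star A x \<otimes> E x) \<ominus> (star A (E x) \<otimes> x \<ominus> star A (E x) \<otimes> E x)"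
      using x by (simp add: star_add star_minus minus_eq l_distr r_distr l_minus r_minus minus_add a_ac)
    then have "E (star A ?y \<otimes> ?y) = (E (star A x \<otimes> x) \<ominus> star A (E x) \<otimes> E x)
        \<ominus> (star A (E x) \<otimes> E x \<ominus> star A (E x) \<otimes> E x)"
      using x by (simp add: diff Ex xE EE)
    also have "\<dots> = E (star A x \<otimes> x) \<ominus> star A (E x) \<otimes> E x"
      using x by (simp add: r_neg minus_eq)
    finally have 1: "pos (E (star A x \<otimes> x) \<ominus> star A (E x) \<otimes> E x)" using pos[of ?y] x by simp
    let ?n = "complex_of_real ((nrm A x)\<^sup>2) \<odot> \<one>"
    have "pos (?n \<ominus> star A x \<otimes> x)"
      using pos_norm_minus[of "star A x \<otimes> x"] x by (simp add: star_mult nrm_cstar)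
    then have "pos (E (?n \<ominus> star A x \<otimes> x))" by (rule pos')
    then have 2: "pos (?n \<ominus> E (star A x \<otimes> x))" using x Bsub by (simp add: diff smult fix_B)
    have "pos (?n \<ominus> star A (E x) \<otimes> E x)"
      using pos_add[OF 2 1] minus_trans[of ?n "E (star A x \<otimes> x)" "star A (E x) \<otimes> E x"] x by simp
    then have "nrm A (star A (E x) \<otimes> E x) \<le> (nrm A x)\<^sup>2"
      using pos_star_mult[of "E x"] x by (intro pos_le_norm) auto
    then show ?thesis using x by (simp add: nrm_cstar power2_le_iff_abs_le nrm_nonneg)
  qed
  show ?thesis
    unfolding conditional_expectation_def
  proof (intro conjI ballI allI impI)
    show "positive (A\<lparr>carrier := B\<rparr>) (E x)" if "positive A x" for x
      using that pos'[of x] posD(1)[of x] pos_in_subalgebra[OF _ _ B] by (simp add: positive_iff_pos)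
    show "E (a \<otimes> x \<otimes> b) = a \<otimes> E x \<otimes> b" if "a \<in> B" "b \<in> B" "x \<in> carrier A" for a b x
      using that Bsub(2) by (subst right) (auto simp: left)
  qed (use assms contr in auto)
qed

lemma pos_scalar:
  assumes "pos (c \<odot> \<one>)" and "\<one> \<noteq> \<zero>"
  obtains r where "c = complex_of_real r" "0 \<le> r"
proof -
  have "(cnj c - c) \<odot> \<one> = \<zero>"
    using posD(2)[OF assms(1)] by (simp add: star_smult smult_diff_left minus_eq_zero_iff)
  then have "cnj c = c" using smult_eq_zero[of "\<one>" "cnj c - c"] assms(2) by auto
  then obtain r where r: "c = complex_of_real r" by (metis Reals_cnj_iff Reals_cases)
  have "0 \<le> r"
  proof (rule ccontr)
    assume neg: "\<not> 0 \<le> r"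
    then have "pos (of_real (-r) \<odot> \<one>)" using pos_square[of "\<one>"] by (intro pos_smult) auto
    then have "pos (\<ominus> (c \<odot> \<one>))" by (simp add: r smult_minus_left)
    then have "c \<odot> \<one> = \<zero>" by (rule pos_antisym[OF assms(1)])
    then show False using smult_eq_zero[of "\<one>" c] assms(2) r neg by auto
  qed
  with r that show ?thesis by blast
qed

lemma relative_commutant_subalgebra:
  assumes S: "S \<subseteq> carrier A" and star: "\<And>x. x \<in> S \<Longrightarrow> star A x \<in> S"
  shows "cstar_subalgebra (relative_commutant S A) A"
  unfolding cstar_subalgebra_def
proof (intro conjI allI ballI)
  have Sc [simp]: "s \<in> carrier A" if "s \<in> S" for s using S that by auto
  show "subring (relative_commutant S A) A"
    by (rule subringI) (auto simp: relative_commutant_def l_distr r_distr l_minus r_minus m_assoc,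
        metis Sc m_assoc)
  show "c \<odot> x \<in> relative_commutant S A" if "x \<in> relative_commutant S A" for c x
    using that by (auto simp: relative_commutant_def smult_mult_left smult_mult_right)
  show "star A x \<in> relative_commutant S A" if x: "x \<in> relative_commutant S A" for x
  proof -
    have "star A x \<otimes> s = s \<otimes> star A x" if s: "s \<in> S" for s
    proof -
      have "x \<otimes> star A s = star A s \<otimes> x" using x star[OF s] by (simp add: relative_commutant_def)
      then have "star A (x \<otimes> star A s) = star A (star A s \<otimes> x)" by simp
      then show ?thesis using x s by (simp add: star_mult relative_commutant_def)
    qed
    then show ?thesis using x by (simp add: relative_commutant_def)
  qed
  show "norm_closed A (relative_commutant S A)"
    unfolding norm_closed_iff
  proof (intro conjI allI impI)
    fix s x assume *: "range s \<subseteq> relative_commutant S A \<and> tends s x"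
    then have t: "tends s x" by simp
    have "x \<otimes> z = z \<otimes> x" if z: "z \<in> S" for z
    proof -
      have "(\<lambda>n. s n \<otimes> z) = (\<lambda>n. z \<otimes> s n)" using * z by (auto simp: relative_commutant_def)
      then show ?thesis
        using tends_unique tends_mult_left[OF t Sc[OF z]] tends_mult_right[OF t Sc[OF z]] by metis
    qed
    then show "x \<in> relative_commutant S A" using tendsD(2)[OF t] by (simp add: relative_commutant_def)
  qed (auto simp: relative_commutant_def)
qed

text \<open>
  The difference is taken in another record, where the additive inverse is a different choice term.
\<close>

lemma restrict_minus:
  assumes C: "subring C A" and x: "x \<in> C" and y: "y \<in> C"
  shows "x \<ominus>\<^bsub>A\<lparr>carrier := C\<rparr>\<^esub> y = x \<ominus> y"
proof -
  interpret C: ring "A\<lparr>carrier := C\<rparr>" by (rule subring_is_ring[OF C])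
  have "\<ominus> y \<in> C" "C \<subseteq> carrier A" using subringE[OF C] y by auto
  then have "\<ominus>\<^bsub>A\<lparr>carrier := C\<rparr>\<^esub> y = \<ominus> y" using y by (intro C.minus_equality) (auto simp: l_neg)
  then show ?thesis by (simp add: a_minus_def)
qed

end

locale cond_exp = cstar_algebra A for A :: "'a cstar" (structure) +
  fixes B :: "'a set" and E :: "'a \<Rightarrow> 'a"
  assumes expectation: "conditional_expectation A B E"
begin

lemma B_subalgebra: "cstar_subalgebra B A"
  using expectation by (simp add: conditional_expectation_def)

lemmas B_simps = cstar_subalgebraD[OF B_subalgebra]

lemma B_carrier [simp]: "b \<in> B \<Longrightarrow> b \<in> carrier A"
  using B_simps(2) by blast

declare B_simps(3-10) [simp]

lemma E_B [simp]: "x \<in> carrier A \<Longrightarrow> E x \<in> B"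
  using expectation by (auto simp: conditional_expectation_def)

lemma E_ext: "E \<in> carrier A \<rightarrow>\<^sub>E B"
  using expectation by (simp add: conditional_expectation_def)

lemma E_closed [simp]: "x \<in> carrier A \<Longrightarrow> E x \<in> carrier A"
  by simp

lemma E_add: "\<lbrakk>x \<in> carrier A; y \<in> carrier A\<rbrakk> \<Longrightarrow> E (x \<oplus> y) = E x \<oplus> E y"
  using expectation by (simp add: conditional_expectation_def)

lemma E_smult: "x \<in> carrier A \<Longrightarrow> E (c \<odot> x) = c \<odot> E x"
  using expectation by (simp add: conditional_expectation_def)

lemma E_fix [simp]: "b \<in> B \<Longrightarrow> E b = b"
  using expectation by (simp add: conditional_expectation_def)

lemma E_norm: "x \<in> carrier A \<Longrightarrow> nrm A (E x) \<le> nrm A x"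
  using expectation by (simp add: conditional_expectation_def)

lemma E_bimodule: "\<lbrakk>a \<in> B; b \<in> B; x \<in> carrier A\<rbrakk> \<Longrightarrow> E (a \<otimes> x \<otimes> b) = a \<otimes> E x \<otimes> b"
  using expectation by (simp add: conditional_expectation_def)

lemma E_left: "\<lbrakk>a \<in> B; x \<in> carrier A\<rbrakk> \<Longrightarrow> E (a \<otimes> x) = a \<otimes> E x"
  using E_bimodule[of a "\<one>" x] by simp

lemma E_right: "\<lbrakk>b \<in> B; x \<in> carrier A\<rbrakk> \<Longrightarrow> E (x \<otimes> b) = E x \<otimes> b"
  using E_bimodule[of "\<one>" b x] by simp

lemma E_zero [simp]: "E \<zero> = \<zero>"
  by simp

lemma E_diff: "\<lbrakk>x \<in> carrier A; y \<in> carrier A\<rbrakk> \<Longrightarrow> E (x \<ominus> y) = E x \<ominus> E y"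
  using E_add[of x "(-1) \<odot> y"] E_smult[of y "-1"] by (simp add: minus_eq minus_eq_smult)

lemma E_pos: "pos x \<Longrightarrow> pos (E x)"
proof -
  assume "pos x"
  then have "positive (A\<lparr>carrier := B\<rparr>) (E x)"
    using expectation by (simp add: conditional_expectation_def positive_iff_pos)
  then obtain y where "y \<in> B" "E x = star A y \<otimes> y" by (auto simp: positive_def)
  then show ?thesis by (simp add: pos_star_mult)
qed

lemma E_star: "x \<in> carrier A \<Longrightarrow> E (star A x) = star A (E x)"
  by (rule pos_map_star) (auto simp: E_add E_smult E_pos)

lemma E_finsum: "g \<in> I \<rightarrow> carrier A \<Longrightarrow> E (\<Oplus>i\<in>I. g i) = (\<Oplus>i\<in>I. E (g i))"
  by (rule finsum_additive) (auto simp: E_add)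

text \<open>
  Put \<open>a = E(x\<^sup>* x)\<close>, \<open>b = E(x\<^sup>* y)\<close>, \<open>c = E(y\<^sup>* y)\<close>. For \<open>t > \<parallel>a\<parallel>\<close>, expanding \<open>E(z\<^sup>* z) \<ge> 0\<close> for
  \<open>z = x b - t y\<close> and using \<open>b\<^sup>* a b \<le> t b\<^sup>* b\<close> yields \<open>b\<^sup>* b \<le> t c\<close>; then \<open>t\<close> tends to \<open>\<parallel>a\<parallel>\<close>. The strict
  inequality avoids dividing by \<open>\<parallel>a\<parallel> = 0\<close>.
\<close>

lemma cauchy_schwarz:
  assumes x: "x \<in> carrier A" and y: "y \<in> carrier A"
  shows "(nrm A (E (star A x \<otimes> y)))\<^sup>2 \<le> nrm A (E (star A x \<otimes> x)) * nrm A (E (star A y \<otimes> y))"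
proof -
  define a where "a = E (star A x \<otimes> x)"
  define b where "b = E (star A x \<otimes> y)"
  define c where "c = E (star A y \<otimes> y)"
  note [simp] = x y
  have B [simp]: "a \<in> B" "b \<in> B" "c \<in> B" by (simp_all add: a_def b_def c_def)
  have a: "star A a = a" using E_pos[OF pos_star_mult[OF x]] posD(2) by (simp add: a_def)
  have b': "E (star A y \<otimes> x) = star A b" using E_star[of "star A x \<otimes> y"] by (simp add: b_def star_mult)
  have bound: "(nrm A b)\<^sup>2 \<le> t * nrm A c" if t: "t > nrm A a" for t
  proof -
    have tp: "t > 0" using t nrm_nonneg[of a] by simp
    let ?t = "complex_of_real t"
    \<comment> \<open>The factor \<open>b\<close> on the right makes the cross terms multiples of \<open>b\<^sup>* b\<close>.\<close>
    let ?z = "x \<otimes> b \<ominus> ?t \<odot> y"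
    have "star A ?z \<otimes> ?z = (star A b \<otimes> (star A x \<otimes> x) \<otimes> b \<ominus> ?t \<odot> (star A b \<otimes> (star A x \<otimes> y)))
        \<ominus> (?t \<odot> ((star A y \<otimes> x) \<otimes> b) \<ominus> (?t * ?t) \<odot> (star A y \<otimes> y))"
      by (simp add: star_add star_minus star_mult star_smult minus_eq l_distr r_distr l_minus r_minus minus_add
          smult_mult_left smult_mult_right smult_minus_right smult_add_right m_assoc a_ac)
    then have "E (star A ?z \<otimes> ?z) = (star A b \<otimes> a \<otimes> b \<ominus> ?t \<odot> (star A b \<otimes> b))
        \<ominus> (?t \<odot> (star A b \<otimes> b) \<ominus> (?t * ?t) \<odot> c)"
      by (simp add: E_diff E_smult E_bimodule E_left E_right b' flip: a_def b_def c_def)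
    then have 1: "pos ((star A b \<otimes> a \<otimes> b \<ominus> ?t \<odot> (star A b \<otimes> b)) \<ominus> (?t \<odot> (star A b \<otimes> b) \<ominus> (?t * ?t) \<odot> c))"
      using E_pos[OF pos_star_mult[of ?z]] by simp
    have 2: "pos (of_real (nrm A a) \<odot> (star A b \<otimes> b) \<ominus> star A b \<otimes> a \<otimes> b)"
      by (rule pos_norm_conj) (simp_all add: a)
    have 3: "pos (of_real (t - nrm A a) \<odot> (star A b \<otimes> b))"
      using t by (intro pos_smult pos_star_mult) auto
    let ?bb = "star A b \<otimes> b" and ?ab = "star A b \<otimes> a \<otimes> b"
    have tb: "of_real (t - nrm A a) \<odot> ?bb = ?t \<odot> ?bb \<ominus> of_real (nrm A a) \<odot> ?bb"
      using smult_diff_left[of ?bb ?t "complex_of_real (nrm A a)"] by simp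
    have grp: "(((u \<ominus> v) \<ominus> (v \<ominus> w)) \<oplus> (n \<ominus> u)) \<oplus> (v \<ominus> n) = w \<ominus> v"
      if "u \<in> carrier A" "v \<in> carrier A" "w \<in> carrier A" "n \<in> carrier A" for u v w n
      using that by algebra
    have "pos ((?t * ?t) \<odot> c \<ominus> ?t \<odot> ?bb)"
      using pos_add[OF pos_add[OF 1 2] 3] unfolding tb by (subst (asm) grp) auto
    then have "pos (of_real (1/t) \<odot> ((?t * ?t) \<odot> c \<ominus> ?t \<odot> ?bb))" using tp by (intro pos_smult) auto
    also have "of_real (1/t) \<odot> ((?t * ?t) \<odot> c \<ominus> ?t \<odot> ?bb) = ?t \<odot> c \<ominus> ?bb"
      using tp by (simp add: smult_diff_right)
    finally have "nrm A ?bb \<le> nrm A (?t \<odot> c)" by (intro norm_mono pos_star_mult) auto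
    then show ?thesis using tp by (simp add: nrm_cstar nrm_smult)
  qed
  have "(nrm A b)\<^sup>2 \<le> nrm A a * nrm A c"
  proof (rule field_le_epsilon)
    fix \<epsilon> :: real assume e: "0 < \<epsilon>"
    define d where "d = \<epsilon> / (nrm A c + 1)"
    have nc: "nrm A c \<ge> 0" by (simp add: nrm_nonneg)
    have d: "d > 0" using e nc by (simp add: d_def)
    have "d * nrm A c \<le> \<epsilon>" using e nc by (simp add: d_def divide_simps mult_left_mono)
    with bound[of "nrm A a + d"] d show "(nrm A b)\<^sup>2 \<le> nrm A a * nrm A c + \<epsilon>"
      by (simp add: algebra_simps)
  qed
  then show ?thesis by (simp add: a_def b_def c_def)
qed

end

section \<open>Irreducible inclusions of finite index\<close>

text \<open>
  The data of an irreducible inclusion of finite index. Irreducibility passes up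
  the tower, so that the locale reproduces itself for \<open>A \<subseteq> A\<^sub>1\<close> and for \<open>P \<subseteq> A\<^sub>1\<close>.
\<close>

locale inclusion = cond_exp A B E for A :: "'a cstar" (structure) and B E +
  fixes L :: "'a set"
  assumes quasi_basis: "quasi_basis A E L"
    and irreducible: "relative_commutant B A = {c \<odot> \<one> | c. True}"
    and nontrivial: "\<one> \<noteq> \<zero>"
begin

lemma finite_L [simp]: "finite L"
  using quasi_basis by (simp add: quasi_basis_def)

lemma L_carrier [simp]: "l \<in> L \<Longrightarrow> l \<in> carrier A"
  using quasi_basis by (auto simp: quasi_basis_def)

lemma expand: "x \<in> carrier A \<Longrightarrow> (\<Oplus>l\<in>L. l \<otimes> E (star A l \<otimes> x)) = x"
  using quasi_basis by (simp add: quasi_basis_def)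

lemma expand_right: "x \<in> carrier A \<Longrightarrow> (\<Oplus>l\<in>L. E (x \<otimes> l) \<otimes> star A l) = x"
  using quasi_basis by (simp add: quasi_basis_def)

lemma scalar_inj: "c \<odot> \<one> = d \<odot> \<one> \<Longrightarrow> c = d"
proof -
  assume "c \<odot> \<one> = d \<odot> \<one>"
  then have "(c - d) \<odot> \<one> = \<zero>" by (simp add: smult_diff_left minus_eq_zero_iff)
  then show ?thesis using smult_eq_zero[of "\<one>" "c - d"] nontrivial by simp
qed

lemma commutant_scalar:
  assumes "x \<in> carrier A" "\<And>b. b \<in> B \<Longrightarrow> x \<otimes> b = b \<otimes> x"
  obtains c where "x = c \<odot> \<one>"
proof -
  have "x \<in> relative_commutant B A" using assms by (simp add: relative_commutant_def)
  then show ?thesis using irreducible that by auto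
qed

lemma finsum_eq_zero: "(\<And>i. i \<in> I \<Longrightarrow> g i = \<zero>) \<Longrightarrow> (\<Oplus>i\<in>I. g i) = \<zero>"
  using finsum_cong'[of I I "\<lambda>_. \<zero>" g] by simp

lemma E_nondegenerate:
  assumes x: "x \<in> carrier A" and z: "\<And>y. y \<in> carrier A \<Longrightarrow> E (y \<otimes> x) = \<zero>"
  shows "x = \<zero>"
proof -
  have "(\<Oplus>l\<in>L. l \<otimes> E (star A l \<otimes> x)) = \<zero>" by (rule finsum_eq_zero) (simp add: z)
  then show ?thesis using expand[OF x] by simp
qed

lemma E_faithful:
  assumes x: "x \<in> carrier A" and z: "E (star A x \<otimes> x) = \<zero>"
  shows "x = \<zero>"
proof (rule E_nondegenerate[OF x])
  fix y assume y: "y \<in> carrier A"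
  have "(nrm A (E (star A (star A y) \<otimes> x)))\<^sup>2 \<le> 0"
    using cauchy_schwarz[of "star A y" x] x y z by simp
  then show "E (y \<otimes> x) = \<zero>" using x y by (simp add: nrm_eq_0)
qed

text \<open>
  Expanding \<open>a l\<close> on the left in the quasi-basis moves the coefficients, which lie in \<open>B\<close>, past \<open>x\<close>,
  where they recombine to \<open>l\<^sup>* a\<close>. With \<open>D = A\<close> and \<open>x = 1\<close> this says that the index element is central;
  with \<open>D = A\<^sub>2\<close> it produces elements of \<open>A' \<inter> A\<^sub>2\<close>.
\<close>

lemma average_commutes:
  fixes D :: "'d cstar"
  assumes D: "cstar_algebra D" and \<phi>: "\<phi> \<in> carrier A \<rightarrow> carrier D"
    and add: "\<And>x y. \<lbrakk>x \<in> carrier A; y \<in> carrier A\<rbrakk> \<Longrightarrow> \<phi> (x \<oplus> y) = \<phi> x \<oplus>\<^bsub>D\<^esub> \<phi> y"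
    and mult: "\<And>x y. \<lbrakk>x \<in> carrier A; y \<in> carrier A\<rbrakk> \<Longrightarrow> \<phi> (x \<otimes> y) = \<phi> x \<otimes>\<^bsub>D\<^esub> \<phi> y"
    and x: "x \<in> carrier D" and comm: "\<And>b. b \<in> B \<Longrightarrow> x \<otimes>\<^bsub>D\<^esub> \<phi> b = \<phi> b \<otimes>\<^bsub>D\<^esub> x"
    and a: "a \<in> carrier A"
  shows "\<phi> a \<otimes>\<^bsub>D\<^esub> (\<Oplus>\<^bsub>D\<^esub>l\<in>L. \<phi> l \<otimes>\<^bsub>D\<^esub> x \<otimes>\<^bsub>D\<^esub> \<phi> (star A l))
       = (\<Oplus>\<^bsub>D\<^esub>l\<in>L. \<phi> l \<otimes>\<^bsub>D\<^esub> x \<otimes>\<^bsub>D\<^esub> \<phi> (star A l)) \<otimes>\<^bsub>D\<^esub> \<phi> a"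
proof -
  interpret D: cstar_algebra D by (rule D)
  have \<phi>c [simp]: "\<phi> y \<in> carrier D" if "y \<in> carrier A" for y using \<phi> that by auto
  note [simp] = x a
  have \<phi>sum: "\<phi> (\<Oplus>i\<in>L. g i) = (\<Oplus>\<^bsub>D\<^esub>i\<in>L. \<phi> (g i))" if "g \<in> L \<rightarrow> carrier A" for g
    using that by (intro additive_finsum[OF abelian_group D.abelian_group \<phi>]) (auto simp: add)
  have "\<phi> a \<otimes>\<^bsub>D\<^esub> (\<Oplus>\<^bsub>D\<^esub>l\<in>L. \<phi> l \<otimes>\<^bsub>D\<^esub> x \<otimes>\<^bsub>D\<^esub> \<phi> (star A l))
      = (\<Oplus>\<^bsub>D\<^esub>l\<in>L. \<phi> a \<otimes>\<^bsub>D\<^esub> (\<phi> l \<otimes>\<^bsub>D\<^esub> x \<otimes>\<^bsub>D\<^esub> \<phi> (star A l)))"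
    by (rule D.mult_finsum_right) auto
  also have "\<dots> = (\<Oplus>\<^bsub>D\<^esub>l\<in>L. \<Oplus>\<^bsub>D\<^esub>m\<in>L. \<phi> m \<otimes>\<^bsub>D\<^esub> x \<otimes>\<^bsub>D\<^esub> \<phi> (E (star A m \<otimes> a \<otimes> l) \<otimes> star A l))"
  proof (rule D.finsum_cong'[OF refl])
    show "(\<lambda>l. \<Oplus>\<^bsub>D\<^esub>m\<in>L. \<phi> m \<otimes>\<^bsub>D\<^esub> x \<otimes>\<^bsub>D\<^esub> \<phi> (E (star A m \<otimes> a \<otimes> l) \<otimes> star A l)) \<in> L \<rightarrow> carrier D"
      by (auto intro!: D.finsum_closed)
    fix l assume l: "l \<in> L"
    have "\<phi> a \<otimes>\<^bsub>D\<^esub> (\<phi> l \<otimes>\<^bsub>D\<^esub> x \<otimes>\<^bsub>D\<^esub> \<phi> (star A l)) = \<phi> (a \<otimes> l) \<otimes>\<^bsub>D\<^esub> (x \<otimes>\<^bsub>D\<^esub> \<phi> (star A l))"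
      using l by (simp add: mult D.m_assoc)
    also have "\<phi> (a \<otimes> l) = (\<Oplus>\<^bsub>D\<^esub>m\<in>L. \<phi> (m \<otimes> E (star A m \<otimes> a \<otimes> l)))"
      using l \<phi>sum[of "\<lambda>m. m \<otimes> E (star A m \<otimes> (a \<otimes> l))"] expand[of "a \<otimes> l"] by (simp add: m_assoc Pi_def cong: D.finsum_cong)
    also have "\<dots> \<otimes>\<^bsub>D\<^esub> (x \<otimes>\<^bsub>D\<^esub> \<phi> (star A l))
        = (\<Oplus>\<^bsub>D\<^esub>m\<in>L. \<phi> (m \<otimes> E (star A m \<otimes> a \<otimes> l)) \<otimes>\<^bsub>D\<^esub> (x \<otimes>\<^bsub>D\<^esub> \<phi> (star A l)))"
      using l by (intro D.mult_finsum_left) auto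
    also have "\<dots> = (\<Oplus>\<^bsub>D\<^esub>m\<in>L. \<phi> m \<otimes>\<^bsub>D\<^esub> x \<otimes>\<^bsub>D\<^esub> \<phi> (E (star A m \<otimes> a \<otimes> l) \<otimes> star A l))"
    proof (rule D.finsum_cong'[OF refl])
      fix m assume m: "m \<in> L"
      let ?b = "E (star A m \<otimes> a \<otimes> l)"
      have b: "?b \<in> B" "?b \<in> carrier A" using l m by simp_all
      have "\<phi> (m \<otimes> ?b) \<otimes>\<^bsub>D\<^esub> (x \<otimes>\<^bsub>D\<^esub> \<phi> (star A l)) = \<phi> m \<otimes>\<^bsub>D\<^esub> (\<phi> ?b \<otimes>\<^bsub>D\<^esub> x) \<otimes>\<^bsub>D\<^esub> \<phi> (star A l)"
        using l m b by (simp add: mult D.m_assoc)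
      also have "\<dots> = \<phi> m \<otimes>\<^bsub>D\<^esub> (x \<otimes>\<^bsub>D\<^esub> \<phi> ?b) \<otimes>\<^bsub>D\<^esub> \<phi> (star A l)" by (simp only: comm[OF b(1)])
      also have "\<dots> = \<phi> m \<otimes>\<^bsub>D\<^esub> x \<otimes>\<^bsub>D\<^esub> \<phi> (?b \<otimes> star A l)"
        using l m b by (simp add: mult D.m_assoc)
      finally show "\<phi> (m \<otimes> ?b) \<otimes>\<^bsub>D\<^esub> (x \<otimes>\<^bsub>D\<^esub> \<phi> (star A l)) = \<phi> m \<otimes>\<^bsub>D\<^esub> x \<otimes>\<^bsub>D\<^esub> \<phi> (?b \<otimes> star A l)" .
    qed (use l in auto)
    finally show "\<phi> a \<otimes>\<^bsub>D\<^esub> (\<phi> l \<otimes>\<^bsub>D\<^esub> x \<otimes>\<^bsub>D\<^esub> \<phi> (star A l))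
        = (\<Oplus>\<^bsub>D\<^esub>m\<in>L. \<phi> m \<otimes>\<^bsub>D\<^esub> x \<otimes>\<^bsub>D\<^esub> \<phi> (E (star A m \<otimes> a \<otimes> l) \<otimes> star A l))" .
  qed
  also have "\<dots> = (\<Oplus>\<^bsub>D\<^esub>m\<in>L. \<Oplus>\<^bsub>D\<^esub>l\<in>L. \<phi> m \<otimes>\<^bsub>D\<^esub> x \<otimes>\<^bsub>D\<^esub> \<phi> (E (star A m \<otimes> a \<otimes> l) \<otimes> star A l))"
    by (rule D.finsum_swap) auto
  also have "\<dots> = (\<Oplus>\<^bsub>D\<^esub>m\<in>L. (\<phi> m \<otimes>\<^bsub>D\<^esub> x \<otimes>\<^bsub>D\<^esub> \<phi> (star A m)) \<otimes>\<^bsub>D\<^esub> \<phi> a)"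
  proof (rule D.finsum_cong'[OF refl])
    fix m assume m: "m \<in> L"
    have "(\<Oplus>\<^bsub>D\<^esub>l\<in>L. \<phi> m \<otimes>\<^bsub>D\<^esub> x \<otimes>\<^bsub>D\<^esub> \<phi> (E (star A m \<otimes> a \<otimes> l) \<otimes> star A l))
        = \<phi> m \<otimes>\<^bsub>D\<^esub> x \<otimes>\<^bsub>D\<^esub> (\<Oplus>\<^bsub>D\<^esub>l\<in>L. \<phi> (E (star A m \<otimes> a \<otimes> l) \<otimes> star A l))"
      using m by (intro D.mult_finsum_right[symmetric]) auto
    also have "(\<Oplus>\<^bsub>D\<^esub>l\<in>L. \<phi> (E (star A m \<otimes> a \<otimes> l) \<otimes> star A l)) = \<phi> (star A m \<otimes> a)"
      using m \<phi>sum[of "\<lambda>l. E (star A m \<otimes> a \<otimes> l) \<otimes> star A l"] expand_right[of "star A m \<otimes> a"] by (simp add: Pi_def)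
    finally show "(\<Oplus>\<^bsub>D\<^esub>l\<in>L. \<phi> m \<otimes>\<^bsub>D\<^esub> x \<otimes>\<^bsub>D\<^esub> \<phi> (E (star A m \<otimes> a \<otimes> l) \<otimes> star A l))
      = (\<phi> m \<otimes>\<^bsub>D\<^esub> x \<otimes>\<^bsub>D\<^esub> \<phi> (star A m)) \<otimes>\<^bsub>D\<^esub> \<phi> a"
      using m by (simp add: mult D.m_assoc)
  qed auto
  also have "\<dots> = (\<Oplus>\<^bsub>D\<^esub>l\<in>L. \<phi> l \<otimes>\<^bsub>D\<^esub> x \<otimes>\<^bsub>D\<^esub> \<phi> (star A l)) \<otimes>\<^bsub>D\<^esub> \<phi> a"
    by (rule D.mult_finsum_left[symmetric]) auto
  finally show ?thesis .
qed

text \<open>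
  The index element is central, hence scalar. It is a sum of positive elements, and if it vanished then
  every \<open>l\<close> would vanish, contradicting the expansion of 1.
\<close>

lemma index_scalar: "\<exists>r>0. (\<Oplus>l\<in>L. l \<otimes> star A l) = of_real r \<odot> \<one>"
proof -
  define h where "h = (\<Oplus>l\<in>L. l \<otimes> star A l)"
  have h: "h \<in> carrier A" by (auto simp: h_def intro!: finsum_closed)
  have "h = (\<Oplus>l\<in>L. l \<otimes> \<one> \<otimes> star A l)" unfolding h_def by (rule finsum_cong') auto
  then have "a \<otimes> h = h \<otimes> a" if "a \<in> carrier A" for a
    using average_commutes[OF cstar_algebra_axioms, of "\<lambda>x. x" "\<one>" a] that by simp
  then obtain c where c: "h = c \<odot> \<one>" using commutant_scalar[OF h] by auto
  have pos: "pos (l \<otimes> star A l)" if "l \<in> L" for l using pos_star_mult[of "star A l"] that by simp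
  then have hp: "pos h" unfolding h_def by (intro pos_finsum) auto
  obtain r where r: "c = complex_of_real r" "0 \<le> r"
    using pos_scalar[of c] hp nontrivial c by auto
  have "r \<noteq> 0"
  proof
    assume "r = 0"
    then have h0: "h = \<zero>" by (simp add: c r)
    have "l = \<zero>" if l: "l \<in> L" for l
    proof -
      have "l \<otimes> star A l = \<zero>"
        by (rule finsum_pos_zero[OF finite_L pos h0[unfolded h_def] l])
      then have "star A l = \<zero>" using star_mult_zero[of "star A l"] l by simp
      then show ?thesis by (metis L_carrier l star_star star_zero)
    qed
    then have "l \<otimes> E (star A l \<otimes> \<one>) = \<zero>" if "l \<in> L" for l
      using that by (metis E_closed L_carrier l_null m_closed one_closed star_closed)
    then have "(\<Oplus>l\<in>L. l \<otimes> E (star A l \<otimes> \<one>)) = \<zero>" by (rule finsum_eq_zero)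
    then show False using expand[of "\<one>"] nontrivial by simp
  qed
  then show ?thesis using c r by (intro exI[of _ r]) (simp add: h_def)
qed

definition index :: real where
  "index = (THE r. (\<Oplus>l\<in>L. l \<otimes> star A l) = of_real r \<odot> \<one>)"

lemma index: "(\<Oplus>l\<in>L. l \<otimes> star A l) = of_real index \<odot> \<one>" "index > 0"
proof -
  obtain r where r: "r > 0" "(\<Oplus>l\<in>L. l \<otimes> star A l) = of_real r \<odot> \<one>" using index_scalar by blast
  have "index = r"
    unfolding index_def r(2)
  proof (rule the_equality)
    show "t = r" if "of_real r \<odot> \<one> = of_real t \<odot> \<one>" for t
      using scalar_inj[OF that] by simp
  qed simp
  then show "(\<Oplus>l\<in>L. l \<otimes> star A l) = of_real index \<odot> \<one>" "index > 0" using r by auto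
qed

lemma index_eqI: "(\<Oplus>l\<in>L. l \<otimes> star A l) = of_real r \<odot> \<one> \<Longrightarrow> index = r"
  using scalar_inj[of "complex_of_real index" "complex_of_real r"] by (simp add: index)

text \<open>Expand each element of one quasi-basis in the other and interchange the sums.\<close>

lemma quasi_basis_index:
  assumes L': "quasi_basis A E L'"
  shows "(\<Oplus>l\<in>L'. l \<otimes> star A l) = of_real index \<odot> \<one>"
proof -
  have f [simp]: "finite L'" and c [simp]: "l \<in> L' \<Longrightarrow> l \<in> carrier A" for l
    using L' by (auto simp: quasi_basis_def)
  have e: "(\<Oplus>l\<in>L'. E (x \<otimes> l) \<otimes> star A l) = x" if "x \<in> carrier A" for x
    using L' that by (simp add: quasi_basis_def)
  have "(\<Oplus>l\<in>L'. l \<otimes> star A l) = (\<Oplus>l\<in>L'. \<Oplus>m\<in>L. m \<otimes> (E (star A m \<otimes> l) \<otimes> star A l))"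
  proof (rule finsum_cong'[OF refl])
    fix l assume l: "l \<in> L'"
    have "(\<Oplus>m\<in>L. m \<otimes> E (star A m \<otimes> l)) \<otimes> star A l = (\<Oplus>m\<in>L. m \<otimes> E (star A m \<otimes> l) \<otimes> star A l)"
      using l by (intro mult_finsum_left) auto
    also have "\<dots> = (\<Oplus>m\<in>L. m \<otimes> (E (star A m \<otimes> l) \<otimes> star A l))"
      using l by (intro finsum_cong') (auto simp: m_assoc)
    finally show "l \<otimes> star A l = (\<Oplus>m\<in>L. m \<otimes> (E (star A m \<otimes> l) \<otimes> star A l))"
      using l by (simp add: expand)
  qed (auto intro!: finsum_closed)
  also have "\<dots> = (\<Oplus>m\<in>L. \<Oplus>l\<in>L'. m \<otimes> (E (star A m \<otimes> l) \<otimes> star A l))"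
    by (rule finsum_swap) auto
  also have "\<dots> = (\<Oplus>m\<in>L. m \<otimes> star A m)"
  proof (rule finsum_cong'[OF refl])
    fix m assume m: "m \<in> L"
    have "(\<Oplus>l\<in>L'. m \<otimes> (E (star A m \<otimes> l) \<otimes> star A l)) = m \<otimes> (\<Oplus>l\<in>L'. E (star A m \<otimes> l) \<otimes> star A l)"
      using m by (intro mult_finsum_right[symmetric]) auto
    then show "(\<Oplus>l\<in>L'. m \<otimes> (E (star A m \<otimes> l) \<otimes> star A l)) = m \<otimes> star A m"
      using m by (simp add: e)
  qed auto
  finally show ?thesis using index by simp
qed

lemma index_element: "index_element A E = of_real index \<odot> \<one>"
  unfolding index_element_def by (rule quasi_basis_index[OF someI[of "quasi_basis A E", OF quasi_basis]])

text \<open>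
  The other expectation has the form \<open>x \<mapsto> E(x h)\<close>. Its right \<open>B\<close>-linearity forces \<open>h\<close> to commute with
  \<open>B\<close>, so \<open>h\<close> is scalar, and the value at 1 is 1.
\<close>

lemma expectation_unique:
  assumes E': "conditional_expectation A B E'" shows "E' = E"
proof -
  interpret E': cond_exp A B E' by unfold_locales (rule E')
  define h where "h = (\<Oplus>l\<in>L. l \<otimes> E' (star A l))"
  have h [simp]: "h \<in> carrier A" by (auto simp: h_def intro!: finsum_closed)
  have eq: "E' x = E (x \<otimes> h)" if x: "x \<in> carrier A" for x
  proof -
    have "E' x = E' (\<Oplus>l\<in>L. E (x \<otimes> l) \<otimes> star A l)" using x by (simp add: expand_right)
    also have "\<dots> = (\<Oplus>l\<in>L. E' (E (x \<otimes> l) \<otimes> star A l))" using x by (intro E'.E_finsum) auto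
    also have "\<dots> = (\<Oplus>l\<in>L. E (x \<otimes> (l \<otimes> E' (star A l))))"
      using x by (intro finsum_cong') (auto simp: E'.E_left m_assoc[symmetric] E_right)
    also have "\<dots> = E (\<Oplus>l\<in>L. x \<otimes> (l \<otimes> E' (star A l)))" using x by (intro E_finsum[symmetric]) auto
    also have "\<dots> = E (x \<otimes> h)" unfolding h_def using x by (subst mult_finsum_right) auto
    finally show ?thesis .
  qed
  have "h \<otimes> b = b \<otimes> h" if b: "b \<in> B" for b
  proof -
    have z: "E (y \<otimes> (b \<otimes> h \<ominus> h \<otimes> b)) = \<zero>" if y: "y \<in> carrier A" for y
    proof -
      have "E (y \<otimes> (b \<otimes> h \<ominus> h \<otimes> b)) = E (y \<otimes> b \<otimes> h) \<ominus> E (y \<otimes> h \<otimes> b)"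
        using y b by (simp add: minus_distrib_right E_diff m_assoc)
      also have "\<dots> = E' (y \<otimes> b) \<ominus> E' y \<otimes> b" using y b by (simp add: eq E_right)
      also have "\<dots> = \<zero>" using y b by (simp add: E'.E_right minus_self)
      finally show ?thesis .
    qed
    have "b \<otimes> h \<ominus> h \<otimes> b = \<zero>" by (rule E_nondegenerate[OF _ z]) (use b in simp_all)
    then show ?thesis using b by (simp add: minus_eq_zero_iff)
  qed
  then obtain c where c: "h = c \<odot> \<one>" using commutant_scalar[OF h] by blast
  have "E' \<one> = c \<odot> E \<one>" unfolding eq[OF one_closed] c by (simp add: E_smult del: E_fix)
  then have "1 \<odot> \<one> = c \<odot> \<one>" by simp
  then have "h = \<one>" using c scalar_inj[of 1 c] by simp
  then have "E' x = E x" if "x \<in> carrier A" for x using eq that by simp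
  then show ?thesis using E_ext E'.E_ext by (intro PiE_ext) blast+
qed

text \<open>Uniqueness leaves no competitor, and the index of \<open>E\<close> is a real scalar.\<close>

lemma minimal_expectation_iff: "minimal_expectation A B F \<longleftrightarrow> F = E"
proof
  assume "minimal_expectation A B F"
  then show "F = E" unfolding minimal_expectation_def finite_index_expectation_def by (blast intro: expectation_unique)
next
  assume F: "F = E"
  have 1: "finite_index_expectation A B E"
    unfolding finite_index_expectation_def using expectation quasi_basis by blast
  have "index \<le> r'" if "finite_index_expectation A B E'" "index_element A E' = complex_of_real r' \<odot> \<one>" for E' r'
  proof -
    have "E' = E" using that expectation_unique unfolding finite_index_expectation_def by blast
    then have "of_real index \<odot> \<one> = complex_of_real r' \<odot> \<one>" using that index_element by simp
    then show ?thesis by (auto dest: scalar_inj)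
  qed
  then show "minimal_expectation A B F"
    unfolding minimal_expectation_def F using 1 index_element by blast
qed

lemma min_expectation: "min_expectation A B = E"
  unfolding min_expectation_def minimal_expectation_iff by simp

lemma min_index: "min_index A B = index"
  unfolding min_index_def min_expectation index_element by (rule the_equality) (auto dest: scalar_inj)

end

section \<open>The basic construction is a C*-algebra\<close>

lemma complex_ring_cring: "cring complex_ring"
proof (rule cringI)
  show "abelian_group complex_ring"
  proof (rule abelian_groupI)
    show "\<exists>y\<in>carrier complex_ring. y \<oplus>\<^bsub>complex_ring\<^esub> x = \<zero>\<^bsub>complex_ring\<^esub>" for x
      by (auto simp: complex_ring_def intro: exI[of _ "- x"])
  qed (auto simp: complex_ring_def)
  show "comm_monoid complex_ring" by (rule comm_monoidI) (auto simp: complex_ring_def)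
qed (auto simp: complex_ring_def algebra_simps)

lemma finsum_subalgebra:
  assumes A: "cstar_algebra A" and C: "cstar_subalgebra C A" and "finite I" and "\<And>i. i \<in> I \<Longrightarrow> g i \<in> C"
  shows "(\<Oplus>\<^bsub>A\<^esub>i\<in>I. g i) \<in> C"
proof -
  interpret cstar_algebra A by (rule A)
  note C = cstar_subalgebraD[OF C]
  show ?thesis using assms(3,4)
  proof (induction I rule: finite_induct)
    case (insert i I)
    then have "g \<in> I \<rightarrow> carrier A" "g i \<in> carrier A" using C(2) by auto
    with insert C show ?case by simp
  qed (simp add: C)
qed

context inclusion
begin

abbreviation hn :: "'a \<Rightarrow> real" where "hn \<equiv> hnorm A E"

lemma hn_square: "x \<in> carrier A \<Longrightarrow> (hn x)\<^sup>2 = nrm A (E (star A x \<otimes> x))"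
  by (simp add: hnorm_def hinner_def nrm_nonneg)

lemma hn_nonneg [simp]: "x \<in> carrier A \<Longrightarrow> 0 \<le> hn x"
  by (simp add: hnorm_def hinner_def nrm_nonneg)

lemma hn_eq_0: "x \<in> carrier A \<Longrightarrow> hn x = 0 \<longleftrightarrow> x = \<zero>"
  using E_faithful[of x] by (auto simp: hnorm_def hinner_def nrm_eq_0)

lemma hn_zero [simp]: "hn \<zero> = 0"
  by (simp add: hn_eq_0)

text \<open>The Cauchy-Schwarz inequality of the Hilbert \<open>B\<close>-module \<open>A\<close>.\<close>

lemma inner_bound:
  assumes "x \<in> carrier A" "y \<in> carrier A"
  shows "nrm A (E (star A x \<otimes> y)) \<le> hn x * hn y"
proof -
  have "(nrm A (E (star A x \<otimes> y)))\<^sup>2 \<le> (hn x * hn y)\<^sup>2"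
    using cauchy_schwarz[OF assms] assms by (simp add: power_mult_distrib hn_square)
  then show ?thesis by (rule power2_le_imp_le) (simp add: assms)
qed

lemma hn_smult: "x \<in> carrier A \<Longrightarrow> hn (c \<odot> x) = cmod c * hn x"
proof -
  assume x: "x \<in> carrier A"
  have "star A (c \<odot> x) \<otimes> (c \<odot> x) = complex_of_real ((cmod c)\<^sup>2) \<odot> (star A x \<otimes> x)"
    unfolding complex_norm_square using x by (simp add: star_smult smult_mult_left smult_mult_right mult.commute)
  then have "nrm A (E (star A (c \<odot> x) \<otimes> (c \<odot> x))) = (cmod c)\<^sup>2 * nrm A (E (star A x \<otimes> x))"
    using x by (simp add: E_smult nrm_smult norm_power)
  then show ?thesis by (simp add: hnorm_def hinner_def real_sqrt_mult)
qed

lemma hn_triangle: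
  assumes x: "x \<in> carrier A" and y: "y \<in> carrier A"
  shows "hn (x \<oplus> y) \<le> hn x + hn y"
proof (rule power2_le_imp_le)
  have "star A (x \<oplus> y) \<otimes> (x \<oplus> y) = (star A x \<otimes> x \<oplus> star A x \<otimes> y) \<oplus> (star A y \<otimes> x \<oplus> star A y \<otimes> y)"
    using x y by (simp add: star_add l_distr r_distr a_ac)
  then have "(hn (x \<oplus> y))\<^sup>2 = nrm A ((E (star A x \<otimes> x) \<oplus> E (star A x \<otimes> y)) \<oplus> (E (star A y \<otimes> x) \<oplus> E (star A y \<otimes> y)))"
    using x y by (simp add: hn_square E_add)
  also have "\<dots> \<le> (nrm A (E (star A x \<otimes> x)) + nrm A (E (star A x \<otimes> y)))
      + (nrm A (E (star A y \<otimes> x)) + nrm A (E (star A y \<otimes> y)))"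
    using x y by (intro order.trans[OF nrm_triangle] add_mono nrm_triangle) auto
  also have "\<dots> \<le> ((hn x)\<^sup>2 + hn x * hn y) + (hn y * hn x + (hn y)\<^sup>2)"
    using x y by (intro add_mono inner_bound) (auto simp: hn_square)
  also have "\<dots> = (hn x + hn y)\<^sup>2" by (simp add: power2_eq_square algebra_simps)
  finally show "(hn (x \<oplus> y))\<^sup>2 \<le> (hn x + hn y)\<^sup>2" .
qed (use x y in auto)

lemma hn_finsum: "\<lbrakk>finite I; g \<in> I \<rightarrow> carrier A\<rbrakk> \<Longrightarrow> hn (\<Oplus>i\<in>I. g i) \<le> (\<Sum>i\<in>I. hn (g i))"
proof (induction I rule: finite_induct)
  case empty
  then show ?case using hn_eq_0[of "\<zero>"] by simp
next
  case (insert i I)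
  then have g: "g \<in> I \<rightarrow> carrier A" "g i \<in> carrier A" by auto
  then have "hn (g i \<oplus> (\<Oplus>i\<in>I. g i)) \<le> hn (g i) + hn (\<Oplus>i\<in>I. g i)"
    by (intro hn_triangle finsum_closed)
  with insert g show ?case by simp
qed

lemma hn_le_nrm:
  assumes x: "x \<in> carrier A" shows "hn x \<le> nrm A x"
proof (rule power2_le_imp_le)
  show "(hn x)\<^sup>2 \<le> (nrm A x)\<^sup>2"
    using E_norm[of "star A x \<otimes> x"] x by (simp add: hn_square nrm_cstar)
qed (simp add: nrm_nonneg x)

text \<open>
  Apply \<open>E\<close> to \<open>x\<^sup>* a\<^sup>* a x \<le> \<parallel>a\<parallel>\<^sup>2 x\<^sup>* x\<close>.
\<close>

lemma hn_mult:
  assumes a: "a \<in> carrier A" and x: "x \<in> carrier A"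
  shows "hn (a \<otimes> x) \<le> nrm A a * hn x"
proof (rule power2_le_imp_le)
  have "pos (complex_of_real (nrm A (star A a \<otimes> a)) \<odot> (star A x \<otimes> x) \<ominus> star A x \<otimes> (star A a \<otimes> a) \<otimes> x)"
    using a x by (intro pos_norm_conj) (auto simp: star_mult)
  then have "pos (E (complex_of_real (nrm A (star A a \<otimes> a)) \<odot> (star A x \<otimes> x) \<ominus> star A x \<otimes> (star A a \<otimes> a) \<otimes> x))"
    by (rule E_pos)
  then have 1: "pos (complex_of_real ((nrm A a)\<^sup>2) \<odot> E (star A x \<otimes> x) \<ominus> E (star A (a \<otimes> x) \<otimes> (a \<otimes> x)))"
    using a x by (simp add: E_diff E_smult star_mult nrm_cstar m_assoc)
  have "nrm A (E (star A (a \<otimes> x) \<otimes> (a \<otimes> x))) \<le> nrm A (complex_of_real ((nrm A a)\<^sup>2) \<odot> E (star A x \<otimes> x))"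
    by (rule norm_mono[OF _ 1]) (use a x in \<open>auto intro!: E_pos pos_star_mult\<close>)
  then show "(hn (a \<otimes> x))\<^sup>2 \<le> (nrm A a * hn x)\<^sup>2"
    using a x by (simp add: hn_square power_mult_distrib nrm_smult norm_power)
qed (use a x in \<open>auto simp: nrm_nonneg\<close>)

text \<open>
  The right \<open>B\<close>-linear map \<open>\<Sum> t(l) e\<^sub>1 l\<^sup>*\<close>. Every map in \<open>maps\<close> has this form with \<open>t\<close> its own values on
  the quasi-basis, which makes boundedness and completeness questions about finitely many elements of \<open>A\<close>.
\<close>

definition synth :: "('a \<Rightarrow> 'a) \<Rightarrow> 'a \<Rightarrow> 'a" where
  "synth t = (\<lambda>x\<in>carrier A. \<Oplus>l\<in>L. t l \<otimes> E (star A l \<otimes> x))"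

lemma hn_synth:
  assumes t: "t \<in> L \<rightarrow> carrier A" and x: "x \<in> carrier A"
  shows "hn (synth t x) \<le> (\<Sum>l\<in>L. nrm A (t l) * hn l) * hn x"
proof -
  have tc [simp]: "t l \<in> carrier A" if "l \<in> L" for l using t that by auto
  have "hn (synth t x) \<le> (\<Sum>l\<in>L. hn (t l \<otimes> E (star A l \<otimes> x)))"
    using x by (simp add: synth_def) (intro hn_finsum, auto)
  also have "\<dots> \<le> (\<Sum>l\<in>L. nrm A (t l) * (hn l * hn x))"
  proof (rule sum_mono)
    fix l assume l: "l \<in> L"
    have "hn (t l \<otimes> E (star A l \<otimes> x)) \<le> nrm A (t l) * hn (E (star A l \<otimes> x))"
      using l x by (intro hn_mult) auto
    also have "\<dots> \<le> nrm A (t l) * nrm A (E (star A l \<otimes> x))"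
      using l x by (intro mult_left_mono hn_le_nrm nrm_nonneg) auto
    also have "\<dots> \<le> nrm A (t l) * (hn l * hn x)"
      using l x by (intro mult_left_mono inner_bound nrm_nonneg) auto
    finally show "hn (t l \<otimes> E (star A l \<otimes> x)) \<le> nrm A (t l) * (hn l * hn x)" .
  qed
  finally show ?thesis by (simp add: sum_distrib_right mult.assoc)
qed

text \<open>
  With a finite quasi-basis the module norm and the norm of \<open>A\<close> are equivalent (the other inequality is
  \<open>hn_le_nrm\<close>), so completeness of \<open>A\<close> can be used for the module.
\<close>

lemma nrm_le_hn: "\<exists>C\<ge>0. \<forall>x\<in>carrier A. nrm A x \<le> C * hn x"
proof (intro exI conjI ballI)
  let ?C = "\<Sum>l\<in>L. nrm A l * hn l"
  show "0 \<le> ?C" by (intro sum_nonneg) (auto simp: nrm_nonneg)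
  fix x assume x: "x \<in> carrier A"
  have "nrm A x = nrm A (\<Oplus>l\<in>L. l \<otimes> E (star A l \<otimes> x))" using x by (simp add: expand)
  also have "\<dots> \<le> (\<Sum>l\<in>L. nrm A (l \<otimes> E (star A l \<otimes> x)))" using x by (intro nrm_finsum) auto
  also have "\<dots> \<le> (\<Sum>l\<in>L. nrm A l * (hn l * hn x))"
  proof (rule sum_mono)
    fix l assume l: "l \<in> L"
    have "nrm A (l \<otimes> E (star A l \<otimes> x)) \<le> nrm A l * nrm A (E (star A l \<otimes> x))"
      using l x by (intro nrm_mult) auto
    also have "\<dots> \<le> nrm A l * (hn l * hn x)"
      using l x by (intro mult_left_mono inner_bound nrm_nonneg) auto
    finally show "nrm A (l \<otimes> E (star A l \<otimes> x)) \<le> nrm A l * (hn l * hn x)" .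
  qed
  finally show "nrm A x \<le> ?C * hn x" by (simp add: sum_distrib_right mult.assoc)
qed

text \<open>
  Adjointability is left out: over a finite quasi-basis it follows from right \<open>B\<close>-linearity, see
  \<open>M_carrier\<close>.
\<close>

definition maps :: "('a \<Rightarrow> 'a) set" where
  "maps = {T \<in> carrier A \<rightarrow>\<^sub>E carrier A.
     (\<forall>x\<in>carrier A. \<forall>y\<in>carrier A. T (x \<oplus> y) = T x \<oplus> T y) \<and>
     (\<forall>x\<in>carrier A. \<forall>b\<in>B. T (x \<otimes> b) = T x \<otimes> b)}"

lemma mapsI:
  assumes "\<And>x. x \<in> carrier A \<Longrightarrow> f x \<in> carrier A"
    "\<And>x y. \<lbrakk>x \<in> carrier A; y \<in> carrier A\<rbrakk> \<Longrightarrow> f (x \<oplus> y) = f x \<oplus> f y"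
    "\<And>x b. \<lbrakk>x \<in> carrier A; b \<in> B\<rbrakk> \<Longrightarrow> f (x \<otimes> b) = f x \<otimes> b"
  shows "(\<lambda>x\<in>carrier A. f x) \<in> maps"
  using assms by (auto simp: maps_def)

lemma maps_closed [simp]: "\<lbrakk>T \<in> maps; x \<in> carrier A\<rbrakk> \<Longrightarrow> T x \<in> carrier A"
  by (auto simp: maps_def)

lemma maps_add: "\<lbrakk>T \<in> maps; x \<in> carrier A; y \<in> carrier A\<rbrakk> \<Longrightarrow> T (x \<oplus> y) = T x \<oplus> T y"
  by (auto simp: maps_def)

lemma maps_right: "\<lbrakk>T \<in> maps; x \<in> carrier A; b \<in> B\<rbrakk> \<Longrightarrow> T (x \<otimes> b) = T x \<otimes> b"
  by (auto simp: maps_def)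

lemma maps_ext: "\<lbrakk>S \<in> maps; T \<in> maps; \<And>x. x \<in> carrier A \<Longrightarrow> S x = T x\<rbrakk> \<Longrightarrow> S = T"
  by (rule PiE_ext[where s = "\<lambda>_. carrier A" and k = "carrier A"]) (auto simp: maps_def)

lemma maps_smult: "\<lbrakk>T \<in> maps; x \<in> carrier A\<rbrakk> \<Longrightarrow> T (c \<odot> x) = c \<odot> T x"
  using maps_right[of T x "c \<odot> \<one>"] by (simp add: smult_mult_one)

lemma maps_zero [simp]: "T \<in> maps \<Longrightarrow> T \<zero> = \<zero>"
  using maps_smult[of T "\<zero>" 0] by simp

lemma maps_diff: "\<lbrakk>T \<in> maps; x \<in> carrier A; y \<in> carrier A\<rbrakk> \<Longrightarrow> T (x \<ominus> y) = T x \<ominus> T y"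
  using maps_add[of T x "(-1) \<odot> y"] maps_smult[of T y "-1"] by (simp add: minus_eq minus_eq_smult)

lemma maps_finsum: "\<lbrakk>T \<in> maps; g \<in> I \<rightarrow> carrier A\<rbrakk> \<Longrightarrow> T (\<Oplus>i\<in>I. g i) = (\<Oplus>i\<in>I. T (g i))"
  by (rule finsum_additive) (auto simp: maps_add)

lemma maps_expand:
  assumes T: "T \<in> maps" and x: "x \<in> carrier A"
  shows "T x = (\<Oplus>l\<in>L. T l \<otimes> E (star A l \<otimes> x))"
proof -
  have "T x = T (\<Oplus>l\<in>L. l \<otimes> E (star A l \<otimes> x))" using x by (simp add: expand)
  also have "\<dots> = (\<Oplus>l\<in>L. T (l \<otimes> E (star A l \<otimes> x)))" using T x by (intro maps_finsum) auto
  also have "\<dots> = (\<Oplus>l\<in>L. T l \<otimes> E (star A l \<otimes> x))"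
    using T x by (intro finsum_cong') (auto simp: maps_right)
  finally show ?thesis .
qed

lemma rank_one_sum_maps:
  assumes "s \<in> I \<rightarrow> carrier A" "t \<in> I \<rightarrow> carrier A"
  shows "(\<lambda>x\<in>carrier A. \<Oplus>l\<in>I. s l \<otimes> E (t l \<otimes> x)) \<in> maps"
proof (rule mapsI)
  have [simp]: "s l \<in> carrier A" "t l \<in> carrier A" if "l \<in> I" for l using assms that by auto
  fix x assume x: "x \<in> carrier A"
  show "(\<Oplus>l\<in>I. s l \<otimes> E (t l \<otimes> x)) \<in> carrier A" using x by (intro finsum_closed) auto
  show "(\<Oplus>l\<in>I. s l \<otimes> E (t l \<otimes> (x \<oplus> y))) = (\<Oplus>l\<in>I. s l \<otimes> E (t l \<otimes> x)) \<oplus> (\<Oplus>l\<in>I. s l \<otimes> E (t l \<otimes> y))"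
    if y: "y \<in> carrier A" for y
    by (rule trans[OF finsum_cong'[OF refl] finsum_addf]) (use x y in \<open>auto simp: r_distr E_add\<close>)
  show "(\<Oplus>l\<in>I. s l \<otimes> E (t l \<otimes> (x \<otimes> b))) = (\<Oplus>l\<in>I. s l \<otimes> E (t l \<otimes> x)) \<otimes> b" if b: "b \<in> B" for b
    using x b by (subst mult_finsum_left) (auto intro!: finsum_cong' simp: E_right m_assoc[symmetric])
qed

lemma synth_maps: "t \<in> L \<rightarrow> carrier A \<Longrightarrow> synth t \<in> maps"
  unfolding synth_def by (rule rank_one_sum_maps) auto

lemma synth_self: "T \<in> maps \<Longrightarrow> synth T = T"
  by (rule maps_ext[OF synth_maps]) (auto simp: synth_def maps_expand[symmetric])

text \<open>Formally the adjoint of \<open>\<Sum> T(l) e\<^sub>1 l\<^sup>*\<close>.\<close>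

definition adj :: "('a \<Rightarrow> 'a) \<Rightarrow> 'a \<Rightarrow> 'a" where
  "adj T = (\<lambda>x\<in>carrier A. \<Oplus>l\<in>L. l \<otimes> E (star A (T l) \<otimes> x))"

lemma adj_maps: "T \<in> maps \<Longrightarrow> adj T \<in> maps"
  unfolding adj_def by (rule rank_one_sum_maps) auto

lemma adj_inner:
  assumes T: "T \<in> maps" and x: "x \<in> carrier A" and y: "y \<in> carrier A"
  shows "E (star A (T x) \<otimes> y) = E (star A x \<otimes> adj T y)"
proof -
  have "star A (T x) \<otimes> y = (\<Oplus>l\<in>L. E (star A x \<otimes> l) \<otimes> (star A (T l) \<otimes> y))"
    unfolding maps_expand[OF T x] using T x y
    by (subst star_finsum, simp, subst mult_finsum_left)
       (auto intro!: finsum_cong' simp: star_mult E_star[symmetric] m_assoc)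
  then have "E (star A (T x) \<otimes> y) = E (\<Oplus>l\<in>L. E (star A x \<otimes> l) \<otimes> (star A (T l) \<otimes> y))" by simp
  also have "\<dots> = (\<Oplus>l\<in>L. E (star A x \<otimes> l) \<otimes> E (star A (T l) \<otimes> y))"
    using T x y by (subst E_finsum) (auto intro!: finsum_cong' simp: E_left)
  also have "\<dots> = E (\<Oplus>l\<in>L. star A x \<otimes> (l \<otimes> E (star A (T l) \<otimes> y)))"
    using T x y by (subst E_finsum) (auto intro!: finsum_cong' simp: E_right m_assoc[symmetric])
  also have "(\<Oplus>l\<in>L. star A x \<otimes> (l \<otimes> E (star A (T l) \<otimes> y))) = star A x \<otimes> adj T y"
    unfolding adj_def using T x y by (simp, subst mult_finsum_right) auto
  finally show ?thesis .
qed

lemma adj_inner':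
  assumes T: "T \<in> maps" and x: "x \<in> carrier A" and y: "y \<in> carrier A"
  shows "E (star A x \<otimes> T y) = E (star A (adj T x) \<otimes> y)"
  using adj_inner[OF T y x] E_star[of "star A (T y) \<otimes> x"] E_star[of "star A y \<otimes> adj T x"] T x y
  by (simp add: star_mult adj_maps)

text \<open>The inner product is nondegenerate, again by the expansion in the quasi-basis.\<close>

lemma adj_unique:
  assumes T: "T \<in> maps" and S: "S \<in> carrier A \<rightarrow>\<^sub>E carrier A"
    and eq: "\<And>x y. \<lbrakk>x \<in> carrier A; y \<in> carrier A\<rbrakk> \<Longrightarrow> E (star A (T x) \<otimes> y) = E (star A x \<otimes> S y)"
  shows "S = adj T"
proof (rule PiE_ext[OF S])
  show "adj T \<in> carrier A \<rightarrow>\<^sub>E carrier A" using adj_maps[OF T] by (simp add: maps_def)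
  fix y assume y: "y \<in> carrier A"
  have Sy: "S y \<in> carrier A" using S y by auto
  have z: "E (x \<otimes> (S y \<ominus> adj T y)) = \<zero>" if x: "x \<in> carrier A" for x
    using eq[of "star A x" y] adj_inner[OF T, of "star A x" y] x y Sy T
    by (simp add: minus_distrib_right E_diff adj_maps minus_self)
  have "S y \<ominus> adj T y = \<zero>" by (rule E_nondegenerate[OF _ z]) (simp_all add: Sy y T adj_maps)
  then show "S y = adj T y" using Sy y T adj_maps by (simp add: minus_eq_zero_iff)
qed

lemma is_adjoint_iff: "T \<in> maps \<Longrightarrow> is_adjoint A E T S \<longleftrightarrow> S = adj T"
  using adj_unique[of T S] adj_inner adj_maps[of T] unfolding is_adjoint_def hinner_def maps_def by auto

lemma adj_eqI:
  assumes "T \<in> maps" "S \<in> maps"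
    and "\<And>x y. \<lbrakk>x \<in> carrier A; y \<in> carrier A\<rbrakk> \<Longrightarrow> E (star A (T x) \<otimes> y) = E (star A x \<otimes> S y)"
  shows "adj T = S"
  by (rule adj_unique[symmetric]) (use assms in \<open>auto simp: maps_def\<close>)

abbreviation M :: "('a \<Rightarrow> 'a) cstar" where "M \<equiv> adjointable_maps A B E"

lemma M_carrier: "carrier M = maps"
  using is_adjoint_iff unfolding adjointable_maps_def by (auto simp: maps_def)

lemma M_simps:
  "S \<otimes>\<^bsub>M\<^esub> T = compose (carrier A) S T"
  "\<one>\<^bsub>M\<^esub> = (\<lambda>x\<in>carrier A. x)"
  "\<zero>\<^bsub>M\<^esub> = (\<lambda>x\<in>carrier A. \<zero>)"
  "S \<oplus>\<^bsub>M\<^esub> T = (\<lambda>x\<in>carrier A. S x \<oplus> T x)"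
  "c \<odot>\<^bsub>M\<^esub> T = (\<lambda>x\<in>carrier A. c \<odot> T x)"
  "nrm M T = (SUP x\<in>{x \<in> carrier A. hn x \<le> 1}. hn (T x))"
  by (simp_all add: adjointable_maps_def)

lemma M_star: "T \<in> maps \<Longrightarrow> star M T = adj T"
  using is_adjoint_iff[of T] by (auto simp: adjointable_maps_def intro!: the_equality)

lemma M_apply:
  "x \<in> carrier A \<Longrightarrow> (S \<otimes>\<^bsub>M\<^esub> T) x = S (T x)"
  "x \<in> carrier A \<Longrightarrow> \<one>\<^bsub>M\<^esub> x = x"
  "x \<in> carrier A \<Longrightarrow> \<zero>\<^bsub>M\<^esub> x = \<zero>"
  "x \<in> carrier A \<Longrightarrow> (S \<oplus>\<^bsub>M\<^esub> T) x = S x \<oplus> T x"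
  "x \<in> carrier A \<Longrightarrow> (c \<odot>\<^bsub>M\<^esub> T) x = c \<odot> T x"
  by (simp_all add: M_simps compose_eq)

lemma M_maps:
  "\<lbrakk>S \<in> maps; T \<in> maps\<rbrakk> \<Longrightarrow> S \<otimes>\<^bsub>M\<^esub> T \<in> maps"
  "\<one>\<^bsub>M\<^esub> \<in> maps" "\<zero>\<^bsub>M\<^esub> \<in> maps"
  "\<lbrakk>S \<in> maps; T \<in> maps\<rbrakk> \<Longrightarrow> S \<oplus>\<^bsub>M\<^esub> T \<in> maps"
  "T \<in> maps \<Longrightarrow> c \<odot>\<^bsub>M\<^esub> T \<in> maps"
  unfolding M_simps compose_def
  by (auto intro!: mapsI simp: maps_add maps_right smult_add_right smult_mult_left l_distr a_ac)

lemma M_ring: "ring M"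
proof (rule ringI)
  show "abelian_group M"
  proof (rule abelian_groupI)
    show "\<exists>S\<in>carrier M. S \<oplus>\<^bsub>M\<^esub> T = \<zero>\<^bsub>M\<^esub>" if "T \<in> carrier M" for T
      using that M_maps by (intro bexI[of _ "(-1) \<odot>\<^bsub>M\<^esub> T"])
        (auto simp: M_carrier M_apply l_neg smult_minus_left intro!: maps_ext)
  qed (auto simp: M_carrier M_maps M_apply a_ac intro!: maps_ext)
  show "monoid M"
    by (rule monoidI) (auto simp: M_carrier M_maps M_apply intro!: maps_ext)
qed (auto simp: M_carrier M_maps M_apply maps_add intro!: maps_ext)

lemma M_minus: "\<lbrakk>S \<in> maps; T \<in> maps; x \<in> carrier A\<rbrakk> \<Longrightarrow> (S \<ominus>\<^bsub>M\<^esub> T) x = S x \<ominus> T x"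
proof -
  assume *: "S \<in> maps" "T \<in> maps" "x \<in> carrier A"
  interpret M: ring M by (rule M_ring)
  have "\<ominus>\<^bsub>M\<^esub> T = (-1) \<odot>\<^bsub>M\<^esub> T"
    using * by (intro M.minus_equality) (auto simp: M_carrier M_maps M_apply l_neg smult_minus_left intro!: maps_ext)
  then show ?thesis using * by (simp add: a_minus_def M_apply smult_minus_left)
qed

lemma minus_maps: "\<lbrakk>S \<in> maps; T \<in> maps\<rbrakk> \<Longrightarrow> S \<ominus>\<^bsub>M\<^esub> T \<in> maps"
  using ring.ring_simprules(4)[OF M_ring, of S T] by (simp add: M_carrier)

lemma op_bounded:
  assumes T: "T \<in> maps"
  shows "bdd_above ((\<lambda>x. hn (T x)) ` {x \<in> carrier A. hn x \<le> 1})"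
proof (rule bdd_aboveI2)
  let ?K = "\<Sum>l\<in>L. nrm A (T l) * hn l"
  have K: "?K \<ge> 0" using T by (intro sum_nonneg) (auto simp: nrm_nonneg)
  fix x assume x: "x \<in> {x \<in> carrier A. hn x \<le> 1}"
  then have "hn (T x) \<le> ?K * hn x" using hn_synth[of T x] T synth_self[OF T] by auto
  also have "\<dots> \<le> ?K * 1" using x K by (intro mult_left_mono) auto
  finally show "hn (T x) \<le> ?K" by simp
qed

lemma op_bound:
  assumes T: "T \<in> maps" and x: "x \<in> carrier A"
  shows "hn (T x) \<le> nrm M T * hn x"
proof (cases "hn x = 0")
  case True
  then show ?thesis using x T hn_eq_0 by simp
next
  case False
  then have p: "hn x > 0" using hn_nonneg[OF x] by linarith
  let ?y = "of_real (1 / hn x) \<odot> x"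
  have "hn ?y \<le> 1" using x p by (simp add: hn_smult norm_divide)
  then have "hn (T ?y) \<le> nrm M T"
    unfolding M_simps using op_bounded[OF T] x by (intro cSUP_upper) auto
  then show ?thesis using x p T by (simp add: maps_smult hn_smult norm_divide field_simps)
qed

lemma op_least:
  assumes "\<And>x. x \<in> carrier A \<Longrightarrow> hn (T x) \<le> K * hn x" and K: "0 \<le> K"
  shows "nrm M T \<le> K"
  unfolding M_simps
proof (rule cSUP_least)
  show "{x \<in> carrier A. hn x \<le> 1} \<noteq> {}" using hn_eq_0[of "\<zero>"] by auto
  fix x assume "x \<in> {x \<in> carrier A. hn x \<le> 1}"
  then show "hn (T x) \<le> K" using assms(1)[of x] mult_left_mono[of "hn x" 1 K] K by auto
qed

lemma op_nonneg: assumes T: "T \<in> maps" shows "0 \<le> nrm M T"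
proof -
  have "hn \<one> \<noteq> 0" by (simp add: hn_eq_0 nontrivial)
  then have one: "hn \<one> > 0" using hn_nonneg[OF one_closed] by linarith
  have "0 \<le> hn (T \<one>)" using T by simp
  also have "\<dots> \<le> nrm M T * hn \<one>" by (rule op_bound[OF T one_closed])
  finally show ?thesis using one by (simp add: zero_le_mult_iff)
qed

lemma op_eq_0: assumes T: "T \<in> maps" shows "nrm M T = 0 \<longleftrightarrow> T = \<zero>\<^bsub>M\<^esub>"
proof
  assume z: "nrm M T = 0"
  show "T = \<zero>\<^bsub>M\<^esub>"
  proof (rule maps_ext[OF T M_maps(3)])
    fix x assume x: "x \<in> carrier A"
    have "hn (T x) \<le> 0" using op_bound[OF T x] z by simp
    then have "hn (T x) = 0" using T x by (intro order.antisym hn_nonneg) auto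
    then show "T x = \<zero>\<^bsub>M\<^esub> x" using hn_eq_0[of "T x"] T x by (simp add: M_apply)
  qed
next
  assume "T = \<zero>\<^bsub>M\<^esub>"
  then have "nrm M T \<le> 0" using hn_eq_0[of "\<zero>"] by (intro op_least) (auto simp: M_apply)
  then show "nrm M T = 0" using op_nonneg[OF T] by simp
qed

lemma op_triangle:
  assumes "S \<in> maps" "T \<in> maps"
  shows "nrm M (S \<oplus>\<^bsub>M\<^esub> T) \<le> nrm M S + nrm M T"
proof (rule op_least)
  fix x assume x: "x \<in> carrier A"
  show "hn ((S \<oplus>\<^bsub>M\<^esub> T) x) \<le> (nrm M S + nrm M T) * hn x"
    using hn_triangle[of "S x" "T x"] op_bound[OF assms(1) x] op_bound[OF assms(2) x] assms x
    by (simp add: M_apply algebra_simps)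
qed (use assms op_nonneg in auto)

lemma op_smult_le:
  assumes T: "T \<in> maps" shows "nrm M (c \<odot>\<^bsub>M\<^esub> T) \<le> cmod c * nrm M T"
proof (rule op_least)
  fix x assume x: "x \<in> carrier A"
  show "hn ((c \<odot>\<^bsub>M\<^esub> T) x) \<le> (cmod c * nrm M T) * hn x"
    using op_bound[OF T x] T x by (simp add: M_apply hn_smult mult.assoc mult_left_mono)
qed (use T op_nonneg in auto)

lemma op_smult:
  assumes T: "T \<in> maps" shows "nrm M (c \<odot>\<^bsub>M\<^esub> T) = cmod c * nrm M T"
proof (cases "c = 0")
  case True
  have "0 \<odot>\<^bsub>M\<^esub> T = \<zero>\<^bsub>M\<^esub>" using T M_maps by (intro maps_ext) (auto simp: M_apply)
  then show ?thesis using True op_eq_0[OF M_maps(3)] by simp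
next
  case False
  have "inverse c \<odot>\<^bsub>M\<^esub> (c \<odot>\<^bsub>M\<^esub> T) = T" using T M_maps False by (intro maps_ext) (auto simp: M_apply)
  then have "nrm M T \<le> inverse (cmod c) * nrm M (c \<odot>\<^bsub>M\<^esub> T)"
    using op_smult_le[of "c \<odot>\<^bsub>M\<^esub> T" "inverse c"] T M_maps by (simp add: norm_inverse)
  then have "cmod c * nrm M T \<le> nrm M (c \<odot>\<^bsub>M\<^esub> T)" using False by (simp add: field_simps)
  then show ?thesis using op_smult_le[OF T, of c] by simp
qed

lemma op_mult:
  assumes "S \<in> maps" "T \<in> maps"
  shows "nrm M (S \<otimes>\<^bsub>M\<^esub> T) \<le> nrm M S * nrm M T"
proof (rule op_least)
  fix x assume x: "x \<in> carrier A"
  have "hn (S (T x)) \<le> nrm M S * hn (T x)" using assms x by (intro op_bound) auto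
  also have "\<dots> \<le> nrm M S * (nrm M T * hn x)" using assms x by (intro mult_left_mono op_bound op_nonneg)
  finally show "hn ((S \<otimes>\<^bsub>M\<^esub> T) x) \<le> (nrm M S * nrm M T) * hn x" using x by (simp add: M_apply mult.assoc)
qed (use assms op_nonneg in auto)

lemma adj_adj: "T \<in> maps \<Longrightarrow> adj (adj T) = T"
  using adj_unique[of "adj T" T] adj_inner'[of T] adj_maps[of T] by (auto simp: maps_def)

text \<open>
  The usual estimate \<open>\<parallel>T x\<parallel>\<^sup>2 = \<parallel>\<langle>x, T\<^sup>* T x\<rangle>\<parallel> \<le> \<parallel>T\<^sup>* T\<parallel> \<parallel>x\<parallel>\<^sup>2\<close>.
\<close>

lemma op_cstar_le:
  assumes T: "T \<in> maps" shows "(nrm M T)\<^sup>2 \<le> nrm M (adj T \<otimes>\<^bsub>M\<^esub> T)"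
proof -
  let ?N = "nrm M (adj T \<otimes>\<^bsub>M\<^esub> T)"
  have m: "adj T \<otimes>\<^bsub>M\<^esub> T \<in> maps" using T by (simp add: M_maps adj_maps)
  have N: "?N \<ge> 0" using m by (rule op_nonneg)
  have "nrm M T \<le> sqrt ?N"
  proof (rule op_least)
    fix x assume x: "x \<in> carrier A"
    have "(hn (T x))\<^sup>2 = nrm A (E (star A x \<otimes> (adj T \<otimes>\<^bsub>M\<^esub> T) x))"
      using T x adj_inner[OF T x, of "T x"] by (simp add: hn_square M_apply)
    also have "\<dots> \<le> hn x * hn ((adj T \<otimes>\<^bsub>M\<^esub> T) x)" using x m by (intro inner_bound) auto
    also have "\<dots> \<le> hn x * (?N * hn x)" using x m by (intro mult_left_mono op_bound) auto
    also have "\<dots> = (sqrt ?N * hn x)\<^sup>2" using N by (simp add: power_mult_distrib power2_eq_square)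
    finally show "hn (T x) \<le> sqrt ?N * hn x" by (rule power2_le_imp_le) (simp add: N x)
  qed (simp add: N)
  then have "(nrm M T)\<^sup>2 \<le> (sqrt ?N)\<^sup>2" using op_nonneg[OF T] by (intro power_mono) auto
  then show ?thesis using N by simp
qed

lemma op_adj: assumes T: "T \<in> maps" shows "nrm M (adj T) = nrm M T"
proof -
  have le: "nrm M T \<le> nrm M (adj T)" if T: "T \<in> maps" for T
  proof (cases "nrm M T = 0")
    case False
    have "nrm M T * nrm M T \<le> nrm M (adj T) * nrm M T"
      using op_cstar_le[OF T] op_mult[OF adj_maps[OF T] T] by (simp add: power2_eq_square)
    then show ?thesis using False op_nonneg[OF T] by simp
  qed (simp add: op_nonneg adj_maps T)
  show ?thesis using le[OF T] le[OF adj_maps[OF T]] T by (simp add: adj_adj)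
qed

lemma M_metric: "Metric_space (carrier M) (cstar_dist M)"
proof
  fix S T R
  note s = cstar_dist_def M_carrier
  have swap: "S \<ominus>\<^bsub>M\<^esub> T = (-1) \<odot>\<^bsub>M\<^esub> (T \<ominus>\<^bsub>M\<^esub> S)" if "S \<in> maps" "T \<in> maps" for S T
    using that by (intro maps_ext) (auto simp: M_maps minus_maps M_apply M_minus smult_minus_left minus_swap)
  show "0 \<le> cstar_dist M S T" by (simp add: s op_nonneg minus_maps)
  show "cstar_dist M S T = cstar_dist M T S"
  proof (cases "S \<in> maps \<and> T \<in> maps")
    case True
    then have "nrm M (S \<ominus>\<^bsub>M\<^esub> T) = cmod (-1) * nrm M (T \<ominus>\<^bsub>M\<^esub> S)"
      by (subst swap) (auto simp: op_smult minus_maps)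
    then show ?thesis using True by (simp add: s)
  qed (auto simp: s)
  show "cstar_dist M S T = 0 \<longleftrightarrow> S = T" if "S \<in> carrier M" "T \<in> carrier M"
  proof -
    have ST: "S \<in> maps" "T \<in> maps" using that by (auto simp: M_carrier)
    have "S \<ominus>\<^bsub>M\<^esub> T = \<zero>\<^bsub>M\<^esub> \<longleftrightarrow> S = T"
    proof
      assume z: "S \<ominus>\<^bsub>M\<^esub> T = \<zero>\<^bsub>M\<^esub>"
      have "S x = T x" if x: "x \<in> carrier A" for x
      proof -
        have "S x \<ominus> T x = \<zero>" using M_minus[OF ST x] x by (simp add: z M_apply)
        then show ?thesis using x ST by (simp add: minus_eq_zero_iff)
      qed
      then show "S = T" by (rule maps_ext[OF ST])
    qed (use ST in \<open>auto intro!: maps_ext simp: minus_maps M_maps M_minus M_apply minus_self\<close>)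
    then show ?thesis using ST by (simp add: s op_eq_0 minus_maps)
  qed
  show "cstar_dist M S R \<le> cstar_dist M S T + cstar_dist M T R"
    if "S \<in> carrier M" "T \<in> carrier M" "R \<in> carrier M"
  proof -
    have m: "S \<in> maps" "T \<in> maps" "R \<in> maps" using that by (auto simp: M_carrier)
    have "S \<ominus>\<^bsub>M\<^esub> R = (S \<ominus>\<^bsub>M\<^esub> T) \<oplus>\<^bsub>M\<^esub> (T \<ominus>\<^bsub>M\<^esub> R)"
      using m by (intro maps_ext) (auto simp: minus_maps M_maps M_minus M_apply intro: minus_trans)
    then show ?thesis using m op_triangle[of "S \<ominus>\<^bsub>M\<^esub> T" "T \<ominus>\<^bsub>M\<^esub> R"] by (simp add: s minus_maps)
  qed
qed

text \<open>
  A Cauchy sequence of maps converges on each of the finitely many \<open>l\<close>, and the map synthesised from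
  these limits is the limit in operator norm.
\<close>

lemma M_complete: "Metric_space.mcomplete (carrier M) (cstar_dist M)"
  unfolding Metric_space.mcomplete_def[OF M_metric]
proof (intro allI impI)
  fix T assume C: "Metric_space.MCauchy (carrier M) (cstar_dist M) T"
  then have T [simp]: "T n \<in> maps" for n
    unfolding Metric_space.MCauchy_def[OF M_metric] by (auto simp: M_carrier)
  have C: "\<exists>N. \<forall>m\<ge>N. \<forall>n\<ge>N. nrm M (T m \<ominus>\<^bsub>M\<^esub> T n) < \<epsilon>" if "\<epsilon> > 0" for \<epsilon>
    using C that unfolding Metric_space.MCauchy_def[OF M_metric] by (simp add: cstar_dist_def M_carrier)
  obtain K where K: "K \<ge> 0" "\<And>x. x \<in> carrier A \<Longrightarrow> nrm A x \<le> K * hn x" using nrm_le_hn by blast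
  have "\<exists>x. tends (\<lambda>n. T n l) x" if l: "l \<in> L" for l
  proof -
    have "\<exists>N. \<forall>m\<ge>N. \<forall>n\<ge>N. nrm A (T m l \<ominus> T n l) < \<epsilon>" if e: "\<epsilon> > 0" for \<epsilon>
    proof -
      \<comment> \<open>The summand 1 keeps the denominator positive when \<open>hn l = 0\<close>.\<close>
      let ?D = "K * hn l + 1"
      have D: "?D > 0" using K l by (simp add: add_nonneg_pos)
      obtain N where N: "\<forall>m\<ge>N. \<forall>n\<ge>N. nrm M (T m \<ominus>\<^bsub>M\<^esub> T n) < \<epsilon> / ?D" using C[of "\<epsilon> / ?D"] D e by auto
      have "nrm A (T m l \<ominus> T n l) < \<epsilon>" if "m \<ge> N" "n \<ge> N" for m n
      proof -
        let ?d = "nrm M (T m \<ominus>\<^bsub>M\<^esub> T n)"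
        have d: "0 \<le> ?d" "?d < \<epsilon> / ?D" using N that by (auto simp: op_nonneg minus_maps)
        have "nrm A (T m l \<ominus> T n l) \<le> K * hn ((T m \<ominus>\<^bsub>M\<^esub> T n) l)"
          using K(2)[of "T m l \<ominus> T n l"] l by (simp add: M_minus)
        also have "\<dots> \<le> K * (?d * hn l)" using K l by (intro mult_left_mono op_bound) (auto simp: minus_maps)
        also have "\<dots> \<le> ?d * ?D" using d by (simp add: algebra_simps)
        also have "\<dots> < \<epsilon>" using d D by (simp add: pos_less_divide_eq)
        finally show ?thesis .
      qed
      then show ?thesis by blast
    qed
    then show ?thesis using cauchy_tends[of "\<lambda>n. T n l"] l by (metis L_carrier T maps_closed)
  qed
  then obtain t where t: "\<And>l. l \<in> L \<Longrightarrow> tends (\<lambda>n. T n l) (t l)" by metis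
  have tc: "t \<in> L \<rightarrow> carrier A" using t tendsD(2) by blast
  let ?S = "synth t"
  have S: "?S \<in> maps" by (rule synth_maps[OF tc])
  have bd: "nrm M (T n \<ominus>\<^bsub>M\<^esub> ?S) \<le> (\<Sum>l\<in>L. nrm A (T n l \<ominus> t l) * hn l)" for n
  proof (rule op_least)
    fix x assume x: "x \<in> carrier A"
    have tl: "t l \<in> carrier A" if "l \<in> L" for l using tc that by auto
    have "(T n \<ominus>\<^bsub>M\<^esub> ?S) x = synth (T n) x \<ominus> synth t x" using x S by (simp add: M_minus synth_self)
    also have "\<dots> = synth (\<lambda>l. T n l \<ominus> t l) x"
    proof -
      have "synth (T n) x = synth (\<lambda>l. T n l \<ominus> t l) x \<oplus> synth t x"
        unfolding synth_def restrict_apply'[OF x]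
        by (rule trans[OF finsum_cong'[OF refl] finsum_addf])
           (use x tl in \<open>auto simp: minus_distrib_left minus_add_cancel\<close>)
      moreover have "synth (\<lambda>l. T n l \<ominus> t l) x \<in> carrier A" "synth t x \<in> carrier A"
        using x tl by (auto intro!: maps_closed[OF synth_maps])
      ultimately show ?thesis by (simp add: minus_eq a_assoc r_neg)
    qed
    finally show "hn ((T n \<ominus>\<^bsub>M\<^esub> ?S) x) \<le> (\<Sum>l\<in>L. nrm A (T n l \<ominus> t l) * hn l) * hn x"
      using x tl by (simp, intro hn_synth) auto
  qed (use tc in \<open>auto intro!: sum_nonneg mult_nonneg_nonneg nrm_nonneg\<close>)
  have lim: "(\<lambda>n. \<Sum>l\<in>L. nrm A (T n l \<ominus> t l) * hn l) \<longlonglongrightarrow> (\<Sum>l\<in>L. 0 * hn l)"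
    by (intro tendsto_sum tendsto_mult tendsto_const tendsD(3)[OF t])
  have "(\<lambda>n. nrm M (T n \<ominus>\<^bsub>M\<^esub> ?S)) \<longlonglongrightarrow> 0"
    by (rule real_tendsto_sandwich[OF _ _ tendsto_const lim[simplified]])
       (use bd S in \<open>auto intro!: always_eventually op_nonneg minus_maps\<close>)
  then have "limitin (Metric_space.mtopology (carrier M) (cstar_dist M)) T ?S sequentially"
    unfolding Metric_space.limitin_metric_dist_null[OF M_metric] using S by (simp add: M_carrier cstar_dist_def)
  then show "\<exists>S. limitin (Metric_space.mtopology (carrier M) (cstar_dist M)) T S sequentially" by blast
qed

lemma M_module: "Module.module complex_ring M"
proof (rule moduleI[OF complex_ring_cring])
  show "abelian_group M" using M_ring by (rule ring.is_abelian_group)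
qed (auto simp: M_carrier M_maps M_apply complex_ring_def smult_add_left smult_add_right intro!: maps_ext)

theorem M_cstar_algebra: "cstar_algebra M"
proof (intro cstar_algebra.intro cstar_algebra_axioms.intro)
  fix S T c
  assume "S \<in> carrier M"
  then have S [simp]: "S \<in> maps" by (simp add: M_carrier)
  show "star M S \<in> carrier M" by (simp add: M_star M_carrier adj_maps)
  show "star M (star M S) = S" by (simp add: M_star adj_maps adj_adj)
  show "star M (c \<odot>\<^bsub>M\<^esub> S) = cnj c \<odot>\<^bsub>M\<^esub> star M S"
    unfolding M_star[OF S] M_star[OF M_maps(5)[OF S]]
    by (rule adj_eqI) (simp_all add: M_maps adj_maps M_apply star_smult smult_mult_left smult_mult_right E_smult adj_inner)
  show "0 \<le> nrm M S" by (simp add: op_nonneg)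
  show "nrm M S = 0 \<longleftrightarrow> S = \<zero>\<^bsub>M\<^esub>" by (simp add: op_eq_0)
  show "nrm M (c \<odot>\<^bsub>M\<^esub> S) = cmod c * nrm M S" by (simp add: op_smult)
  show "nrm M (star M S \<otimes>\<^bsub>M\<^esub> S) = (nrm M S)\<^sup>2"
    using op_cstar_le[OF S] op_mult[OF adj_maps[OF S] S] by (simp add: M_star op_adj power2_eq_square)
  assume "T \<in> carrier M"
  then have T [simp]: "T \<in> maps" by (simp add: M_carrier)
  show "(c \<odot>\<^bsub>M\<^esub> S) \<otimes>\<^bsub>M\<^esub> T = c \<odot>\<^bsub>M\<^esub> (S \<otimes>\<^bsub>M\<^esub> T)" "S \<otimes>\<^bsub>M\<^esub> (c \<odot>\<^bsub>M\<^esub> T) = c \<odot>\<^bsub>M\<^esub> (S \<otimes>\<^bsub>M\<^esub> T)"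
    by (auto intro!: maps_ext simp: M_maps M_apply maps_smult)
  show "star M (S \<oplus>\<^bsub>M\<^esub> T) = star M S \<oplus>\<^bsub>M\<^esub> star M T"
    unfolding M_star[OF S] M_star[OF T] M_star[OF M_maps(4)[OF S T]]
    by (rule adj_eqI) (simp_all add: M_maps adj_maps M_apply star_add l_distr r_distr E_add adj_inner)
  show "star M (S \<otimes>\<^bsub>M\<^esub> T) = star M T \<otimes>\<^bsub>M\<^esub> star M S"
    unfolding M_star[OF S] M_star[OF T] M_star[OF M_maps(1)[OF S T]]
    by (rule adj_eqI) (simp_all add: M_maps adj_maps M_apply adj_inner)
  show "nrm M (S \<oplus>\<^bsub>M\<^esub> T) \<le> nrm M S + nrm M T" by (simp add: op_triangle)
  show "nrm M (S \<otimes>\<^bsub>M\<^esub> T) \<le> nrm M S * nrm M T" by (simp add: op_mult)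
qed (rule M_ring M_module M_complete)+

end

section \<open>The dual inclusion\<close>

context cond_exp
begin

text \<open>The second expansion is the adjoint of the first.\<close>

lemma quasi_basisI:
  assumes "finite K" "K \<subseteq> carrier A"
    and K: "\<And>x. x \<in> carrier A \<Longrightarrow> (\<Oplus>l\<in>K. l \<otimes> E (star A l \<otimes> x)) = x"
  shows "quasi_basis A E K"
  unfolding quasi_basis_def
proof (intro conjI ballI)
  have c [simp]: "l \<in> carrier A" if "l \<in> K" for l using assms(2) that by auto
  fix x assume x: "x \<in> carrier A"
  show "x = (\<Oplus>l\<in>K. l \<otimes> E (star A l \<otimes> x))" by (rule K[OF x, symmetric])
  have "x = star A (\<Oplus>l\<in>K. l \<otimes> E (star A l \<otimes> star A x))" using K[of "star A x"] x by simp
  also have "\<dots> = (\<Oplus>l\<in>K. star A (l \<otimes> E (star A l \<otimes> star A x)))" using x by (intro star_finsum) auto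
  also have "\<dots> = (\<Oplus>l\<in>K. E (x \<otimes> l) \<otimes> star A l)"
    using x by (intro finsum_cong') (auto simp: star_mult E_star[symmetric])
  finally show "x = (\<Oplus>l\<in>K. E (x \<otimes> l) \<otimes> star A l)" .
qed (use assms in auto)

end

context inclusion
begin

declare M_carrier [simp] M_maps [simp] adj_maps [simp] minus_maps [simp]

sublocale M: cstar_algebra M
  by (rule M_cstar_algebra)

abbreviation M_mult (infixl "\<cdot>" 70) where "S \<cdot> T \<equiv> S \<otimes>\<^bsub>M\<^esub> T"

abbreviation emb :: "'a \<Rightarrow> 'a \<Rightarrow> 'a" where "emb \<equiv> left_mult A"

lemma emb_apply: "x \<in> carrier A \<Longrightarrow> emb a x = a \<otimes> x"
  by (simp add: left_mult_def)

lemma emb_maps [simp]: "a \<in> carrier A \<Longrightarrow> emb a \<in> maps"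
  unfolding left_mult_def by (rule mapsI) (auto simp: r_distr m_assoc)

lemma emb_inj: "\<lbrakk>emb a = emb b; a \<in> carrier A; b \<in> carrier A\<rbrakk> \<Longrightarrow> a = b"
  by (drule fun_cong[of _ _ "\<one>"]) (simp add: emb_apply)

lemma emb_inj_on: "inj_on emb (carrier A)"
  by (rule inj_onI) (rule emb_inj)

lemma emb_add: "\<lbrakk>a \<in> carrier A; b \<in> carrier A\<rbrakk> \<Longrightarrow> emb (a \<oplus> b) = emb a \<oplus>\<^bsub>M\<^esub> emb b"
  by (rule maps_ext) (auto simp: M_apply emb_apply l_distr)

lemma emb_mult: "\<lbrakk>a \<in> carrier A; b \<in> carrier A\<rbrakk> \<Longrightarrow> emb (a \<otimes> b) = emb a \<cdot> emb b"
  by (rule maps_ext) (auto simp: M_apply emb_apply m_assoc)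

lemma emb_smult: "a \<in> carrier A \<Longrightarrow> emb (c \<odot> a) = c \<odot>\<^bsub>M\<^esub> emb a"
  by (rule maps_ext) (auto simp: M_apply emb_apply smult_mult_left)

lemma emb_one: "emb \<one> = \<one>\<^bsub>M\<^esub>"
  by (rule maps_ext) (auto simp: M_apply emb_apply)

lemma emb_zero: "emb \<zero> = \<zero>\<^bsub>M\<^esub>"
  by (rule maps_ext) (auto simp: M_apply emb_apply)

lemma emb_minus: "a \<in> carrier A \<Longrightarrow> emb (\<ominus> a) = \<ominus>\<^bsub>M\<^esub> emb a"
  using emb_smult[of a "-1"] by (simp add: minus_eq_smult M.minus_eq_smult)

lemma emb_star: "a \<in> carrier A \<Longrightarrow> star M (emb a) = emb (star A a)"
  unfolding M_star[OF emb_maps] by (rule adj_eqI) (auto simp: emb_apply star_mult m_assoc)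

lemma emb_finsum:
  assumes "g \<in> I \<rightarrow> carrier A" shows "emb (\<Oplus>i\<in>I. g i) = (\<Oplus>\<^bsub>M\<^esub>i\<in>I. emb (g i))"
  by (rule additive_finsum[OF abelian_group M.abelian_group _ _ assms]) (auto simp: emb_add)

lemma emb_pos: "pos a \<Longrightarrow> M.pos (emb a)"
proof -
  assume "pos a"
  then obtain b where b: "b \<in> carrier A" "star A b = b" "b \<otimes> b = a" using pos_sqrt by metis
  then have "emb a = star M (emb b) \<cdot> emb b" by (metis emb_mult emb_star)
  then show ?thesis using M.pos_star_mult[of "emb b"] b by simp
qed

text \<open>
  Maps in \<open>maps\<close> are continuous for the norm of \<open>A\<close> as well, by equivalence of the two norms.
\<close>

lemma maps_tends:
  assumes T: "T \<in> maps" and s: "tends s x" shows "tends (\<lambda>n. T (s n)) (T x)"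
proof -
  obtain K where K: "K \<ge> 0" "\<And>x. x \<in> carrier A \<Longrightarrow> nrm A x \<le> K * hn x" using nrm_le_hn by blast
  show ?thesis
  proof (rule tends_linear[OF s])
    fix x assume x: "x \<in> carrier A"
    have "nrm A (T x) \<le> K * hn (T x)" using T x by (intro K(2)) auto
    also have "\<dots> \<le> K * (nrm M T * hn x)" using T x K(1) by (intro mult_left_mono op_bound)
    also have "\<dots> \<le> K * (nrm M T * nrm A x)"
      using T x K(1) by (intro mult_left_mono hn_le_nrm op_nonneg)
    finally show "nrm A (T x) \<le> (K * nrm M T) * nrm A x" by (simp add: mult.assoc)
  qed (use T in \<open>auto simp: maps_diff\<close>)
qed

text \<open>
  The Jones projection \<open>e\<^sub>1\<close>; it is \<^const>\<open>jones_projection\<close> once \<open>min_expectation A B = E\<close> is used.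
\<close>

definition e1 :: "'a \<Rightarrow> 'a" where "e1 = (\<lambda>x\<in>carrier A. E x)"

lemma e1_apply [simp]: "x \<in> carrier A \<Longrightarrow> e1 x = E x"
  by (simp add: e1_def)

lemma e1_maps [simp]: "e1 \<in> maps"
  unfolding e1_def by (rule mapsI) (auto simp: E_add E_right)

lemma e1_star: "star M e1 = e1"
  unfolding M_star[OF e1_maps] by (rule adj_eqI) (auto simp: E_star[symmetric] E_left E_right)

lemma e1_idem: "e1 \<cdot> e1 = e1"
  by (rule maps_ext) (auto simp: M_apply)

lemma e1_emb_e1: "a \<in> carrier A \<Longrightarrow> e1 \<cdot> emb a \<cdot> e1 = emb (E a) \<cdot> e1"
  by (rule maps_ext) (auto simp: M_apply emb_apply E_right)

lemma e1_emb_B: "b \<in> B \<Longrightarrow> e1 \<cdot> emb b = emb b \<cdot> e1"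
  by (rule maps_ext) (auto simp: M_apply emb_apply E_left)

lemma maps_emb_e1: "\<lbrakk>T \<in> maps; a \<in> carrier A\<rbrakk> \<Longrightarrow> T \<cdot> emb a \<cdot> e1 = emb (T a) \<cdot> e1"
  by (rule maps_ext) (auto simp: M_apply emb_apply maps_right)

lemma maps_e1: "T \<in> maps \<Longrightarrow> T \<cdot> e1 = emb (T \<one>) \<cdot> e1"
  using maps_emb_e1[of T "\<one>"] by (simp add: emb_one)

lemma M_finsum_maps [simp]: "(\<And>i. i \<in> I \<Longrightarrow> g i \<in> maps) \<Longrightarrow> (\<Oplus>\<^bsub>M\<^esub>i\<in>I. g i) \<in> maps"
  using M.finsum_closed[of g I] by auto

lemma M_finsum_apply:
  assumes g: "\<And>i. i \<in> I \<Longrightarrow> g i \<in> maps" and x: "x \<in> carrier A"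
  shows "(\<Oplus>\<^bsub>M\<^esub>i\<in>I. g i) x = (\<Oplus>i\<in>I. g i x)"
  using additive_finsum[OF M.abelian_group abelian_group, of "\<lambda>T. T x" g I] g x by (auto simp: M_apply)

lemma M_expand: "T \<in> maps \<Longrightarrow> (\<Oplus>\<^bsub>M\<^esub>l\<in>L. emb (T l) \<cdot> e1 \<cdot> emb (star A l)) = T"
proof (rule maps_ext)
  fix x assume T: "T \<in> maps" and x: "x \<in> carrier A"
  have "(\<Oplus>\<^bsub>M\<^esub>l\<in>L. emb (T l) \<cdot> e1 \<cdot> emb (star A l)) x
      = (\<Oplus>l\<in>L. (emb (T l) \<cdot> e1 \<cdot> emb (star A l)) x)"
    using T x by (intro M_finsum_apply) auto
  also have "\<dots> = (\<Oplus>l\<in>L. T l \<otimes> E (star A l \<otimes> x))"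
    using T x by (intro finsum_cong') (auto simp: M_apply emb_apply)
  finally show "(\<Oplus>\<^bsub>M\<^esub>l\<in>L. emb (T l) \<cdot> e1 \<cdot> emb (star A l)) x = T x"
    using maps_expand[OF T x] by simp
qed auto

lemma M_expand_left:
  "T \<in> maps \<Longrightarrow> (\<Oplus>\<^bsub>M\<^esub>l\<in>L. emb l \<cdot> e1 \<cdot> emb (star A (adj T l))) = T"
proof (rule maps_ext)
  fix x assume T: "T \<in> maps" and x: "x \<in> carrier A"
  have "(\<Oplus>\<^bsub>M\<^esub>l\<in>L. emb l \<cdot> e1 \<cdot> emb (star A (adj T l))) x
      = (\<Oplus>l\<in>L. (emb l \<cdot> e1 \<cdot> emb (star A (adj T l))) x)"
    using T x by (intro M_finsum_apply) auto
  also have "\<dots> = (\<Oplus>l\<in>L. l \<otimes> E (star A l \<otimes> T x))"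
    using T x by (intro finsum_cong') (auto simp: M_apply emb_apply adj_inner')
  finally show "(\<Oplus>\<^bsub>M\<^esub>l\<in>L. emb l \<cdot> e1 \<cdot> emb (star A (adj T l))) x = T x"
    using T x by (simp add: expand)
qed auto

text \<open>
  The C*-algebra generated by \<open>A\<close> and \<open>e\<^sub>1\<close> already contains all maps, by \<open>M_expand\<close>.
\<close>

lemma basic_construction: "basic_construction A B = M"
proof -
  let ?S = "left_mult A ` carrier A \<union> {jones_projection A B}"
  have j: "jones_projection A B = e1" by (simp add: jones_projection_def min_expectation e1_def)
  have whole: "cstar_subalgebra (carrier M) M"
    unfolding cstar_subalgebra_def M.norm_closed_iff
    using M.carrier_is_subring M.tendsD(2) M.star_closed by (auto simp: M_star)
  have "carrier M \<subseteq> C" if C: "cstar_subalgebra C M" "?S \<subseteq> C" for C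
  proof
    fix T assume "T \<in> carrier M"
    then have T: "T \<in> maps" by simp
    have "emb a \<in> C" if "a \<in> carrier A" for a using that C by auto
    moreover have "e1 \<in> C" using C j by auto
    ultimately have "(\<Oplus>\<^bsub>M\<^esub>l\<in>L. emb (T l) \<cdot> e1 \<cdot> emb (star A l)) \<in> C"
      using T by (intro finsum_subalgebra[OF M_cstar_algebra C(1)] cstar_subalgebraD(6)[OF C(1)]) auto
    then show "T \<in> C" using M_expand[OF T] by simp
  qed
  moreover have "?S \<subseteq> carrier M" using j by auto
  ultimately have "cstar_generated M ?S = carrier M"
    unfolding cstar_generated_def using whole by blast
  then show ?thesis unfolding basic_construction_def min_expectation Let_def by simp
qed

text \<open>
  Dictated by \<open>E\<^sub>1(a e\<^sub>1 b) = \<tau> a b\<close> and the expansion \<open>T = \<Sum> T(l) e\<^sub>1 l\<^sup>*\<close>. The values are taken in \<open>A\<close>,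
  before embedding them in \<open>A\<^sub>1\<close>.
\<close>

definition ptrace :: "('a \<Rightarrow> 'a) \<Rightarrow> 'a" where
  "ptrace T = of_real (1 / index) \<odot> (\<Oplus>l\<in>L. T l \<otimes> star A l)"

lemma ptrace_closed [simp]: "T \<in> maps \<Longrightarrow> ptrace T \<in> carrier A"
  unfolding ptrace_def by (auto intro!: smult_closed finsum_closed)

lemma ptrace_add: "\<lbrakk>S \<in> maps; T \<in> maps\<rbrakk> \<Longrightarrow> ptrace (S \<oplus>\<^bsub>M\<^esub> T) = ptrace S \<oplus> ptrace T"
proof -
  assume *: "S \<in> maps" "T \<in> maps"
  have "(\<Oplus>l\<in>L. (S \<oplus>\<^bsub>M\<^esub> T) l \<otimes> star A l) = (\<Oplus>l\<in>L. S l \<otimes> star A l) \<oplus> (\<Oplus>l\<in>L. T l \<otimes> star A l)"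
    by (rule trans[OF finsum_cong'[OF refl] finsum_addf]) (use * in \<open>auto simp: M_apply l_distr\<close>)
  moreover have "(\<Oplus>l\<in>L. S l \<otimes> star A l) \<in> carrier A" "(\<Oplus>l\<in>L. T l \<otimes> star A l) \<in> carrier A"
    using * by (auto intro!: finsum_closed)
  ultimately show ?thesis by (simp add: ptrace_def smult_add_right)
qed

lemma ptrace_smult: "T \<in> maps \<Longrightarrow> ptrace (c \<odot>\<^bsub>M\<^esub> T) = c \<odot> ptrace T"
proof -
  assume T: "T \<in> maps"
  have "(\<Oplus>l\<in>L. (c \<odot>\<^bsub>M\<^esub> T) l \<otimes> star A l) = (\<Oplus>l\<in>L. c \<odot> (T l \<otimes> star A l))"
    using T by (intro finsum_cong') (auto simp: M_apply smult_mult_left)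
  also have "\<dots> = c \<odot> (\<Oplus>l\<in>L. T l \<otimes> star A l)" using T by (intro smult_finsum[symmetric]) auto
  finally show ?thesis using T by (simp add: ptrace_def finsum_closed Pi_def mult.commute)
qed

lemma ptrace_left: "\<lbrakk>a \<in> carrier A; T \<in> maps\<rbrakk> \<Longrightarrow> ptrace (emb a \<cdot> T) = a \<otimes> ptrace T"
proof -
  assume *: "a \<in> carrier A" "T \<in> maps"
  have "(\<Oplus>l\<in>L. (emb a \<cdot> T) l \<otimes> star A l) = (\<Oplus>l\<in>L. a \<otimes> (T l \<otimes> star A l))"
    using * by (intro finsum_cong') (auto simp: M_apply emb_apply m_assoc)
  also have "\<dots> = a \<otimes> (\<Oplus>l\<in>L. T l \<otimes> star A l)" using * by (intro mult_finsum_right[symmetric]) auto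
  finally show ?thesis using * by (simp add: ptrace_def finsum_closed Pi_def smult_mult_right)
qed

lemma ptrace_rank_one:
  assumes "a \<in> carrier A" "b \<in> carrier A"
  shows "ptrace (emb a \<cdot> e1 \<cdot> emb b) = of_real (1 / index) \<odot> (a \<otimes> b)"
proof -
  have "(\<Oplus>l\<in>L. (emb a \<cdot> e1 \<cdot> emb b) l \<otimes> star A l) = (\<Oplus>l\<in>L. a \<otimes> (E (b \<otimes> l) \<otimes> star A l))"
    using assms by (intro finsum_cong') (auto simp: M_apply emb_apply m_assoc)
  also have "\<dots> = a \<otimes> (\<Oplus>l\<in>L. E (b \<otimes> l) \<otimes> star A l)"
    using assms by (intro mult_finsum_right[symmetric]) auto
  finally show ?thesis using assms by (simp add: ptrace_def expand_right)
qed

lemma ptrace_finsum: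
  assumes "\<And>i. i \<in> I \<Longrightarrow> g i \<in> maps" shows "ptrace (\<Oplus>\<^bsub>M\<^esub>i\<in>I. g i) = (\<Oplus>i\<in>I. ptrace (g i))"
  by (rule additive_finsum[OF M.abelian_group abelian_group]) (use assms in \<open>auto simp: ptrace_add\<close>)

text \<open>
  For reducing identities that are linear in \<open>T\<close> to operators \<open>a e\<^sub>1 b\<close>.
\<close>

lemma maps_induct_rank_one [consumes 1, case_names sum]:
  assumes T: "T \<in> maps"
    and sum: "\<And>s t. \<lbrakk>s \<in> L \<rightarrow> carrier A; t \<in> L \<rightarrow> carrier A\<rbrakk>
      \<Longrightarrow> P (\<Oplus>\<^bsub>M\<^esub>l\<in>L. emb (s l) \<cdot> e1 \<cdot> emb (t l))"
  shows "P T"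
  using sum[of T "star A"] M_expand[OF T] T by auto

lemma ptrace_right: "\<lbrakk>a \<in> carrier A; T \<in> maps\<rbrakk> \<Longrightarrow> ptrace (T \<cdot> emb a) = ptrace T \<otimes> a"
proof -
  assume a: "a \<in> carrier A" and T: "T \<in> maps"
  from T a show ?thesis
  proof (induction T rule: maps_induct_rank_one)
    case (sum s t)
    have c [simp]: "s l \<in> carrier A" "t l \<in> carrier A" if "l \<in> L" for l using sum that by auto
    have "ptrace ((\<Oplus>\<^bsub>M\<^esub>l\<in>L. emb (s l) \<cdot> e1 \<cdot> emb (t l)) \<cdot> emb a)
        = ptrace (\<Oplus>\<^bsub>M\<^esub>l\<in>L. emb (s l) \<cdot> e1 \<cdot> emb (t l) \<cdot> emb a)"
      using a by (subst M.mult_finsum_left) auto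
    also have "\<dots> = (\<Oplus>l\<in>L. ptrace (emb (s l) \<cdot> e1 \<cdot> emb (t l) \<cdot> emb a))"
      using a by (intro ptrace_finsum) auto
    also have "\<dots> = (\<Oplus>l\<in>L. ptrace (emb (s l) \<cdot> e1 \<cdot> emb (t l)) \<otimes> a)"
    proof (rule finsum_cong'[OF refl])
      fix l assume l: "l \<in> L"
      have "emb (s l) \<cdot> e1 \<cdot> emb (t l) \<cdot> emb a = emb (s l) \<cdot> e1 \<cdot> emb (t l \<otimes> a)"
        using l a by (simp add: emb_mult M.m_assoc)
      then show "ptrace (emb (s l) \<cdot> e1 \<cdot> emb (t l) \<cdot> emb a)
          = ptrace (emb (s l) \<cdot> e1 \<cdot> emb (t l)) \<otimes> a"
        using l a by (simp add: ptrace_rank_one smult_mult_left m_assoc)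
    qed (use a in auto)
    also have "\<dots> = ptrace (\<Oplus>\<^bsub>M\<^esub>l\<in>L. emb (s l) \<cdot> e1 \<cdot> emb (t l)) \<otimes> a"
      using a by (subst ptrace_finsum) (auto intro!: mult_finsum_left[symmetric])
    finally show ?case .
  qed
qed

lemma ptrace_one: "ptrace \<one>\<^bsub>M\<^esub> = \<one>"
proof -
  have "(\<Oplus>l\<in>L. \<one>\<^bsub>M\<^esub> l \<otimes> star A l) = of_real index \<odot> \<one>"
    unfolding index(1)[symmetric] by (rule finsum_cong') (auto simp: M_apply)
  then show ?thesis using index(2) by (simp add: ptrace_def)
qed

lemma ptrace_emb: "a \<in> carrier A \<Longrightarrow> ptrace (emb a) = a"
  using ptrace_left[of a "\<one>\<^bsub>M\<^esub>"] by (simp add: ptrace_one)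

text \<open>
  Writing the right factor as \<open>\<Sum> l e\<^sub>1 T\<^sup>*(l)\<^sup>*\<close> turns \<open>T\<^sup>* T\<close> into \<open>\<Sum> T\<^sup>*(l) e\<^sub>1 T\<^sup>*(l)\<^sup>*\<close>. This is what makes the
  expectation onto \<open>A\<close> positive without any appeal to complete positivity.
\<close>

lemma ptrace_star_mult:
  assumes T: "T \<in> maps"
  shows "ptrace (adj T \<cdot> T) = of_real (1 / index) \<odot> (\<Oplus>l\<in>L. adj T l \<otimes> star A (adj T l))"
proof -
  have "adj T \<cdot> T = adj T \<cdot> (\<Oplus>\<^bsub>M\<^esub>l\<in>L. emb l \<cdot> e1 \<cdot> emb (star A (adj T l)))"
    using M_expand_left[OF T] by simp
  also have "\<dots> = (\<Oplus>\<^bsub>M\<^esub>l\<in>L. adj T \<cdot> (emb l \<cdot> e1 \<cdot> emb (star A (adj T l))))"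
    using T by (intro M.mult_finsum_right) auto
  also have "\<dots> = (\<Oplus>\<^bsub>M\<^esub>l\<in>L. emb (adj T l) \<cdot> e1 \<cdot> emb (star A (adj T l)))"
    using T by (intro M.finsum_cong') (auto simp: maps_emb_e1[symmetric] M.m_assoc)
  finally have "ptrace (adj T \<cdot> T)
      = (\<Oplus>l\<in>L. ptrace (emb (adj T l) \<cdot> e1 \<cdot> emb (star A (adj T l))))"
    using T by (simp add: ptrace_finsum)
  also have "\<dots> = (\<Oplus>l\<in>L. of_real (1 / index) \<odot> (adj T l \<otimes> star A (adj T l)))"
    using T by (intro finsum_cong') (auto simp: ptrace_rank_one)
  also have "\<dots> = of_real (1 / index) \<odot> (\<Oplus>l\<in>L. adj T l \<otimes> star A (adj T l))"
    using T by (intro smult_finsum[symmetric]) auto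
  finally show ?thesis .
qed

lemma ptrace_pos: "T \<in> maps \<Longrightarrow> pos (ptrace (adj T \<cdot> T))"
proof -
  assume T: "T \<in> maps"
  have "pos (adj T l \<otimes> star A (adj T l))" if "l \<in> L" for l
    using pos_star_mult[of "star A (adj T l)"] T that by simp
  then show ?thesis unfolding ptrace_star_mult[OF T] using index(2) by (intro pos_smult pos_finsum) auto
qed

definition dual :: "('a \<Rightarrow> 'a) \<Rightarrow> 'a \<Rightarrow> 'a" where
  "dual = (\<lambda>T\<in>carrier M. emb (ptrace T))"

lemma dual_apply [simp]: "T \<in> maps \<Longrightarrow> dual T = emb (ptrace T)"
  by (simp add: dual_def)

text \<open>
  The limit is recovered from its value at 1: if \<open>a\<^sub>n \<rightarrow> T\<close> as operators then \<open>a\<^sub>n \<rightarrow> T(1)\<close> in \<open>A\<close>.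
\<close>

lemma emb_closed: "norm_closed M (emb ` carrier A)"
  unfolding M.norm_closed_iff
proof (intro conjI allI impI)
  show "emb ` carrier A \<subseteq> carrier M" by auto
  fix s T assume *: "range s \<subseteq> emb ` carrier A \<and> M.tends s T"
  then have t: "M.tends s T" by simp
  have "\<forall>n. \<exists>a\<in>carrier A. s n = emb a" using * by blast
  then obtain a where a: "\<And>n. a n \<in> carrier A" "\<And>n. s n = emb (a n)" by metis
  have T [simp]: "T \<in> maps" using M.tendsD(2)[OF t] by simp
  obtain K where K: "K \<ge> 0" "\<And>x. x \<in> carrier A \<Longrightarrow> nrm A x \<le> K * hn x" using nrm_le_hn by blast
  have lim: "tends (\<lambda>n. a n \<otimes> x) (T x)" if x: "x \<in> carrier A" for x
  proof (rule tendsI)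
    show "nrm A (a n \<otimes> x \<ominus> T x) \<le> (K * hn x) * nrm M (s n \<ominus>\<^bsub>M\<^esub> T)" for n
    proof -
      have "a n \<otimes> x \<ominus> T x = (s n \<ominus>\<^bsub>M\<^esub> T) x" using a x by (simp add: M_minus emb_apply)
      then have "nrm A (a n \<otimes> x \<ominus> T x) \<le> K * hn ((s n \<ominus>\<^bsub>M\<^esub> T) x)" using K(2) a x by simp
      also have "\<dots> \<le> K * (nrm M (s n \<ominus>\<^bsub>M\<^esub> T) * hn x)"
        using K(1) a x by (intro mult_left_mono op_bound) auto
      finally show ?thesis by (simp add: mult_ac)
    qed
    show "(\<lambda>n. (K * hn x) * nrm M (s n \<ominus>\<^bsub>M\<^esub> T)) \<longlonglongrightarrow> 0"
      using tendsto_mult_left[OF M.tendsD(3)[OF t]] by simp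
  qed (use a x in auto)
  have one: "tends a (T \<one>)" using lim[of "\<one>"] a by simp
  have "T = emb (T \<one>)"
  proof (rule maps_ext)
    fix x assume x: "x \<in> carrier A"
    show "T x = emb (T \<one>) x"
      unfolding emb_apply[OF x] by (rule tends_unique[OF lim[OF x] tends_mult_right[OF one x]])
  qed simp_all
  then show "T \<in> emb ` carrier A" by (rule image_eqI) simp
qed

lemma emb_subalgebra: "cstar_subalgebra (emb ` carrier A) M"
  unfolding cstar_subalgebra_def
proof (intro conjI allI ballI)
  show "subring (emb ` carrier A) M"
  proof (rule M.subringI)
    show "\<one>\<^bsub>M\<^esub> \<in> emb ` carrier A" by (rule image_eqI[where x = "\<one>"]) (simp_all add: emb_one)
    show "\<ominus>\<^bsub>M\<^esub> h \<in> emb ` carrier A" if "h \<in> emb ` carrier A" for h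
      using that by (auto simp: emb_minus[symmetric])
    show "h \<cdot> k \<in> emb ` carrier A" if "h \<in> emb ` carrier A" "k \<in> emb ` carrier A" for h k
      using that by (auto simp: emb_mult[symmetric])
    show "h \<oplus>\<^bsub>M\<^esub> k \<in> emb ` carrier A" if "h \<in> emb ` carrier A" "k \<in> emb ` carrier A" for h k
      using that by (auto simp: emb_add[symmetric])
  qed auto
qed (auto simp: emb_smult[symmetric] emb_star emb_closed)

lemma dual_expectation: "conditional_expectation M (emb ` carrier A) dual"
proof (rule M.conditional_expectationI[OF emb_subalgebra])
  show "dual \<in> carrier M \<rightarrow>\<^sub>E emb ` carrier A" by (auto simp: dual_def)
  show "M.pos (dual (star M T \<cdot> T))" if "T \<in> carrier M" for T
    using that by (simp add: M_star emb_pos ptrace_pos)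
qed (auto simp: ptrace_add emb_add ptrace_smult emb_smult ptrace_emb ptrace_left ptrace_right emb_mult)

text \<open>
  The elements \<open>c l e\<^sub>1\<close> form a quasi-basis of \<open>A\<^sub>1\<close> over \<open>A\<close>, and later over the intermediate algebra, for
  suitable \<open>c\<close>.
\<close>

definition jones_basis :: "complex \<Rightarrow> ('a \<Rightarrow> 'a) set" where
  "jones_basis c = (\<lambda>l. c \<odot>\<^bsub>M\<^esub> (emb l \<cdot> e1)) ` L"

text \<open>
  Quasi-bases are sets rather than families, so sums over them need injectivity; \<open>l\<close> is the value of
  \<open>l e\<^sub>1\<close> at 1.
\<close>

lemma jones_basis_inj:
  assumes c: "c \<noteq> 0" shows "inj_on (\<lambda>l. c \<odot>\<^bsub>M\<^esub> (emb l \<cdot> e1)) L"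
proof (rule inj_onI)
  fix l m assume lm: "l \<in> L" "m \<in> L"
    and eq: "c \<odot>\<^bsub>M\<^esub> (emb l \<cdot> e1) = c \<odot>\<^bsub>M\<^esub> (emb m \<cdot> e1)"
  have "emb l \<cdot> e1 = emb m \<cdot> e1"
    by (rule M.smult_cancel[OF _ _ _ eq]) (use lm c in auto)
  then have "(emb l \<cdot> e1) \<one> = (emb m \<cdot> e1) \<one>" by simp
  then show "l = m" using lm by (simp add: M_apply emb_apply)
qed

lemma jones_basis_finite: "finite (jones_basis c)" "jones_basis c \<subseteq> carrier M"
  by (auto simp: jones_basis_def)

lemma jones_basis_finsum:
  assumes "c \<noteq> 0" "\<And>l. l \<in> L \<Longrightarrow> g (c \<odot>\<^bsub>M\<^esub> (emb l \<cdot> e1)) = h l" "\<And>l. l \<in> L \<Longrightarrow> h l \<in> maps"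
  shows "(\<Oplus>\<^bsub>M\<^esub>n\<in>jones_basis c. g n) = (\<Oplus>\<^bsub>M\<^esub>l\<in>L. h l)"
  unfolding jones_basis_def using assms
  by (subst M.finsum_reindex[OF _ jones_basis_inj]) (auto intro!: M.finsum_cong')

lemma jones_basis_star:
  "l \<in> L \<Longrightarrow> star M (of_real r \<odot>\<^bsub>M\<^esub> (emb l \<cdot> e1)) = of_real r \<odot>\<^bsub>M\<^esub> (e1 \<cdot> emb (star A l))"
  by (simp add: M.star_smult M.star_mult e1_star emb_star)

lemma e1_emb_maps:
  assumes "T \<in> maps" "l \<in> carrier A"
  shows "e1 \<cdot> emb (star A l) \<cdot> T = e1 \<cdot> emb (star A (adj T l))"
proof -
  have "e1 \<cdot> emb (star A l) \<cdot> T = star M (adj T \<cdot> emb l \<cdot> e1)"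
    using assms by (simp add: M.star_mult e1_star emb_star M_star[OF adj_maps[OF assms(1)]] adj_adj M.m_assoc)
  also have "\<dots> = e1 \<cdot> emb (star A (adj T l))"
    using assms by (simp add: maps_emb_e1 M.star_mult e1_star emb_star)
  finally show ?thesis .
qed

lemma jones_basis_index:
  "0 < r \<Longrightarrow> (\<Oplus>\<^bsub>M\<^esub>n\<in>jones_basis (complex_of_real (sqrt r)). n \<cdot> star M n) = of_real r \<odot>\<^bsub>M\<^esub> \<one>\<^bsub>M\<^esub>"
proof -
  assume r: "0 < r"
  let ?r = "complex_of_real (sqrt r)"
  have rr: "?r * ?r = complex_of_real r" using r by (simp flip: of_real_mult)
  have "(\<Oplus>\<^bsub>M\<^esub>n\<in>jones_basis ?r. n \<cdot> star M n)
      = (\<Oplus>\<^bsub>M\<^esub>l\<in>L. of_real r \<odot>\<^bsub>M\<^esub> (emb l \<cdot> e1 \<cdot> emb (star A l)))"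
  proof (rule jones_basis_finsum)
    fix l assume l: "l \<in> L"
    have "emb l \<cdot> e1 \<cdot> (e1 \<cdot> emb (star A l)) = emb l \<cdot> (e1 \<cdot> e1) \<cdot> emb (star A l)"
      using l by (simp add: M.m_assoc)
    then show "?r \<odot>\<^bsub>M\<^esub> (emb l \<cdot> e1) \<cdot> star M (?r \<odot>\<^bsub>M\<^esub> (emb l \<cdot> e1))
        = of_real r \<odot>\<^bsub>M\<^esub> (emb l \<cdot> e1 \<cdot> emb (star A l))"
      using l by (simp add: jones_basis_star M.smult_mult_left M.smult_mult_right rr e1_idem)
  qed (use r in auto)
  also have "\<dots> = of_real r \<odot>\<^bsub>M\<^esub> (\<Oplus>\<^bsub>M\<^esub>l\<in>L. emb (\<one>\<^bsub>M\<^esub> l) \<cdot> e1 \<cdot> emb (star A l))"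
    by (subst M.smult_finsum) (auto intro!: M.finsum_cong' simp: M_apply)
  also have "(\<Oplus>\<^bsub>M\<^esub>l\<in>L. emb (\<one>\<^bsub>M\<^esub> l) \<cdot> e1 \<cdot> emb (star A l)) = \<one>\<^bsub>M\<^esub>" by (rule M_expand) simp
  finally show ?thesis .
qed

definition L1 :: "('a \<Rightarrow> 'a) set" where
  "L1 = jones_basis (complex_of_real (sqrt index))"

lemma sqrt_index: "complex_of_real (sqrt index) * complex_of_real (sqrt index) = complex_of_real index"
  "complex_of_real (sqrt index) \<noteq> 0"
  using index(2) by (simp_all flip: of_real_mult)

lemma dual_quasi_basis: "quasi_basis M dual L1"
proof -
  interpret D: cond_exp M "emb ` carrier A" dual by unfold_locales (rule dual_expectation)
  show ?thesis
  proof (rule D.quasi_basisI)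
    show "finite L1" "L1 \<subseteq> carrier M" unfolding L1_def by (rule jones_basis_finite)+
    fix T assume "T \<in> carrier M"
    then have T: "T \<in> maps" by simp
    have "(\<Oplus>\<^bsub>M\<^esub>n\<in>L1. n \<cdot> dual (star M n \<cdot> T)) = (\<Oplus>\<^bsub>M\<^esub>l\<in>L. emb l \<cdot> e1 \<cdot> emb (star A (adj T l)))"
      unfolding L1_def
    proof (rule jones_basis_finsum[OF sqrt_index(2)])
      fix l assume l: "l \<in> L"
      let ?r = "complex_of_real (sqrt index)"
      let ?n = "?r \<odot>\<^bsub>M\<^esub> (emb l \<cdot> e1)"
      have "ptrace (e1 \<cdot> emb (star A l) \<cdot> T) = of_real (1 / index) \<odot> star A (adj T l)"
        using ptrace_rank_one[of "\<one>" "star A (adj T l)"] l T by (simp add: emb_one e1_emb_maps)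
      then have "dual (star M ?n \<cdot> T) = (?r * complex_of_real (1 / index)) \<odot>\<^bsub>M\<^esub> emb (star A (adj T l))"
        unfolding jones_basis_star[OF l] using l T by (simp add: M.smult_mult_left ptrace_smult emb_smult)
      then have "?n \<cdot> dual (star M ?n \<cdot> T)
          = (?r * ?r * complex_of_real (1 / index)) \<odot>\<^bsub>M\<^esub> (emb l \<cdot> e1 \<cdot> emb (star A (adj T l)))"
        using l T by (simp add: M.smult_mult_left M.smult_mult_right mult_ac del: dual_apply)
      then show "?n \<cdot> dual (star M ?n \<cdot> T) = emb l \<cdot> e1 \<cdot> emb (star A (adj T l))"
        unfolding sqrt_index using l T index(2) by (simp del: dual_apply)
    qed (use T in auto)
    then show "(\<Oplus>\<^bsub>M\<^esub>n\<in>L1. n \<cdot> dual (star M n \<cdot> T)) = T" using M_expand_left[OF T] by simp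
  qed
qed

text \<open>
  A map commuting with left multiplications is right multiplication by its value \<open>T(1)\<close>, and
  right \<open>B\<close>-linearity puts \<open>T(1)\<close> in \<open>B' \<inter> A\<close>.
\<close>

lemma dual_irreducible: "relative_commutant (emb ` carrier A) M = {c \<odot>\<^bsub>M\<^esub> \<one>\<^bsub>M\<^esub> | c. True}"
proof (intro equalityI subsetI)
  fix T assume "T \<in> relative_commutant (emb ` carrier A) M"
  then have T: "T \<in> maps" and comm: "\<And>a. a \<in> carrier A \<Longrightarrow> T \<cdot> emb a = emb a \<cdot> T"
    by (auto simp: relative_commutant_def)
  have Ta: "T a = a \<otimes> T \<one>" if a: "a \<in> carrier A" for a
  proof -
    have "(T \<cdot> emb a) \<one> = (emb a \<cdot> T) \<one>" using comm[OF a] by simp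
    then show ?thesis using a T by (simp add: M_apply emb_apply)
  qed
  have "T \<one> \<otimes> b = b \<otimes> T \<one>" if b: "b \<in> B" for b
    unfolding Ta[OF B_carrier[OF b], symmetric] using maps_right[OF T one_closed b] b by simp
  then obtain c where c: "T \<one> = c \<odot> \<one>" using commutant_scalar[of "T \<one>"] T by auto
  have "T = c \<odot>\<^bsub>M\<^esub> \<one>\<^bsub>M\<^esub>"
  proof (rule maps_ext)
    fix x assume x: "x \<in> carrier A"
    show "T x = (c \<odot>\<^bsub>M\<^esub> \<one>\<^bsub>M\<^esub>) x" unfolding Ta[OF x] c using x by (simp add: M_apply smult_mult_one)
  qed (use T in simp_all)
  then show "T \<in> {c \<odot>\<^bsub>M\<^esub> \<one>\<^bsub>M\<^esub> | c. True}" by blast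
qed (auto simp: relative_commutant_def M.smult_one_mult M.smult_mult_one)

lemma M_nontrivial: "\<one>\<^bsub>M\<^esub> \<noteq> \<zero>\<^bsub>M\<^esub>"
  using emb_inj[of "\<one>" "\<zero>"] nontrivial by (auto simp: emb_one emb_zero)

text \<open>
  The tower can be continued: all results on \<open>B \<subseteq> A\<close> apply to \<open>A \<subseteq> A\<^sub>1\<close>.
\<close>

theorem dual_inclusion: "inclusion M (emb ` carrier A) dual L1"
  by (intro inclusion.intro cond_exp.intro inclusion_axioms.intro cond_exp_axioms.intro M_cstar_algebra
      dual_expectation dual_quasi_basis dual_irreducible M_nontrivial)

lemma dual_index: "inclusion.index M L1 = index"
  unfolding L1_def by (rule inclusion.index_eqI[OF dual_inclusion[unfolded L1_def] jones_basis_index[OF index(2)]])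

lemma next_expectation: "T \<in> maps \<Longrightarrow> next_expectation A B T = ptrace T"
  unfolding next_expectation_def basic_construction inclusion.min_expectation[OF dual_inclusion]
  by (simp add: inv_into_f_f[OF emb_inj_on])

end

section \<open>The trace and the Fourier transform\<close>

context cstar_algebra
begin

lemma cstar_algebra_restrict:
  assumes C: "cstar_subalgebra C A" shows "cstar_algebra (A\<lparr>carrier := C\<rparr>)"
proof (intro cstar_algebra.intro cstar_algebra_axioms.intro)
  note Cs = cstar_subalgebraD[OF C]
  have Cc: "x \<in> carrier A" if "x \<in> C" for x using that Cs(2) by blast
  show ring: "ring (A\<lparr>carrier := C\<rparr>)" by (rule subring_is_ring[OF Cs(1)])
  have ag: "abelian_group (A\<lparr>carrier := C\<rparr>)" by (rule ring.is_abelian_group[OF ring])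
  show "Module.module complex_ring (A\<lparr>carrier := C\<rparr>)"
    by (rule moduleI[OF complex_ring_cring ag])
      (auto simp: complex_ring_def Cs Cc smult_add_left smult_add_right)
  have d: "cstar_dist (A\<lparr>carrier := C\<rparr>) x y = (if x \<in> C \<and> y \<in> C then cstar_dist A x y else 0)" for x y
    by (auto simp: cstar_dist_def restrict_minus[OF Cs(1)] Cc)
  have mC: "Metric_space C (cstar_dist (A\<lparr>carrier := C\<rparr>))"
    unfolding Metric_space_def d using metric Cc unfolding Metric_space_def by auto
  have "Metric_space.mcomplete C (cstar_dist (A\<lparr>carrier := C\<rparr>))"
    unfolding Metric_space.mcomplete_def[OF mC]
  proof (intro allI impI)
    fix s assume Cau: "Metric_space.MCauchy C (cstar_dist (A\<lparr>carrier := C\<rparr>)) s"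
    then have s: "s n \<in> C" for n unfolding Metric_space.MCauchy_def[OF mC] by auto
    have "\<exists>N. \<forall>m\<ge>N. \<forall>n\<ge>N. nrm A (s m \<ominus> s n) < \<epsilon>" if "0 < \<epsilon>" for \<epsilon>
      using Cau s Cc that unfolding Metric_space.MCauchy_def[OF mC] by (simp add: d cstar_dist_def restrict_minus[OF Cs(1)])
    then obtain x where x: "tends s x" using cauchy_tends[of s] s Cc by blast
    have xC: "x \<in> C" by (rule norm_closed_tends[OF Cs(11) s x])
    have "(\<lambda>n. nrm A (s n \<ominus> x)) \<longlonglongrightarrow> 0" by (rule tendsD(3)[OF x])
    then have "limitin (Metric_space.mtopology C (cstar_dist (A\<lparr>carrier := C\<rparr>))) s x sequentially"
      unfolding Metric_space.limitin_metric_dist_null[OF mC] using s xC Cc by (simp add: d cstar_dist_def restrict_minus[OF Cs(1)])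
    then show "\<exists>x. limitin (Metric_space.mtopology C (cstar_dist (A\<lparr>carrier := C\<rparr>))) s x sequentially" by blast
  qed
  then show "Metric_space.mcomplete (carrier (A\<lparr>carrier := C\<rparr>)) (cstar_dist (A\<lparr>carrier := C\<rparr>))" by simp
qed (use C in \<open>auto simp: cstar_subalgebraD subset_eq smult_mult_left smult_mult_right star_add star_smult star_mult
      nrm_nonneg nrm_eq_0 nrm_triangle nrm_smult nrm_mult nrm_cstar dest!: subsetD[OF cstar_subalgebraD(2)[OF C]]\<close>)

lemma norm_closed_restrict:
  assumes C: "cstar_subalgebra C A" and S: "norm_closed A S" "S \<subseteq> C"
  shows "norm_closed (A\<lparr>carrier := C\<rparr>) S"
proof -
  interpret R: cstar_algebra "A\<lparr>carrier := C\<rparr>" by (rule cstar_algebra_restrict[OF C])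
  have "tends \<sigma> x" if "R.tends \<sigma> x" for \<sigma> x
    using that cstar_subalgebraD(2)[OF C]
    by (auto simp: tends_def R.tends_def restrict_minus[OF cstar_subalgebraD(1)[OF C]])
  then show ?thesis using norm_closed_tends[OF S(1)] S(2) unfolding R.norm_closed_iff by fastforce
qed

lemma complex_span_superset: "v \<in> S \<Longrightarrow> S \<subseteq> carrier A \<Longrightarrow> v \<in> complex_span A S"
  unfolding complex_span_def by (auto intro!: exI[of _ "{v}"] exI[of _ "\<lambda>_. 1"])

text \<open>
  \<^const>\<open>complex_span\<close> sums over sets of vectors, so the coefficients of two combinations are extended by zero
  to the union of their supports.
\<close>

lemma complex_span_add:
  assumes S: "S \<subseteq> carrier A" and x: "x \<in> complex_span A S" and y: "y \<in> complex_span A S"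
  shows "x \<oplus> y \<in> complex_span A S"
proof -
  obtain T c where T: "finite T" "T \<subseteq> S" "x = (\<Oplus>v\<in>T. c v \<odot> v)" using x by (auto simp: complex_span_def)
  obtain U d where U: "finite U" "U \<subseteq> S" "y = (\<Oplus>v\<in>U. d v \<odot> v)" using y by (auto simp: complex_span_def)
  have ext: "(\<Oplus>v\<in>V. k v \<odot> v) = (\<Oplus>v\<in>T \<union> U. (if v \<in> V then k v else 0) \<odot> v)" if V: "V \<subseteq> T \<union> U" for V k
  proof -
    have W: "T \<union> U = V \<union> (T \<union> U - V)" using V by auto
    have f: "finite V" using V T U finite_subset by blast
    have c: "v \<in> carrier A" if "v \<in> T \<union> U" for v using that S T U by auto
    have "(\<Oplus>v\<in>V \<union> (T \<union> U - V). (if v \<in> V then k v else 0) \<odot> v)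
        = (\<Oplus>v\<in>V. (if v \<in> V then k v else 0) \<odot> v) \<oplus> (\<Oplus>v\<in>T \<union> U - V. (if v \<in> V then k v else 0) \<odot> v)"
      by (rule finsum_Un_disjoint) (use f T U c V in auto)
    also have "(\<Oplus>v\<in>T \<union> U - V. (if v \<in> V then k v else 0) \<odot> v) = (\<Oplus>v\<in>T \<union> U - V. \<zero>)"
      by (rule finsum_cong') (use c in auto)
    also have "(\<Oplus>v\<in>V. (if v \<in> V then k v else 0) \<odot> v) = (\<Oplus>v\<in>V. k v \<odot> v)"
      by (rule finsum_cong') (use c V in auto)
    finally show ?thesis using W c V by (simp add: finsum_closed Pi_def subset_eq)
  qed
  have eq: "x \<oplus> y = (\<Oplus>v\<in>T \<union> U. ((if v \<in> T then c v else 0) + (if v \<in> U then d v else 0)) \<odot> v)"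
    unfolding T(3) U(3) ext[of T, OF Un_upper1] ext[of U, OF Un_upper2]
    by (rule sym, rule trans[OF finsum_cong'[OF refl] finsum_addf])
       (use S T U in \<open>auto simp: subset_eq smult_add_left\<close>)
  show ?thesis
    unfolding complex_span_def mem_Collect_eq
    by (intro exI conjI, rule eq) (use T U in auto)
qed

text \<open>The family \<open>g\<close> may repeat vectors.\<close>

lemma complex_span_finsum:
  assumes S: "S \<subseteq> carrier A" and "finite I" "\<And>i. i \<in> I \<Longrightarrow> g i \<in> S"
  shows "(\<Oplus>i\<in>I. g i) \<in> complex_span A S"
  using assms(2,3)
proof (induction I rule: finite_induct)
  case empty
  show ?case unfolding complex_span_def by (auto intro!: exI[of _ "{}"])
next
  case (insert i I)
  then have "g \<in> I \<rightarrow> carrier A" "g i \<in> carrier A" using S by auto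
  with insert show ?case using complex_span_add[OF S complex_span_superset[OF _ S]] by simp
qed

end

context inclusion
begin

interpretation D: inclusion M "emb ` carrier A" dual L1
  by (rule dual_inclusion)

abbreviation M2_mult (infixl "\<star>" 70) where "x \<star> y \<equiv> x \<otimes>\<^bsub>D.M\<^esub> y"

text \<open>The inclusion of \<open>A\<close> in \<open>A\<^sub>2\<close>.\<close>

abbreviation emb2 :: "'a \<Rightarrow> ('a \<Rightarrow> 'a) \<Rightarrow> 'a \<Rightarrow> 'a" where
  "emb2 a \<equiv> left_mult M (emb a)"

lemma tower1_eq: "tower1 A B = M"
  by (simp add: tower1_def basic_construction)

lemma image1_eq: "image1 A S = emb ` S"
  by (simp add: image1_def)

lemma tower2_eq: "tower2 A B = D.M"
  by (simp add: tower2_def tower1_eq image1_eq D.basic_construction)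

lemma incl12_eq: "incl12 A B = left_mult M"
  by (simp add: incl12_def tower1_eq)

lemma image2_eq: "image2 A B S = emb2 ` S"
  by (simp add: image2_def incl12_eq image1_eq image_image)

lemma jones1_eq: "jones1 A B = e1"
  by (simp add: jones1_def jones_projection_def min_expectation e1_def)

lemma jones2_eq: "jones2 A B = D.e1"
  by (simp add: jones2_def tower1_eq image1_eq jones_projection_def D.min_expectation D.e1_def)

lemma commutant_B1_eq: "commutant_B1 A B = {T \<in> maps. \<forall>b\<in>B. T \<cdot> emb b = emb b \<cdot> T}"
  by (auto simp: commutant_B1_def tower1_eq image1_eq relative_commutant_def)

lemma commutant_B2_eq: "commutant_B2 A B = {x \<in> D.maps. \<forall>b\<in>B. x \<star> emb2 b = emb2 b \<star> x}"
  by (auto simp: commutant_B2_def tower2_eq image2_eq relative_commutant_def)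

lemma commutant_A2_eq:
  "commutant_A2 A B = {x \<in> D.maps. \<forall>a\<in>carrier A. x \<star> emb2 a = emb2 a \<star> x}"
  by (auto simp: commutant_A2_def tower2_eq image2_eq relative_commutant_def)

lemma ptrace_commutant_scalar:
  assumes T: "T \<in> maps" and comm: "\<And>b. b \<in> B \<Longrightarrow> T \<cdot> emb b = emb b \<cdot> T"
  obtains c where "ptrace T = c \<odot> \<one>"
proof (rule commutant_scalar[of "ptrace T"])
  show "ptrace T \<otimes> b = b \<otimes> ptrace T" if b: "b \<in> B" for b
    using ptrace_right[of b T] ptrace_left[of b T] comm[OF b] T b by simp
qed (use T that in auto)

text \<open>
  On \<open>B' \<inter> A\<^sub>2\<close> the value of \<open>E\<^sub>1 \<circ> E\<^sub>2\<close> is already scalar, and \<open>E\<^sub>0\<close> fixes scalars.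
\<close>

lemma tower_trace_eq:
  assumes x: "x \<in> D.maps" and c: "ptrace (D.ptrace x) = c \<odot> \<one>"
  shows "tower_trace A B x = c"
proof -
  have "D.ptrace x \<in> maps" using D.ptrace_closed[OF x] by simp
  then have "next_expectation A B (next_expectation (tower1 A B) (image1 A (carrier A)) x) = ptrace (D.ptrace x)"
    by (simp add: tower1_eq image1_eq D.next_expectation[OF x] next_expectation)
  then show ?thesis
    unfolding tower_trace_def min_expectation by (auto simp: c E_smult intro!: the_equality dest: scalar_inj)
qed

lemma emb2_add: "\<lbrakk>a \<in> carrier A; b \<in> carrier A\<rbrakk> \<Longrightarrow> emb2 (a \<oplus> b) = emb2 a \<oplus>\<^bsub>D.M\<^esub> emb2 b"
  by (simp add: emb_add D.emb_add)

lemma emb2_mult: "\<lbrakk>a \<in> carrier A; b \<in> carrier A\<rbrakk> \<Longrightarrow> emb2 (a \<otimes> b) = emb2 a \<star> emb2 b"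
  by (simp add: emb_mult D.emb_mult)

lemma emb2_star: "a \<in> carrier A \<Longrightarrow> star D.M (emb2 a) = emb2 (star A a)"
  by (simp add: emb_star D.emb_star)

lemma emb2_one: "emb2 \<one> = \<one>\<^bsub>D.M\<^esub>"
  by (simp add: emb_one D.emb_one)

lemma emb2_finsum:
  assumes "g \<in> I \<rightarrow> carrier A" shows "emb2 (\<Oplus>i\<in>I. g i) = (\<Oplus>\<^bsub>D.M\<^esub>i\<in>I. emb2 (g i))"
  using assms by (subst emb_finsum, simp, subst D.emb_finsum) (auto simp: Pi_iff)

lemma emb2_smult: "a \<in> carrier A \<Longrightarrow> emb2 (c \<odot> a) = c \<odot>\<^bsub>D.M\<^esub> emb2 a"
  by (simp add: emb_smult D.emb_smult)

lemma commutant_B2_scalar: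
  assumes "x \<in> commutant_B2 A B" obtains c where "ptrace (D.ptrace x) = c \<odot> \<one>"
proof (rule ptrace_commutant_scalar[of "D.ptrace x"])
  have x: "x \<in> D.maps" using assms by (simp add: commutant_B2_eq)
  then show "D.ptrace x \<in> maps" using D.ptrace_closed by simp
  show "D.ptrace x \<cdot> emb b = emb b \<cdot> D.ptrace x" if b: "b \<in> B" for b
    using D.ptrace_right[of "emb b" x] D.ptrace_left[of "emb b" x] assms b x by (simp add: commutant_B2_eq)
qed (use that in auto)

lemma commutant_B2_subalgebra: "cstar_subalgebra (commutant_B2 A B) D.M"
  unfolding commutant_B2_def tower2_eq image2_eq
  by (rule D.M.relative_commutant_subalgebra) (auto simp: emb2_star)

lemma commutant_A2_subalgebra: "cstar_subalgebra (commutant_A2 A B) D.M"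
  unfolding commutant_A2_def tower2_eq image2_eq
  by (rule D.M.relative_commutant_subalgebra) (auto simp: emb2_star)

lemma commutant_A2_B2: "commutant_A2 A B \<subseteq> commutant_B2 A B"
  by (auto simp: commutant_A2_eq commutant_B2_eq)

text \<open>
  \<open>E\<^sub>1\<close> is faithful on the positive element \<open>E\<^sub>2(v\<^sup>* v)\<close>, which has to be written as a square to apply it,
  and then \<open>E\<^sub>2\<close> is faithful.
\<close>

lemma tower_trace_faithful:
  assumes v: "v \<in> commutant_B2 A B" and z: "tower_trace A B (star D.M v \<star> v) = 0"
  shows "v = \<zero>\<^bsub>D.M\<^esub>"
proof -
  note C = cstar_subalgebraD[OF commutant_B2_subalgebra]
  have vm: "v \<in> D.maps" using v by (simp add: commutant_B2_eq)
  let ?w = "star D.M v \<star> v"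
  have w: "?w \<in> commutant_B2 A B" by (rule C(6)[OF C(10)[OF v] v])
  then have wm: "?w \<in> D.maps" by (simp add: commutant_B2_eq)
  obtain c where c: "ptrace (D.ptrace ?w) = c \<odot> \<one>" using commutant_B2_scalar[OF w] .
  then have p0: "ptrace (D.ptrace ?w) = \<zero>" using tower_trace_eq[OF wm c] z by simp
  have "M.pos (D.ptrace ?w)" using D.ptrace_pos[OF vm] by (simp add: D.M_star[OF vm])
  then obtain r where r: "r \<in> maps" "star M r = r" "r \<cdot> r = D.ptrace ?w"
    using M.pos_sqrt by (metis M_carrier)
  have "dual (star M r \<cdot> r) = \<zero>\<^bsub>M\<^esub>" using r p0 D.ptrace_closed[OF wm] by (simp add: emb_zero)
  then have "r = \<zero>\<^bsub>M\<^esub>" using D.E_faithful[of r] r by simp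
  then have "D.ptrace ?w = \<zero>\<^bsub>M\<^esub>" using r by auto
  then have "D.dual ?w = \<zero>\<^bsub>D.M\<^esub>" using wm by (simp add: D.emb_zero)
  then show ?thesis
    using inclusion.axioms(1)[OF D.dual_inclusion] inclusion.E_faithful[OF D.dual_inclusion, of v] vm by simp
qed

text \<open>
  Averaging over the quasi-basis of \<open>E\<close> inside \<open>A\<^sub>2\<close>. By \<open>average_commutes\<close> it maps
  \<open>B' \<inter> A\<^sub>2\<close> into \<open>A' \<inter> A\<^sub>2\<close>.
\<close>

definition average :: "((('a \<Rightarrow> 'a) \<Rightarrow> 'a \<Rightarrow> 'a)) \<Rightarrow> (('a \<Rightarrow> 'a) \<Rightarrow> 'a \<Rightarrow> 'a)" where
  "average x = of_real (1 / index) \<odot>\<^bsub>D.M\<^esub>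
     (\<Oplus>\<^bsub>D.M\<^esub>l\<in>L. emb2 l \<star> x \<star> emb2 (star A l))"

lemma average_sum_closed [simp]:
  "x \<in> D.maps \<Longrightarrow> (\<Oplus>\<^bsub>D.M\<^esub>l\<in>L. emb2 l \<star> x \<star> emb2 (star A l)) \<in> D.maps"
  by (rule D.M_finsum_maps) simp

lemma average_maps [simp]: "x \<in> D.maps \<Longrightarrow> average x \<in> D.maps"
  by (simp add: average_def)

lemma average_commutant: assumes x: "x \<in> commutant_B2 A B" shows "average x \<in> commutant_A2 A B"
proof -
  have xm: "x \<in> D.maps" using x by (simp add: commutant_B2_eq)
  have "emb2 a \<star> (\<Oplus>\<^bsub>D.M\<^esub>l\<in>L. emb2 l \<star> x \<star> emb2 (star A l))
      = (\<Oplus>\<^bsub>D.M\<^esub>l\<in>L. emb2 l \<star> x \<star> emb2 (star A l)) \<star> emb2 a" if "a \<in> carrier A" for a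
    by (rule average_commutes[OF D.M_cstar_algebra])
       (use x that in \<open>auto simp: emb2_add emb2_mult commutant_B2_eq\<close>)
  then show ?thesis
    unfolding commutant_A2_eq average_def using xm by (simp add: D.M.smult_mult_left D.M.smult_mult_right)
qed

lemma average_add: "\<lbrakk>x \<in> D.maps; y \<in> D.maps\<rbrakk> \<Longrightarrow> average (x \<oplus>\<^bsub>D.M\<^esub> y) = average x \<oplus>\<^bsub>D.M\<^esub> average y"
proof -
  assume *: "x \<in> D.maps" "y \<in> D.maps"
  have "(\<Oplus>\<^bsub>D.M\<^esub>l\<in>L. emb2 l \<star> (x \<oplus>\<^bsub>D.M\<^esub> y) \<star> emb2 (star A l))
     = (\<Oplus>\<^bsub>D.M\<^esub>l\<in>L. emb2 l \<star> x \<star> emb2 (star A l))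
       \<oplus>\<^bsub>D.M\<^esub> (\<Oplus>\<^bsub>D.M\<^esub>l\<in>L. emb2 l \<star> y \<star> emb2 (star A l))"
    by (rule trans[OF D.M.finsum_cong'[OF refl] D.M.finsum_addf])
       (use * in \<open>auto simp: D.M.l_distr D.M.r_distr\<close>)
  then show ?thesis using * by (simp add: average_def D.M.smult_add_right)
qed

lemma average_left:
  assumes z: "z \<in> commutant_A2 A B" and x: "x \<in> D.maps"
  shows "average (z \<star> x) = z \<star> average x"
proof -
  have zm: "z \<in> D.maps" and zc: "\<And>a. a \<in> carrier A \<Longrightarrow> z \<star> emb2 a = emb2 a \<star> z"
    using z by (auto simp: commutant_A2_eq)
  have "(\<Oplus>\<^bsub>D.M\<^esub>l\<in>L. emb2 l \<star> (z \<star> x) \<star> emb2 (star A l))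
      = (\<Oplus>\<^bsub>D.M\<^esub>l\<in>L. z \<star> (emb2 l \<star> x \<star> emb2 (star A l)))"
  proof (rule D.M.finsum_cong'[OF refl])
    fix l assume l: "l \<in> L"
    have "emb2 l \<star> (z \<star> x) = (emb2 l \<star> z) \<star> x"
      using l zm x by (simp add: D.M.m_assoc)
    also have "\<dots> = z \<star> (emb2 l \<star> x)"
      using l zm x by (simp add: zc[symmetric] D.M.m_assoc)
    finally show "emb2 l \<star> (z \<star> x) \<star> emb2 (star A l)
        = z \<star> (emb2 l \<star> x \<star> emb2 (star A l))"
      using l zm x by (simp add: D.M.m_assoc)
  qed (use zm x in auto)
  also have "\<dots> = z \<star> (\<Oplus>\<^bsub>D.M\<^esub>l\<in>L. emb2 l \<star> x \<star> emb2 (star A l))"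
    using zm x by (intro D.M.mult_finsum_right[symmetric]) auto
  finally show ?thesis using zm x by (simp add: average_def D.M.smult_mult_right)
qed

lemma average_right:
  assumes z: "z \<in> commutant_A2 A B" and x: "x \<in> D.maps"
  shows "average (x \<star> z) = average x \<star> z"
proof -
  have zm: "z \<in> D.maps" and zc: "\<And>a. a \<in> carrier A \<Longrightarrow> z \<star> emb2 a = emb2 a \<star> z"
    using z by (auto simp: commutant_A2_eq)
  have "(\<Oplus>\<^bsub>D.M\<^esub>l\<in>L. emb2 l \<star> (x \<star> z) \<star> emb2 (star A l))
      = (\<Oplus>\<^bsub>D.M\<^esub>l\<in>L. (emb2 l \<star> x \<star> emb2 (star A l)) \<star> z)"
    by (rule D.M.finsum_cong'[OF refl]) (use zm x in \<open>auto simp: D.M.m_assoc zc\<close>)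
  also have "\<dots> = (\<Oplus>\<^bsub>D.M\<^esub>l\<in>L. emb2 l \<star> x \<star> emb2 (star A l)) \<star> z"
    using zm x by (intro D.M.mult_finsum_left[symmetric]) auto
  finally show ?thesis using zm x by (simp add: average_def D.M.smult_mult_left)
qed

lemma average_one: "average \<one>\<^bsub>D.M\<^esub> = \<one>\<^bsub>D.M\<^esub>"
proof -
  have "(\<Oplus>\<^bsub>D.M\<^esub>l\<in>L. emb2 l \<star> \<one>\<^bsub>D.M\<^esub> \<star> emb2 (star A l)) = (\<Oplus>\<^bsub>D.M\<^esub>l\<in>L. emb2 (l \<otimes> star A l))"
    by (rule D.M.finsum_cong') (auto simp: emb2_mult)
  also have "\<dots> = emb2 (\<Oplus>l\<in>L. l \<otimes> star A l)" by (rule emb2_finsum[symmetric]) auto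
  finally show ?thesis using index(2) by (simp add: average_def index(1) emb2_smult emb2_one)
qed

lemma average_fix: "z \<in> commutant_A2 A B \<Longrightarrow> average z = z"
  using average_left[of z "\<one>\<^bsub>D.M\<^esub>"] by (simp add: average_one commutant_A2_eq)

lemma average_smult: "x \<in> D.maps \<Longrightarrow> average (c \<odot>\<^bsub>D.M\<^esub> x) = c \<odot>\<^bsub>D.M\<^esub> average x"
proof -
  assume x: "x \<in> D.maps"
  have "c \<odot>\<^bsub>D.M\<^esub> \<one>\<^bsub>D.M\<^esub> \<in> commutant_A2 A B"
    by (simp add: commutant_A2_eq D.M.smult_mult_left D.M.smult_mult_right)
  from average_left[OF this x] show ?thesis using x by (simp add: D.M.smult_mult_left)
qed

lemma average_pos: "x \<in> D.maps \<Longrightarrow> D.M.pos (average (star D.M x \<star> x))"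
proof -
  assume x: "x \<in> D.maps"
  have "D.M.pos (emb2 l \<star> (star D.M x \<star> x) \<star> emb2 (star A l))" if l: "l \<in> L" for l
  proof -
    let ?w = "x \<star> emb2 (star A l)"
    have "star D.M ?w = emb2 l \<star> star D.M x" using x l by (simp add: D.M.star_mult emb2_star)
    then have "emb2 l \<star> (star D.M x \<star> x) \<star> emb2 (star A l) = star D.M ?w \<star> ?w"
      using x l by (simp add: D.M.m_assoc D.M_star[OF x])
    then show ?thesis using D.M.pos_star_mult[of ?w] x l by simp
  qed
  then show ?thesis unfolding average_def using index(2) by (intro D.M.pos_smult D.M.pos_finsum) auto
qed

text \<open>On scalars \<open>c\<close> the average is \<open>\<tau> c \<Sum> l l\<^sup>* = c\<close>.\<close>

lemma average_trace:
  assumes x: "x \<in> commutant_B2 A B" shows "tower_trace A B (average x) = tower_trace A B x"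
proof -
  have xm: "x \<in> D.maps" using x by (simp add: commutant_B2_eq)
  obtain c where c: "ptrace (D.ptrace x) = c \<odot> \<one>" using commutant_B2_scalar[OF x] .
  have pm: "D.ptrace x \<in> maps" using D.ptrace_closed[OF xm] by simp
  have "D.ptrace (average x) = of_real (1 / index) \<odot>\<^bsub>M\<^esub>
      (\<Oplus>\<^bsub>M\<^esub>l\<in>L. D.ptrace (emb2 l \<star> x \<star> emb2 (star A l)))"
    unfolding average_def using xm by (simp add: D.ptrace_smult D.ptrace_finsum)
  also have "(\<Oplus>\<^bsub>M\<^esub>l\<in>L. D.ptrace (emb2 l \<star> x \<star> emb2 (star A l)))
      = (\<Oplus>\<^bsub>M\<^esub>l\<in>L. emb l \<cdot> D.ptrace x \<cdot> emb (star A l))"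
    using xm pm by (intro M.finsum_cong') (auto simp: D.ptrace_left D.ptrace_right)
  finally have "ptrace (D.ptrace (average x)) = of_real (1 / index) \<odot>
      (\<Oplus>l\<in>L. ptrace (emb l \<cdot> D.ptrace x \<cdot> emb (star A l)))"
    using pm by (simp add: ptrace_smult ptrace_finsum)
  also have "(\<Oplus>l\<in>L. ptrace (emb l \<cdot> D.ptrace x \<cdot> emb (star A l))) = (\<Oplus>l\<in>L. c \<odot> (l \<otimes> star A l))"
    using pm by (intro finsum_cong') (auto simp: ptrace_left ptrace_right c smult_mult_left smult_mult_right)
  also have "\<dots> = c \<odot> (\<Oplus>l\<in>L. l \<otimes> star A l)" by (rule smult_finsum[symmetric]) auto
  finally have "ptrace (D.ptrace (average x)) = c \<odot> \<one>" using index(2) by (simp add: index(1))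
  then show ?thesis using tower_trace_eq c xm by simp
qed

lemma average_expectation:
  "conditional_expectation ((tower2 A B)\<lparr>carrier := commutant_B2 A B\<rparr>) (commutant_A2 A B)
     (\<lambda>x\<in>commutant_B2 A B. average x)"
proof -
  let ?C = "commutant_B2 A B"
  let ?R = "D.M\<lparr>carrier := ?C\<rparr>"
  interpret R: cstar_algebra ?R by (rule D.M.cstar_algebra_restrict[OF commutant_B2_subalgebra])
  note C = cstar_subalgebraD[OF commutant_B2_subalgebra]
  note A2 = cstar_subalgebraD[OF commutant_A2_subalgebra]
  have Cm [simp]: "x \<in> D.maps" if "x \<in> ?C" for x using that by (simp add: commutant_B2_eq)
  have Am: "x \<in> ?C" if "x \<in> commutant_A2 A B" for x using that commutant_A2_B2 by blast
  have sub: "cstar_subalgebra (commutant_A2 A B) ?R"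
    unfolding cstar_subalgebra_def
  proof (intro conjI allI ballI)
    have "ring (D.M\<lparr>carrier := commutant_A2 A B\<rparr>)" by (rule D.M.subring_is_ring[OF A2(1)])
    then show "subring (commutant_A2 A B) ?R"
      by (intro R.ring_incl_imp_subring) (use commutant_A2_B2 in auto)
    show "norm_closed ?R (commutant_A2 A B)"
      by (rule D.M.norm_closed_restrict[OF commutant_B2_subalgebra A2(11) commutant_A2_B2])
  qed (use A2 in auto)
  have "conditional_expectation ?R (commutant_A2 A B) (\<lambda>x\<in>?C. average x)"
  proof (rule R.conditional_expectationI[OF sub])
    show "(\<lambda>x\<in>?C. average x) \<in> carrier ?R \<rightarrow>\<^sub>E commutant_A2 A B" using average_commutant by auto
    show "R.pos ((\<lambda>x\<in>?C. average x) (star ?R x \<otimes>\<^bsub>?R\<^esub> x))" if "x \<in> carrier ?R" for x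
    proof -
      have x: "x \<in> ?C" using that by simp
      have w: "star D.M x \<star> x \<in> ?C" by (rule C(6)[OF C(10)[OF x] x])
      have "positive (D.M\<lparr>carrier := ?C\<rparr>) (average (star D.M x \<star> x))"
        using average_pos[of x] average_commutant[OF w] Am x
        by (intro D.M.pos_in_subalgebra[OF _ _ commutant_B2_subalgebra]) auto
      then show ?thesis using w by (simp add: R.positive_iff_pos)
    qed
  qed (use C Am in \<open>auto simp: average_add average_smult average_fix average_left average_right\<close>)
  then show ?thesis by (simp add: tower2_eq)
qed

text \<open>
  Two trace-preserving expectations \<open>F\<close>, \<open>F'\<close> onto \<open>A' \<inter> A\<^sub>2\<close> agree: \<open>w = F(x) - F'(x)\<close> is orthogonal to
  \<open>A' \<inter> A\<^sub>2\<close> for the trace, in particular to itself.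
\<close>

lemma trace_expectation_eq:
  assumes x: "x \<in> commutant_B2 A B" shows "trace_expectation A B x = average x"
proof -
  let ?C = "commutant_B2 A B"
  let ?R = "D.M\<lparr>carrier := ?C\<rparr>"
  note C = cstar_subalgebraD[OF commutant_B2_subalgebra]
  note A2 = cstar_subalgebraD[OF commutant_A2_subalgebra]
  have Cm [simp]: "x \<in> D.maps" if "x \<in> ?C" for x using that by (simp add: commutant_B2_eq)
  have "trace_expectation A B = (\<lambda>x\<in>?C. average x)"
    unfolding trace_expectation_def
  proof (rule the_equality)
    show "conditional_expectation (tower2 A B\<lparr>carrier := ?C\<rparr>) (commutant_A2 A B) (\<lambda>x\<in>?C. average x) \<and>
        (\<forall>x\<in>?C. tower_trace A B ((\<lambda>x\<in>?C. average x) x) = tower_trace A B x)"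
      using average_expectation average_trace by simp
    fix F assume F: "conditional_expectation (tower2 A B\<lparr>carrier := ?C\<rparr>) (commutant_A2 A B) F \<and>
        (\<forall>x\<in>?C. tower_trace A B (F x) = tower_trace A B x)"
    then have Fext: "F \<in> ?C \<rightarrow>\<^sub>E commutant_A2 A B"
      and Fmod: "\<And>z x. \<lbrakk>z \<in> commutant_A2 A B; x \<in> ?C\<rbrakk> \<Longrightarrow>
          F (\<one>\<^bsub>D.M\<^esub> \<star> x \<star> z) = \<one>\<^bsub>D.M\<^esub> \<star> F x \<star> z"
      and Ftr: "\<And>x. x \<in> ?C \<Longrightarrow> tower_trace A B (F x) = tower_trace A B x"
      using A2(3) by (auto simp: conditional_expectation_def tower2_eq)
    have FA: "F x \<in> commutant_A2 A B" if "x \<in> ?C" for x using Fext that by auto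
    show "F = (\<lambda>x\<in>?C. average x)"
    proof (rule PiE_ext[OF Fext])
      show "(\<lambda>x\<in>?C. average x) \<in> ?C \<rightarrow>\<^sub>E commutant_A2 A B" using average_commutant by auto
      fix x assume x: "x \<in> ?C"
      let ?w = "F x \<ominus>\<^bsub>D.M\<^esub> average x"
      have w: "?w \<in> commutant_A2 A B" by (rule A2(8)[OF FA[OF x] average_commutant[OF x]])
      let ?z = "star D.M ?w"
      have z: "?z \<in> commutant_A2 A B" by (rule A2(10)[OF w])
      have zC: "?z \<in> ?C" by (rule subsetD[OF commutant_A2_B2 z])
      have xz: "x \<star> ?z \<in> ?C" by (rule C(6)[OF x zC])
      have m: "F x \<in> D.maps" "average x \<in> D.maps" "?z \<in> D.maps" "x \<in> D.maps"
        using FA[OF x] zC x by (auto simp: commutant_A2_eq)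
      have "F (x \<star> ?z) = F x \<star> ?z" using Fmod[OF z x] m by simp
      then have t1: "tower_trace A B (F x \<star> ?z) = tower_trace A B (x \<star> ?z)"
        using Ftr[OF xz] by simp
      have t2: "tower_trace A B (average x \<star> ?z) = tower_trace A B (x \<star> ?z)"
        using average_trace[OF xz] average_right[OF z] m by simp
      have in1: "F x \<star> ?z \<in> ?C" "average x \<star> ?z \<in> ?C"
        by (intro subsetD[OF commutant_A2_B2] A2(6) FA average_commutant x z)+
      obtain c where c: "ptrace (D.ptrace (F x \<star> ?z)) = c \<odot> \<one>" using commutant_B2_scalar[OF in1(1)] .
      obtain d where d: "ptrace (D.ptrace (average x \<star> ?z)) = d \<odot> \<one>" using commutant_B2_scalar[OF in1(2)] .
      have cd: "c = d"
        using t1 t2 tower_trace_eq[OF Cm[OF in1(1)] c] tower_trace_eq[OF Cm[OF in1(2)] d] by simp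
      have split: "F x \<star> ?z = ?w \<star> ?z \<oplus>\<^bsub>D.M\<^esub> average x \<star> ?z"
        using m by (simp add: D.M.minus_distrib_left D.M.minus_add_cancel)
      have wz: "?w \<star> ?z \<in> D.maps" using m by simp
      have azm: "average x \<star> ?z \<in> D.maps" using m by simp
      have pm: "D.ptrace (?w \<star> ?z) \<in> maps" "D.ptrace (average x \<star> ?z) \<in> maps"
        using D.ptrace_closed[OF wz] D.ptrace_closed[OF azm] by simp_all
      have "c \<odot> \<one> = ptrace (D.ptrace (?w \<star> ?z)) \<oplus> c \<odot> \<one>"
        using c d cd by (simp add: split D.ptrace_add[OF wz azm] ptrace_add[OF pm])
      then have "ptrace (D.ptrace (?w \<star> ?z)) = \<zero>"
        using add.r_cancel_one'[of "c \<odot> \<one>" "ptrace (D.ptrace (?w \<star> ?z))"] pm by simp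
      then have "tower_trace A B (star D.M ?z \<star> ?z) = 0"
        using tower_trace_eq[OF wz, of 0] m by (simp add: D.M.star_star)
      then have "?z = \<zero>\<^bsub>D.M\<^esub>" by (rule tower_trace_faithful[OF zC])
      then have "?w = \<zero>\<^bsub>D.M\<^esub>" using m D.M.star_star[of ?w] D.M.star_zero by simp
      then show "F x = (\<lambda>x\<in>?C. average x) x" using m x by (simp add: D.M.minus_eq_zero_iff)
    qed
  qed
  then show ?thesis using x by simp
qed

definition fourier_scale :: real where
  "fourier_scale = inverse index powr (-3/2) * (1 / index)\<^sup>2"

lemma fourier_scale_pos: "fourier_scale > 0"
  using index(2) by (simp add: fourier_scale_def)

text \<open>
  For \<open>x = e e\<^sub>2 e\<^sub>1\<close>, the summand \<open>l x l\<^sup>*\<close> maps \<open>a e\<^sub>1 b\<close> to \<open>l e E\<^sub>1(e\<^sub>1 l\<^sup>* a e\<^sub>1 b) = \<tau> l E(l\<^sup>* a) e b\<close>, since \<open>e\<close>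
  commutes with \<open>B\<close>; the sum over \<open>l\<close> restores \<open>a\<close>.
\<close>

lemma fourier1_apply:
  assumes e: "e \<in> commutant_B1 A B"
  shows "fourier1 A B e \<in> commutant_A2 A B" "fourier1 A B e \<in> D.maps"
    "\<And>a b. \<lbrakk>a \<in> carrier A; b \<in> carrier A\<rbrakk> \<Longrightarrow> fourier1 A B e (emb a \<cdot> e1 \<cdot> emb b)
       = of_real fourier_scale \<odot>\<^bsub>M\<^esub> (emb a \<cdot> e \<cdot> emb b)"
proof -
  have em [simp]: "e \<in> maps" and ec: "\<And>b. b \<in> B \<Longrightarrow> e \<cdot> emb b = emb b \<cdot> e"
    using e by (auto simp: commutant_B1_eq)
  let ?x = "left_mult M e \<star> D.e1 \<star> left_mult M e1"
  have xm [simp]: "?x \<in> D.maps" by simp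
  have x: "?x \<in> commutant_B2 A B"
    unfolding commutant_B2_eq
  proof (intro CollectI conjI ballI xm)
    fix b assume b: "b \<in> B"
    show "?x \<star> emb2 b = emb2 b \<star> ?x"
    proof (rule D.maps_ext)
      fix T assume "T \<in> carrier M"
      then have T: "T \<in> maps" by simp
      have "(?x \<star> emb2 b) T = e \<cdot> dual (e1 \<cdot> (emb b \<cdot> T))"
        using T b by (simp add: D.M_apply D.emb_apply)
      also have "e1 \<cdot> (emb b \<cdot> T) = emb b \<cdot> (e1 \<cdot> T)"
        using T b e1_emb_B[OF b] by (simp add: M.m_assoc[symmetric])
      also have "dual \<dots> = emb b \<cdot> dual (e1 \<cdot> T)" using T b by (simp add: ptrace_left emb_mult)
      also have "e \<cdot> \<dots> = emb b \<cdot> (e \<cdot> dual (e1 \<cdot> T))"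
        using T b ec[OF b] by (simp add: M.m_assoc[symmetric])
      also have "\<dots> = (emb2 b \<star> ?x) T" using T b by (simp add: D.M_apply D.emb_apply)
      finally show "(?x \<star> emb2 b) T = (emb2 b \<star> ?x) T" .
    qed (use b in auto)
  qed
  have F: "fourier1 A B e = complex_of_real (inverse index powr (-3/2)) \<odot>\<^bsub>D.M\<^esub> average ?x"
    unfolding fourier1_def tower2_eq incl12_eq jones1_eq jones2_eq min_index trace_expectation_eq[OF x] ..
  show "fourier1 A B e \<in> commutant_A2 A B"
    unfolding F by (rule cstar_subalgebraD(9)[OF commutant_A2_subalgebra average_commutant[OF x]])
  then show "fourier1 A B e \<in> D.maps" by (simp add: commutant_A2_eq)
  fix a b assume a: "a \<in> carrier A" and b: "b \<in> carrier A"
  let ?T = "emb a \<cdot> e1 \<cdot> emb b"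
  let ?i = "complex_of_real (1 / index)"
  have summand: "(emb2 l \<star> ?x \<star> emb2 (star A l)) ?T
      = ?i \<odot>\<^bsub>M\<^esub> (emb (l \<otimes> E (star A l \<otimes> a)) \<cdot> (e \<cdot> emb b))" if l: "l \<in> L" for l
  proof -
    have "(emb2 l \<star> ?x \<star> emb2 (star A l)) ?T
        = emb l \<cdot> (e \<cdot> dual (e1 \<cdot> (emb (star A l) \<cdot> ?T)))"
      using l a b by (simp add: D.M_apply D.emb_apply)
    also have "e1 \<cdot> (emb (star A l) \<cdot> ?T) = e1 \<cdot> emb (star A l \<otimes> a) \<cdot> e1 \<cdot> emb b"
      using l a b by (simp add: emb_mult M.m_assoc)
    also have "\<dots> = emb (E (star A l \<otimes> a)) \<cdot> e1 \<cdot> emb b" using l a by (simp add: e1_emb_e1)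
    also have "dual \<dots> = ?i \<odot>\<^bsub>M\<^esub> (emb (E (star A l \<otimes> a)) \<cdot> emb b)"
      using l a b by (simp add: ptrace_rank_one emb_smult emb_mult)
    also have "emb l \<cdot> (e \<cdot> \<dots>) = ?i \<odot>\<^bsub>M\<^esub> (emb l \<cdot> (e \<cdot> emb (E (star A l \<otimes> a))) \<cdot> emb b)"
      using l a b by (simp add: M.smult_mult_right M.m_assoc)
    also have "e \<cdot> emb (E (star A l \<otimes> a)) = emb (E (star A l \<otimes> a)) \<cdot> e" using l a by (intro ec) auto
    finally show ?thesis using l a b by (simp add: emb_mult M.m_assoc)
  qed
  have "average ?x ?T = ?i \<odot>\<^bsub>M\<^esub> (\<Oplus>\<^bsub>M\<^esub>l\<in>L. (emb2 l \<star> ?x \<star> emb2 (star A l)) ?T)"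
    unfolding average_def using a b by (simp add: D.M_apply(5) D.M_finsum_apply)
  also have "(\<Oplus>\<^bsub>M\<^esub>l\<in>L. (emb2 l \<star> ?x \<star> emb2 (star A l)) ?T)
      = (\<Oplus>\<^bsub>M\<^esub>l\<in>L. ?i \<odot>\<^bsub>M\<^esub> (emb (l \<otimes> E (star A l \<otimes> a)) \<cdot> (e \<cdot> emb b)))"
    by (rule M.finsum_cong'[OF refl _ summand]) (use a b in auto)
  also have "\<dots> = ?i \<odot>\<^bsub>M\<^esub> (\<Oplus>\<^bsub>M\<^esub>l\<in>L. emb (l \<otimes> E (star A l \<otimes> a)) \<cdot> (e \<cdot> emb b))"
    using a b by (intro M.smult_finsum[symmetric]) auto
  also have "(\<Oplus>\<^bsub>M\<^esub>l\<in>L. emb (l \<otimes> E (star A l \<otimes> a)) \<cdot> (e \<cdot> emb b))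
      = (\<Oplus>\<^bsub>M\<^esub>l\<in>L. emb (l \<otimes> E (star A l \<otimes> a))) \<cdot> (e \<cdot> emb b)"
    using a b by (intro M.mult_finsum_left[symmetric]) auto
  also have "(\<Oplus>\<^bsub>M\<^esub>l\<in>L. emb (l \<otimes> E (star A l \<otimes> a))) = emb a"
    using emb_finsum[of "\<lambda>l. l \<otimes> E (star A l \<otimes> a)" L] a by (simp add: expand Pi_def)
  finally have "average ?x ?T = (?i * ?i) \<odot>\<^bsub>M\<^esub> (emb a \<cdot> (e \<cdot> emb b))" using a b by simp
  then show "fourier1 A B e ?T = of_real fourier_scale \<odot>\<^bsub>M\<^esub> (emb a \<cdot> e \<cdot> emb b)"
    unfolding F fourier_scale_def using a b
    by (simp add: D.M_apply(5) M.m_assoc power2_eq_square)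
qed

end

section \<open>The intermediate algebra of a biprojection\<close>

text \<open>
  What remains of a biprojection \<open>e\<close> after the Fourier transform is made explicit: the projection
  \<open>p = [\<F>(e)]\<close> as a map on \<open>A\<^sub>1\<close>. That \<open>s\<close> is positive is a consequence, so the locale allows any nonzero
  complex number.
\<close>

locale biprojection_pair = inclusion A B E L for A :: "'a cstar" (structure) and B E L +
  fixes e :: "'a \<Rightarrow> 'a" and p :: "('a \<Rightarrow> 'a) \<Rightarrow> 'a \<Rightarrow> 'a" and s :: complex
  assumes e_maps [simp]: "e \<in> maps"
    and e_star: "star M e = e"
    and e_idem: "e \<cdot> e = e"
    and e_emb_B: "b \<in> B \<Longrightarrow> e \<cdot> emb b = emb b \<cdot> e"
    and e_nonzero: "e \<noteq> \<zero>\<^bsub>M\<^esub>"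
    and p_module_map: "p \<in> inclusion.maps M (emb ` carrier A)"
    and p_self: "\<lbrakk>S \<in> maps; T \<in> maps\<rbrakk> \<Longrightarrow> dual (star M (p S) \<cdot> T) = dual (star M S \<cdot> p T)"
    and p_idem: "T \<in> maps \<Longrightarrow> p (p T) = p T"
    and p_rank_one: "\<lbrakk>a \<in> carrier A; b \<in> carrier A\<rbrakk> \<Longrightarrow>
       p (emb a \<cdot> e1 \<cdot> emb b) = s \<odot>\<^bsub>M\<^esub> (emb a \<cdot> e \<cdot> emb b)"
    and s_nonzero: "s \<noteq> 0"
begin

interpretation D: inclusion M "emb ` carrier A" dual L1
  by (rule dual_inclusion)

lemma p_maps [simp]: "T \<in> maps \<Longrightarrow> p T \<in> maps"
  using D.maps_closed[OF p_module_map, of T] by simp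

lemma p_add: "\<lbrakk>S \<in> maps; T \<in> maps\<rbrakk> \<Longrightarrow> p (S \<oplus>\<^bsub>M\<^esub> T) = p S \<oplus>\<^bsub>M\<^esub> p T"
  using D.maps_add[OF p_module_map, of S T] by simp

lemma p_smult: "T \<in> maps \<Longrightarrow> p (c \<odot>\<^bsub>M\<^esub> T) = c \<odot>\<^bsub>M\<^esub> p T"
  using D.maps_smult[OF p_module_map, of T] by simp

lemma p_finsum: "(\<And>i. i \<in> I \<Longrightarrow> g i \<in> maps) \<Longrightarrow> p (\<Oplus>\<^bsub>M\<^esub>i\<in>I. g i) = (\<Oplus>\<^bsub>M\<^esub>i\<in>I. p (g i))"
  using D.maps_finsum[OF p_module_map, of g I] by auto

lemma p_e1: "p e1 = s \<odot>\<^bsub>M\<^esub> e"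
  using p_rank_one[of "\<one>" "\<one>"] by (simp add: emb_one)

lemma p_expand: "T \<in> maps \<Longrightarrow> p T = s \<odot>\<^bsub>M\<^esub> (\<Oplus>\<^bsub>M\<^esub>l\<in>L. emb (T l) \<cdot> e \<cdot> emb (star A l))"
proof -
  assume T: "T \<in> maps"
  have "p T = p (\<Oplus>\<^bsub>M\<^esub>l\<in>L. emb (T l) \<cdot> e1 \<cdot> emb (star A l))" using M_expand[OF T] by simp
  also have "\<dots> = (\<Oplus>\<^bsub>M\<^esub>l\<in>L. p (emb (T l) \<cdot> e1 \<cdot> emb (star A l)))"
    using T by (intro p_finsum) auto
  also have "\<dots> = (\<Oplus>\<^bsub>M\<^esub>l\<in>L. s \<odot>\<^bsub>M\<^esub> (emb (T l) \<cdot> e \<cdot> emb (star A l)))"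
    using T by (intro M.finsum_cong') (auto simp: p_rank_one)
  also have "\<dots> = s \<odot>\<^bsub>M\<^esub> (\<Oplus>\<^bsub>M\<^esub>l\<in>L. emb (T l) \<cdot> e \<cdot> emb (star A l))"
    using T by (intro M.smult_finsum[symmetric]) auto
  finally show ?thesis .
qed

lemma p_left_emb: "\<lbrakk>a \<in> carrier A; T \<in> maps\<rbrakk> \<Longrightarrow> p (emb a \<cdot> T) = emb a \<cdot> p T"
proof -
  assume a: "a \<in> carrier A" and T: "T \<in> maps"
  have "(\<Oplus>\<^bsub>M\<^esub>l\<in>L. emb ((emb a \<cdot> T) l) \<cdot> e \<cdot> emb (star A l))
      = (\<Oplus>\<^bsub>M\<^esub>l\<in>L. emb a \<cdot> (emb (T l) \<cdot> e \<cdot> emb (star A l)))"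
    using a T by (intro M.finsum_cong') (auto simp: M_apply emb_apply emb_mult M.m_assoc)
  also have "\<dots> = emb a \<cdot> (\<Oplus>\<^bsub>M\<^esub>l\<in>L. emb (T l) \<cdot> e \<cdot> emb (star A l))"
    using a T by (intro M.mult_finsum_right[symmetric]) auto
  finally show ?thesis using a T by (simp add: p_expand M.smult_mult_right)
qed

subsection \<open>Normalisation of the scalar\<close>

text \<open>Both \<open>b e(1)\<close> and \<open>e(1) b\<close> are equal to \<open>e(b)\<close>.\<close>

lemma e_one_scalar: obtains \<alpha> where "e \<one> = \<alpha> \<odot> \<one>"
proof (rule commutant_scalar[of "e \<one>"])
  show "e \<one> \<otimes> b = b \<otimes> e \<one>" if b: "b \<in> B" for b
  proof -
    have "(e \<cdot> emb b) \<one> = (emb b \<cdot> e) \<one>" by (simp add: e_emb_B[OF b])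
    then have "e b = b \<otimes> e \<one>" using b by (simp add: M_apply emb_apply)
    then show ?thesis using maps_right[OF e_maps one_closed b] b by simp
  qed
qed (use that in auto)

text \<open>
  The trace of \<open>e\<close>; the formula is the normalisation \<open>s tr(e) = \<tau>\<close> proved in \<open>scalars\<close>.
\<close>

definition e_trace :: real where "e_trace = 1 / (index * Re s)"

text \<open>
  Write \<open>e(1) = \<alpha>\<close>. Testing self-adjointness of \<open>p\<close> on \<open>e\<^sub>1\<close> gives \<open>s\<^sup>* s tr(e) = s \<alpha>\<^sup>* \<tau>\<close>. Since \<open>tr(e) > 0\<close>,
  \<open>\<alpha>\<close> is nonzero, and being idempotent it is 1; so \<open>s\<^sup>* = \<tau> / tr(e)\<close>.
\<close>

lemma scalars: "e \<one> = \<one>" "s = complex_of_real (Re s)" "0 < Re s" "ptrace e = complex_of_real e_trace \<odot> \<one>"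
proof -
  obtain \<alpha> where \<alpha>: "e \<one> = \<alpha> \<odot> \<one>" by (rule e_one_scalar)
  obtain c where c: "ptrace e = c \<odot> \<one>" using ptrace_commutant_scalar[OF e_maps e_emb_B] .
  have "pos (ptrace e)" using ptrace_pos[OF e_maps] e_star e_idem by (simp add: M_star)
  then obtain r where r: "c = complex_of_real r" "0 \<le> r" using pos_scalar[of c] nontrivial by (auto simp: c)
  have "c \<noteq> 0"
  proof
    assume "c = 0"
    then have "dual (star M e \<cdot> e) = \<zero>\<^bsub>M\<^esub>"
      unfolding e_star e_idem using c by (simp add: emb_zero)
    then have "e = \<zero>\<^bsub>M\<^esub>" using D.E_faithful[of e] by simp
    then show False using e_nonzero by simp
  qed
  with r have rp: "0 < r" by auto
  have e1e: "e1 \<cdot> e = cnj \<alpha> \<odot>\<^bsub>M\<^esub> e1"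
  proof -
    have "e \<cdot> e1 = \<alpha> \<odot>\<^bsub>M\<^esub> e1"
      unfolding maps_e1[OF e_maps] \<alpha> by (simp add: emb_smult emb_one M.smult_mult_left)
    then have "star M (e \<cdot> e1) = star M (\<alpha> \<odot>\<^bsub>M\<^esub> e1)" by simp
    then show ?thesis by (simp add: M.star_mult M.star_smult e_star e1_star)
  qed
  have ptrace_e1: "ptrace e1 = of_real (1 / index) \<odot> \<one>"
    using ptrace_rank_one[of "\<one>" "\<one>"] by (simp add: emb_one)
  \<comment> \<open>Self-adjointness of \<open>p\<close>, tested on \<open>e\<^sub>1\<close>; since \<open>p\<close> is idempotent, it reads \<open>\<langle>p e\<^sub>1, p e\<^sub>1\<rangle> = \<langle>e\<^sub>1, p e\<^sub>1\<rangle>\<close>.\<close>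
  have "dual (star M (p e1) \<cdot> p e1) = dual (star M e1 \<cdot> p (p e1))"
    by (rule p_self) simp_all
  then have "dual (star M (p e1) \<cdot> p e1) = dual (star M e1 \<cdot> p e1)"
    by (simp only: p_idem[OF e1_maps])
  then have "dual ((cnj s * s) \<odot>\<^bsub>M\<^esub> e) = dual ((s * cnj \<alpha>) \<odot>\<^bsub>M\<^esub> e1)"
    unfolding p_e1
    by (simp add: M.star_smult e_star e1_star e_idem e1e M.smult_mult_left M.smult_mult_right mult.commute del: dual_apply)
  then have "ptrace ((cnj s * s) \<odot>\<^bsub>M\<^esub> e) = ptrace ((s * cnj \<alpha>) \<odot>\<^bsub>M\<^esub> e1)"
    by (intro emb_inj) simp_all
  then have "(cnj s * s * c) \<odot> \<one> = (s * cnj \<alpha> * complex_of_real (1 / index)) \<odot> \<one>"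
    by (simp add: ptrace_smult ptrace_e1 c)
  then have "cnj s * s * c = s * cnj \<alpha> * complex_of_real (1 / index)" by (rule scalar_inj)
  then have "s * (cnj s * c) = s * (cnj \<alpha> / complex_of_real index)" by (simp add: mult_ac)
  then have eq: "cnj s * c = cnj \<alpha> / complex_of_real index" by (rule mult_left_cancel[OF s_nonzero, THEN iffD1])
  then have "\<alpha> \<noteq> 0" using \<open>c \<noteq> 0\<close> s_nonzero index(2) by auto
  moreover have "\<alpha> * \<alpha> = \<alpha>"
  proof -
    have "(e \<cdot> e) \<one> = e \<one>" by (simp add: e_idem)
    then have "(\<alpha> * \<alpha>) \<odot> \<one> = \<alpha> \<odot> \<one>" by (simp add: M_apply \<alpha> maps_smult)
    then show ?thesis by (rule scalar_inj)
  qed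
  ultimately have \<alpha>1: "\<alpha> = 1" by simp
  then show "e \<one> = \<one>" using \<alpha> by simp
  have "cnj s = complex_of_real (1 / (index * r))"
    using eq \<alpha>1 rp index(2) by (simp add: r(1) field_simps)
  then have s: "s = complex_of_real (1 / (index * r))" by (metis complex_cnj_cnj complex_cnj_complex_of_real)
  then have Re: "Re s = 1 / (index * r)" by simp
  show "s = complex_of_real (Re s)" using s Re by simp
  show "0 < Re s" using Re rp index(2) by simp
  have "e_trace = r" unfolding e_trace_def Re using rp index(2) by simp
  then show "ptrace e = complex_of_real e_trace \<odot> \<one>" using c r by simp
qed

lemma cnj_s [simp]: "cnj s = s"
proof -
  have "cnj (complex_of_real (Re s)) = complex_of_real (Re s)" by simp
  then show ?thesis by (simp only: scalars(2)[symmetric])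
qed

lemma e_e1: "e \<cdot> e1 = e1"
  unfolding maps_e1[OF e_maps] scalars(1) by (simp add: emb_one)

lemma e1_e: "e1 \<cdot> e = e1"
  using arg_cong[OF e_e1, of "star M"] by (simp add: M.star_mult e_star e1_star)

text \<open>
  \<open>p(1)\<close> commutes with \<open>A\<close>, so it is scalar, and its partial trace is \<open>s tr(e) / \<tau> = 1\<close>.
\<close>

lemma p_one: "p \<one>\<^bsub>M\<^esub> = \<one>\<^bsub>M\<^esub>"
proof -
  have comm: "emb a \<cdot> p \<one>\<^bsub>M\<^esub> = p \<one>\<^bsub>M\<^esub> \<cdot> emb a" if a: "a \<in> carrier A" for a
    using p_left_emb[OF a, of "\<one>\<^bsub>M\<^esub>"] D.maps_right[OF p_module_map, of "\<one>\<^bsub>M\<^esub>" "emb a"] a by simp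
  obtain c where c: "p \<one>\<^bsub>M\<^esub> = c \<odot>\<^bsub>M\<^esub> \<one>\<^bsub>M\<^esub>"
  proof (rule D.commutant_scalar[of "p \<one>\<^bsub>M\<^esub>"])
    show "p \<one>\<^bsub>M\<^esub> \<cdot> T = T \<cdot> p \<one>\<^bsub>M\<^esub>" if "T \<in> emb ` carrier A" for T
      using that comm by fastforce
  qed (simp_all add: that)
  have "ptrace (p \<one>\<^bsub>M\<^esub>) = s \<odot> (\<Oplus>l\<in>L. ptrace (emb l \<cdot> e \<cdot> emb (star A l)))"
  proof -
    have "p \<one>\<^bsub>M\<^esub> = s \<odot>\<^bsub>M\<^esub> (\<Oplus>\<^bsub>M\<^esub>l\<in>L. emb l \<cdot> e \<cdot> emb (star A l))"
      unfolding p_expand[OF M_maps(2)]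
      by (rule arg_cong[where f = "\<lambda>T. s \<odot>\<^bsub>M\<^esub> T"], rule M.finsum_cong') (auto simp: M_apply)
    then show ?thesis by (simp add: ptrace_smult ptrace_finsum)
  qed
  also have "(\<Oplus>l\<in>L. ptrace (emb l \<cdot> e \<cdot> emb (star A l)))
      = (\<Oplus>l\<in>L. complex_of_real e_trace \<odot> (l \<otimes> star A l))"
    by (rule finsum_cong') (auto simp: ptrace_left ptrace_right scalars(4) smult_mult_left smult_mult_right)
  also have "\<dots> = complex_of_real e_trace \<odot> (\<Oplus>l\<in>L. l \<otimes> star A l)" by (rule smult_finsum[symmetric]) auto
  finally have "ptrace (p \<one>\<^bsub>M\<^esub>) = (s * complex_of_real e_trace * complex_of_real index) \<odot> \<one>"
    by (simp add: index(1) mult.assoc)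
  also have "s * complex_of_real e_trace * complex_of_real index = 1"
    using scalars(3) index(2) by (subst scalars(2)) (simp add: e_trace_def flip: of_real_mult)
  finally have "c \<odot> \<one> = 1 \<odot> \<one>" unfolding c by (simp add: ptrace_smult ptrace_one)
  then have "c = 1" by (rule scalar_inj)
  then show ?thesis using c by simp
qed

lemma p_e: "p e = e"
proof -
  have "p (p e1) = p e1" by (rule p_idem) simp
  then have "s \<odot>\<^bsub>M\<^esub> p e = s \<odot>\<^bsub>M\<^esub> e" by (simp add: p_e1 p_smult)
  then show ?thesis using M.smult_cancel[of "p e" e s] s_nonzero by simp
qed

subsection \<open>The exchange relation\<close>

text \<open>
  Self-adjointness of \<open>p\<close> for \<open>e\<^sub>1\<close> and \<open>z e\<^sub>1\<close> compares \<open>E\<^sub>1(e z e\<^sub>1) = \<tau> e(z)\<close> with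
  \<open>E\<^sub>1(e\<^sub>1 z e) = \<tau> e(z\<^sup>*)\<^sup>*\<close>.
\<close>

lemma e_involution: assumes z: "z \<in> carrier A" shows "e (star A z) = star A (e z)"
proof -
  have "dual (star M (p e1) \<cdot> (emb z \<cdot> e1)) = dual (star M e1 \<cdot> p (emb z \<cdot> e1))"
    using z by (intro p_self) simp_all
  moreover have "star M (p e1) = s \<odot>\<^bsub>M\<^esub> e"
    unfolding p_e1 by (simp add: M.star_smult e_star)
  moreover have "p (emb z \<cdot> e1) = s \<odot>\<^bsub>M\<^esub> (emb z \<cdot> e)" using z by (simp add: p_left_emb p_e1 M.smult_mult_right)
  ultimately have "dual (s \<odot>\<^bsub>M\<^esub> (e \<cdot> emb z \<cdot> e1)) = dual (s \<odot>\<^bsub>M\<^esub> (e1 \<cdot> emb z \<cdot> e))"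
    using z by (simp add: e1_star M.smult_mult_left M.smult_mult_right M.m_assoc del: dual_apply)
  then have "ptrace (s \<odot>\<^bsub>M\<^esub> (e \<cdot> emb z \<cdot> e1)) = ptrace (s \<odot>\<^bsub>M\<^esub> (e1 \<cdot> emb z \<cdot> e))"
    using z by (intro emb_inj) simp_all
  then have eq: "ptrace (e \<cdot> emb z \<cdot> e1) = ptrace (e1 \<cdot> emb z \<cdot> e)"
    using z s_nonzero smult_cancel[of _ _ s] by (simp add: ptrace_smult)
  have 1: "ptrace (e \<cdot> emb z \<cdot> e1) = of_real (1 / index) \<odot> e z"
    using ptrace_rank_one[of "e z" "\<one>"] z by (simp add: maps_emb_e1 emb_one)
  have "e1 \<cdot> emb z \<cdot> e = star M (e \<cdot> emb (star A z) \<cdot> e1)"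
    using z by (simp add: M.star_mult e1_star e_star emb_star M.m_assoc)
  also have "\<dots> = e1 \<cdot> emb (star A (e (star A z)))"
    using z by (simp add: maps_emb_e1 M.star_mult e1_star emb_star)
  finally have 2: "ptrace (e1 \<cdot> emb z \<cdot> e) = of_real (1 / index) \<odot> star A (e (star A z))"
    using ptrace_rank_one[of "\<one>" "star A (e (star A z))"] z by (simp add: emb_one)
  have "e z = star A (e (star A z))"
    using eq z index(2) unfolding 1 2 by (intro smult_cancel[of "e z" _ "complex_of_real (1 / index)"]) auto
  then have "star A (e z) = star A (star A (e (star A z)))" by simp
  then show ?thesis using z by simp
qed

lemma adj_e: "adj e = e"
  using e_star by (simp add: M_star)

text \<open>
  Expanding \<open>e = e e\<close> in the quasi-basis gives \<open>e = \<Sum> e(l) e\<^sub>1 e(l)\<^sup>*\<close>, and applying \<open>p\<close> gives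
  \<open>e = s \<Sum> e(l) e e(l)\<^sup>*\<close>. Compressed with \<open>q = 1 - e\<close> this is a vanishing sum of elements \<open>v v\<^sup>*\<close> with
  \<open>v = q e(l) e\<close>, so each \<open>v\<close> is zero.
\<close>

lemma e_absorbs_basis:
  assumes l: "l \<in> L" shows "emb (e l) \<cdot> e = e \<cdot> (emb (e l) \<cdot> e)"
proof -
  let ?u = "\<lambda>l. emb (e l)"
  let ?w = "\<lambda>l. ?u l \<cdot> e \<cdot> star M (?u l)"
  let ?q = "\<one>\<^bsub>M\<^esub> \<ominus>\<^bsub>M\<^esub> e"
  let ?v = "\<lambda>l. ?q \<cdot> (?u l \<cdot> e)"
  have "e = e \<cdot> (\<Oplus>\<^bsub>M\<^esub>l\<in>L. emb l \<cdot> e1 \<cdot> emb (star A (adj e l)))"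
    using M_expand_left[OF e_maps] e_idem by simp
  also have "\<dots> = (\<Oplus>\<^bsub>M\<^esub>l\<in>L. e \<cdot> (emb l \<cdot> e1 \<cdot> emb (star A (adj e l))))"
    by (rule M.mult_finsum_right) auto
  also have "\<dots> = (\<Oplus>\<^bsub>M\<^esub>l\<in>L. ?u l \<cdot> e1 \<cdot> star M (?u l))"
    by (rule M.finsum_cong') (auto simp: maps_emb_e1[symmetric] M.m_assoc adj_e emb_star)
  finally have "e = (\<Oplus>\<^bsub>M\<^esub>l\<in>L. ?u l \<cdot> e1 \<cdot> star M (?u l))" .
  then have "p e = p (\<Oplus>\<^bsub>M\<^esub>l\<in>L. ?u l \<cdot> e1 \<cdot> star M (?u l))" by simp
  also have "\<dots> = (\<Oplus>\<^bsub>M\<^esub>l\<in>L. p (?u l \<cdot> e1 \<cdot> star M (?u l)))"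
    by (rule p_finsum) (auto simp: emb_star)
  also have "\<dots> = (\<Oplus>\<^bsub>M\<^esub>l\<in>L. s \<odot>\<^bsub>M\<^esub> ?w l)"
    by (rule M.finsum_cong') (auto simp: emb_star p_rank_one)
  also have "\<dots> = s \<odot>\<^bsub>M\<^esub> (\<Oplus>\<^bsub>M\<^esub>l\<in>L. ?w l)" by (rule M.smult_finsum[symmetric]) (auto simp: emb_star)
  finally have e_sum: "e = s \<odot>\<^bsub>M\<^esub> (\<Oplus>\<^bsub>M\<^esub>l\<in>L. ?w l)" by (simp add: p_e)
  have qe: "?q \<cdot> e = \<zero>\<^bsub>M\<^esub>" by (simp add: M.minus_distrib_left e_idem M.minus_self)
  have q: "star M ?q = ?q" by (simp add: M.star_diff e_star)
  have vv: "?q \<cdot> (?w l \<cdot> ?q) = ?v l \<cdot> star M (?v l)" if l: "l \<in> L" for l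
  proof -
    have "star M (?v l) = e \<cdot> star M (?u l) \<cdot> ?q" using l by (simp add: M.star_mult q e_star emb_star)
    then have "?v l \<cdot> star M (?v l) = ?q \<cdot> (?u l \<cdot> (e \<cdot> e) \<cdot> star M (?u l) \<cdot> ?q)"
      using l by (simp add: M.m_assoc emb_star)
    then show ?thesis using l by (simp add: e_idem)
  qed
  have "\<zero>\<^bsub>M\<^esub> = ?q \<cdot> e \<cdot> ?q" by (simp add: qe)
  also have "\<dots> = ?q \<cdot> (s \<odot>\<^bsub>M\<^esub> (\<Oplus>\<^bsub>M\<^esub>l\<in>L. ?w l)) \<cdot> ?q" using e_sum by simp
  also have "\<dots> = s \<odot>\<^bsub>M\<^esub> (?q \<cdot> ((\<Oplus>\<^bsub>M\<^esub>l\<in>L. ?w l) \<cdot> ?q))"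
    by (simp add: M.smult_mult_left M.smult_mult_right M.m_assoc emb_star)
  also have "(\<Oplus>\<^bsub>M\<^esub>l\<in>L. ?w l) \<cdot> ?q = (\<Oplus>\<^bsub>M\<^esub>l\<in>L. ?w l \<cdot> ?q)"
    by (rule M.mult_finsum_left) (auto simp: emb_star)
  also have "?q \<cdot> \<dots> = (\<Oplus>\<^bsub>M\<^esub>l\<in>L. ?q \<cdot> (?w l \<cdot> ?q))"
    by (rule M.mult_finsum_right) (auto simp: emb_star)
  also have "\<dots> = (\<Oplus>\<^bsub>M\<^esub>l\<in>L. ?v l \<cdot> star M (?v l))"
    by (rule M.finsum_cong'[OF refl _ vv]) (auto simp: M_star)
  finally have "s \<odot>\<^bsub>M\<^esub> (\<Oplus>\<^bsub>M\<^esub>l\<in>L. ?v l \<cdot> star M (?v l)) = \<zero>\<^bsub>M\<^esub>" by simp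
  then have sum0: "(\<Oplus>\<^bsub>M\<^esub>l\<in>L. ?v l \<cdot> star M (?v l)) = \<zero>\<^bsub>M\<^esub>"
    using M.smult_eq_zero[of "\<Oplus>\<^bsub>M\<^esub>l\<in>L. ?v l \<cdot> star M (?v l)" s] s_nonzero by (simp add: M_star)
  have vm: "?v l \<in> carrier M" if "l \<in> L" for l using that by simp
  have pos: "M.pos (?v l \<cdot> star M (?v l))" if "l \<in> L" for l
    using M.pos_star_mult[OF M.star_closed[OF vm[OF that]]] M.star_star[OF vm[OF that]] by simp
  have "?v l \<cdot> star M (?v l) = \<zero>\<^bsub>M\<^esub>"
    by (rule M.finsum_pos_zero[OF finite_L pos sum0 l])
  then have "star M (?v l) = \<zero>\<^bsub>M\<^esub>"
    using M.star_mult_zero[OF M.star_closed[OF vm[OF l]]] M.star_star[OF vm[OF l]] by simp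
  then have "?v l = \<zero>\<^bsub>M\<^esub>" using M.star_star[OF vm[OF l]] M.star_zero by metis
  then have "?u l \<cdot> e \<ominus>\<^bsub>M\<^esub> e \<cdot> (?u l \<cdot> e) = \<zero>\<^bsub>M\<^esub>"
    using l by (simp add: M.minus_distrib_left)
  then show ?thesis using l by (simp add: M.minus_eq_zero_iff)
qed

text \<open>
  \<open>e(a) = \<Sum> e(l) E(l\<^sup>* a)\<close>, the coefficients commute with \<open>e\<close>, and the range of \<open>e\<close> absorbs each \<open>e(l)\<close>.
\<close>

lemma e_range_mult:
  assumes a: "a \<in> carrier A" and x: "x \<in> carrier A" shows "e (e a \<otimes> e x) = e a \<otimes> e x"
proof -
  have eB: "e (b \<otimes> y) = b \<otimes> e y" if "b \<in> B" "y \<in> carrier A" for b y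
    using fun_cong[OF e_emb_B[OF that(1)], of y] that by (simp add: M_apply emb_apply)
  have basis: "e (e l \<otimes> e y) = e l \<otimes> e y" if "l \<in> L" "y \<in> carrier A" for l y
    using fun_cong[OF e_absorbs_basis[OF that(1)], of y] that by (simp add: M_apply emb_apply)
  have "e a \<otimes> e x = (\<Oplus>l\<in>L. e l \<otimes> E (star A l \<otimes> a)) \<otimes> e x" using maps_expand[OF e_maps a] by simp
  also have "\<dots> = (\<Oplus>l\<in>L. e l \<otimes> E (star A l \<otimes> a) \<otimes> e x)" using a x by (intro mult_finsum_left) auto
  also have "\<dots> = (\<Oplus>l\<in>L. e l \<otimes> e (E (star A l \<otimes> a) \<otimes> x))"
    using a x by (intro finsum_cong') (auto simp: eB m_assoc)
  finally have eq: "e a \<otimes> e x = (\<Oplus>l\<in>L. e l \<otimes> e (E (star A l \<otimes> a) \<otimes> x))" .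
  have "e (e a \<otimes> e x) = (\<Oplus>l\<in>L. e (e l \<otimes> e (E (star A l \<otimes> a) \<otimes> x)))"
    unfolding eq using a x by (intro maps_finsum) auto
  also have "\<dots> = (\<Oplus>l\<in>L. e l \<otimes> e (E (star A l \<otimes> a) \<otimes> x))"
    using a x by (intro finsum_cong') (auto simp: basis)
  finally show ?thesis using eq by simp
qed

text \<open>
  The range of \<open>e\<close> is closed under the involution, so that adjoints of the relation \<open>e u e = u e\<close> for
  \<open>u = e(a\<^sup>*)\<close> give \<open>e u e = e u\<close> for \<open>u = e(a)\<close>.
\<close>

lemma e_left_range:
  assumes a: "a \<in> carrier A" and x: "x \<in> carrier A" shows "e (e a \<otimes> x) = e a \<otimes> e x"
proof -
  have abs: "e \<cdot> (emb (e c) \<cdot> e) = emb (e c) \<cdot> e" if c: "c \<in> carrier A" for c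
    using c by (intro maps_ext) (auto simp: M_apply emb_apply e_range_mult)
  have "star M (e \<cdot> (emb (e (star A a)) \<cdot> e)) = star M (emb (e (star A a)) \<cdot> e)"
    using abs[of "star A a"] a by simp
  then have "e \<cdot> emb (e a) \<cdot> e = e \<cdot> emb (e a)"
    using a by (simp add: M.star_mult e_star emb_star e_involution)
  then have "e \<cdot> emb (e a) = emb (e a) \<cdot> e" using abs[OF a] a by (simp add: M.m_assoc)
  from fun_cong[OF this, of x] show ?thesis using a x by (simp add: M_apply emb_apply)
qed

lemma e_right_range:
  assumes a: "a \<in> carrier A" and x: "x \<in> carrier A" shows "e (x \<otimes> e a) = e x \<otimes> e a"
proof -
  have "e (x \<otimes> e a) = star A (e (star A (x \<otimes> e a)))"
    using a x by (simp add: e_involution del: star_mult)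
  also have "star A (x \<otimes> e a) = e (star A a) \<otimes> star A x" using a x by (simp add: star_mult e_involution)
  also have "e \<dots> = star A (e a) \<otimes> star A (e x)" using e_left_range[of "star A a" "star A x"] a x by (simp add: e_involution)
  also have "star A \<dots> = e x \<otimes> e a" using a x by (simp add: star_mult)
  finally show ?thesis .
qed

lemma exchange: "a \<in> carrier A \<Longrightarrow> e \<cdot> emb a \<cdot> e = emb (e a) \<cdot> e"
  by (rule maps_ext) (auto simp: M_apply emb_apply e_right_range)

text \<open>
  By the exchange relation both sides send \<open>a e\<^sub>1 b\<close> to \<open>s e a e b = s e(a) e b\<close>.
\<close>

lemma p_left_e: assumes T: "T \<in> maps" shows "p (e \<cdot> T) = e \<cdot> p T"
proof -
  have "(\<Oplus>\<^bsub>M\<^esub>l\<in>L. emb ((e \<cdot> T) l) \<cdot> e \<cdot> emb (star A l))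
      = (\<Oplus>\<^bsub>M\<^esub>l\<in>L. e \<cdot> (emb (T l) \<cdot> e \<cdot> emb (star A l)))"
    using T by (intro M.finsum_cong') (auto simp: M_apply exchange[symmetric] M.m_assoc)
  also have "\<dots> = e \<cdot> (\<Oplus>\<^bsub>M\<^esub>l\<in>L. emb (T l) \<cdot> e \<cdot> emb (star A l))"
    using T by (intro M.mult_finsum_right[symmetric]) auto
  finally show ?thesis using T by (simp add: p_expand M.smult_mult_right)
qed

subsection \<open>The intermediate subalgebra\<close>

text \<open>
  The elements of \<open>A\<^sub>1\<close> whose left multiplication commutes with \<open>p\<close> in \<open>A\<^sub>2\<close>, evaluated on \<open>A\<^sub>1\<close> so that no
  product in \<open>A\<^sub>2\<close> occurs; \<open>P_commutant\<close> gives the formulation in \<open>A\<^sub>2\<close>.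
\<close>

definition P :: "('a \<Rightarrow> 'a) set" where
  "P = {T \<in> maps. \<forall>S\<in>maps. p (T \<cdot> S) = T \<cdot> p S}"

lemma P_maps: "T \<in> P \<Longrightarrow> T \<in> maps"
  by (simp add: P_def)

lemma P_module: "\<lbrakk>T \<in> P; S \<in> maps\<rbrakk> \<Longrightarrow> p (T \<cdot> S) = T \<cdot> p S"
  by (simp add: P_def)

lemma P_I: "\<lbrakk>T \<in> maps; \<And>S. S \<in> maps \<Longrightarrow> p (T \<cdot> S) = T \<cdot> p S\<rbrakk> \<Longrightarrow> T \<in> P"
  by (simp add: P_def)

lemma emb_P: "a \<in> carrier A \<Longrightarrow> emb a \<in> P"
  by (rule P_I) (simp_all add: p_left_emb)

lemma e_P: "e \<in> P"
  by (rule P_I) (simp_all add: p_left_e)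

lemma P_mult: "\<lbrakk>S \<in> P; T \<in> P\<rbrakk> \<Longrightarrow> S \<cdot> T \<in> P"
  by (rule P_I) (simp_all add: M.m_assoc P_module P_maps)

lemma P_add: "\<lbrakk>S \<in> P; T \<in> P\<rbrakk> \<Longrightarrow> S \<oplus>\<^bsub>M\<^esub> T \<in> P"
  by (rule P_I) (simp_all add: M.l_distr p_add P_module P_maps)

lemma P_smult: "T \<in> P \<Longrightarrow> c \<odot>\<^bsub>M\<^esub> T \<in> P"
  by (rule P_I) (simp_all add: M.smult_mult_left p_smult P_module P_maps)

lemma P_finsum: "\<lbrakk>finite I; \<And>i. i \<in> I \<Longrightarrow> g i \<in> P\<rbrakk> \<Longrightarrow> (\<Oplus>\<^bsub>M\<^esub>i\<in>I. g i) \<in> P"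
proof (induction I rule: finite_induct)
  case empty
  have "\<zero>\<^bsub>M\<^esub> \<in> P" using P_smult[OF e_P, of 0] by simp
  then show ?case by simp
next
  case (insert i I)
  then have "g i \<in> carrier M" "g \<in> I \<rightarrow> carrier M" using P_maps by auto
  with insert show ?case by (simp add: P_add)
qed

lemma p_P: assumes T: "T \<in> maps" shows "p T \<in> P"
  unfolding p_expand[OF T] by (intro P_smult P_finsum P_mult emb_P e_P) (use T in auto)

text \<open>
  \<open>p(T) = p(T 1) = T p(1) = T\<close> on \<open>P\<close>, while the range of \<open>p\<close> is spanned by products of elements of \<open>A\<close>
  and \<open>e\<close>, all in \<open>P\<close>.
\<close>

lemma P_iff: "T \<in> P \<longleftrightarrow> T \<in> maps \<and> p T = T"
proof
  assume T: "T \<in> P"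
  then show "T \<in> maps \<and> p T = T" using P_module[OF T, of "\<one>\<^bsub>M\<^esub>"] P_maps[OF T] by (simp add: p_one)
next
  assume "T \<in> maps \<and> p T = T"
  then show "T \<in> P" using p_P[of T] by simp
qed

lemma p_star: assumes T: "T \<in> maps" shows "p (star M T) = star M (p T)"
proof -
  have "star M T = star M (\<Oplus>\<^bsub>M\<^esub>l\<in>L. emb (T l) \<cdot> e1 \<cdot> emb (star A l))" using M_expand[OF T] by simp
  also have "\<dots> = (\<Oplus>\<^bsub>M\<^esub>l\<in>L. star M (emb (T l) \<cdot> e1 \<cdot> emb (star A l)))"
    using T by (intro M.star_finsum) auto
  also have "\<dots> = (\<Oplus>\<^bsub>M\<^esub>l\<in>L. emb l \<cdot> e1 \<cdot> emb (star A (T l)))"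
    using T by (intro M.finsum_cong') (auto simp: M.star_mult emb_star e1_star M.m_assoc)
  finally have "p (star M T) = p (\<Oplus>\<^bsub>M\<^esub>l\<in>L. emb l \<cdot> e1 \<cdot> emb (star A (T l)))" by simp
  also have "\<dots> = (\<Oplus>\<^bsub>M\<^esub>l\<in>L. p (emb l \<cdot> e1 \<cdot> emb (star A (T l))))"
    using T by (intro p_finsum) auto
  also have "\<dots> = (\<Oplus>\<^bsub>M\<^esub>l\<in>L. star M (s \<odot>\<^bsub>M\<^esub> (emb (T l) \<cdot> e \<cdot> emb (star A l))))"
  proof (rule M.finsum_cong'[OF refl])
    fix l assume l: "l \<in> L"
    show "p (emb l \<cdot> e1 \<cdot> emb (star A (T l)))
        = star M (s \<odot>\<^bsub>M\<^esub> (emb (T l) \<cdot> e \<cdot> emb (star A l)))"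
      using l T by (subst p_rank_one) (simp_all add: M.star_smult M.star_mult emb_star e_star M.m_assoc)
  qed (use T in \<open>auto simp: M_star\<close>)
  also have "\<dots> = star M (\<Oplus>\<^bsub>M\<^esub>l\<in>L. s \<odot>\<^bsub>M\<^esub> (emb (T l) \<cdot> e \<cdot> emb (star A l)))"
    using T by (intro M.star_finsum[symmetric]) auto
  also have "(\<Oplus>\<^bsub>M\<^esub>l\<in>L. s \<odot>\<^bsub>M\<^esub> (emb (T l) \<cdot> e \<cdot> emb (star A l))) = p T"
    unfolding p_expand[OF T] using T by (intro M.smult_finsum[symmetric]) auto
  finally show ?thesis .
qed

lemma P_star: "T \<in> P \<Longrightarrow> star M T \<in> P"
  using p_star[of T] by (simp add: P_iff M_star)

text \<open>
  Closedness is read off from the description of \<open>P\<close> as the fixed points of the continuous map \<open>p\<close>, the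
  algebraic properties from its description as a commutant.
\<close>

lemma P_subalgebra: "cstar_subalgebra P M"
  unfolding cstar_subalgebra_def
proof (intro conjI allI ballI)
  show "subring P M"
  proof (rule M.subringI)
    show "\<ominus>\<^bsub>M\<^esub> T \<in> P" if "T \<in> P" for T using P_smult[OF that, of "-1"] P_maps[OF that] by (simp add: M.minus_eq_smult)
    show "\<one>\<^bsub>M\<^esub> \<in> P" by (simp add: P_iff p_one)
  qed (auto simp: P_mult P_add P_maps)
  show "norm_closed M P"
    unfolding M.norm_closed_iff
  proof (intro conjI allI impI)
    fix \<sigma> T assume *: "range \<sigma> \<subseteq> P \<and> M.tends \<sigma> T"
    then have t: "M.tends \<sigma> T" by simp
    have "(\<lambda>n. p (\<sigma> n)) = \<sigma>" using * by (auto simp: P_iff subset_eq)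
    then have "M.tends \<sigma> (p T)" using D.maps_tends[OF p_module_map t] by simp
    then have "p T = T" using M.tends_unique t by blast
    then show "T \<in> P" using M.tendsD(2)[OF t] by (simp add: P_iff)
  qed (auto simp: P_maps)
qed (auto simp: P_smult P_star)

lemma P_span: "P = complex_span M {emb a \<cdot> e \<cdot> emb b | a b. a \<in> carrier A \<and> b \<in> carrier A}"
  (is "P = complex_span M ?S")
proof (intro equalityI subsetI)
  have S: "?S \<subseteq> carrier M" by auto
  fix T assume TP: "T \<in> P"
  then have T: "T \<in> maps" by (rule P_maps)
  from TP have "T = (\<Oplus>\<^bsub>M\<^esub>l\<in>L. s \<odot>\<^bsub>M\<^esub> (emb (T l) \<cdot> e \<cdot> emb (star A l)))"
    using p_expand[of T] by (subst M.smult_finsum[symmetric]) (auto simp: P_iff)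
  also have "\<dots> = (\<Oplus>\<^bsub>M\<^esub>l\<in>L. emb (s \<odot> T l) \<cdot> e \<cdot> emb (star A l))"
    using T by (intro M.finsum_cong') (auto simp: emb_smult M.smult_mult_left)
  also have "\<dots> \<in> complex_span M ?S"
  proof (rule M.complex_span_finsum[OF S finite_L])
    fix l assume "l \<in> L"
    then show "emb (s \<odot> T l) \<cdot> e \<cdot> emb (star A l) \<in> ?S"
      using T by (intro CollectI exI[of _ "s \<odot> T l"] exI[of _ "star A l"]) auto
  qed
  finally show "T \<in> complex_span M ?S" .
next
  fix T assume "T \<in> complex_span M ?S"
  then obtain V c where V: "finite V" "V \<subseteq> ?S" "T = (\<Oplus>\<^bsub>M\<^esub>v\<in>V. c v \<odot>\<^bsub>M\<^esub> v)"
    unfolding complex_span_def by blast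
  have "v \<in> P" if "v \<in> V" for v using V(2) that by (auto intro!: P_mult emb_P e_P)
  then show "T \<in> P" unfolding V(3) using V(1) by (intro P_finsum P_smult) auto
qed

text \<open>
  As for \<open>ptrace_star_mult\<close>: \<open>T\<^sup>* T\<close> is a sum of \<open>v\<^sup>* e\<^sub>1 v\<close>, which \<open>p\<close> maps to a sum of \<open>s v\<^sup>* e v\<close>.
\<close>

lemma p_pos: assumes T: "T \<in> maps" shows "M.pos (p (star M T \<cdot> T))"
proof -
  let ?v = "\<lambda>l. emb (star A (adj T l))"
  have "star M T \<cdot> T = adj T \<cdot> (\<Oplus>\<^bsub>M\<^esub>l\<in>L. emb l \<cdot> e1 \<cdot> ?v l)"
    using M_expand_left[OF T] M_star[OF T] by simp
  also have "\<dots> = (\<Oplus>\<^bsub>M\<^esub>l\<in>L. adj T \<cdot> (emb l \<cdot> e1 \<cdot> ?v l))"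
    using T by (intro M.mult_finsum_right) auto
  also have "\<dots> = (\<Oplus>\<^bsub>M\<^esub>l\<in>L. emb (adj T l) \<cdot> e1 \<cdot> ?v l)"
    using T by (intro M.finsum_cong') (auto simp: maps_emb_e1[symmetric] M.m_assoc)
  finally have "p (star M T \<cdot> T) = (\<Oplus>\<^bsub>M\<^esub>l\<in>L. p (emb (adj T l) \<cdot> e1 \<cdot> ?v l))"
    using T by (simp add: p_finsum)
  also have "\<dots> = (\<Oplus>\<^bsub>M\<^esub>l\<in>L. of_real (Re s) \<odot>\<^bsub>M\<^esub> (star M (e \<cdot> ?v l) \<cdot> (e \<cdot> ?v l)))"
  proof (rule M.finsum_cong'[OF refl])
    fix l assume l: "l \<in> L"
    have "star M (e \<cdot> ?v l) \<cdot> (e \<cdot> ?v l) = emb (adj T l) \<cdot> (e \<cdot> e) \<cdot> ?v l"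
      using l T by (simp add: M.star_mult e_star emb_star M.m_assoc)
    then show "p (emb (adj T l) \<cdot> e1 \<cdot> ?v l)
        = of_real (Re s) \<odot>\<^bsub>M\<^esub> (star M (e \<cdot> ?v l) \<cdot> (e \<cdot> ?v l))"
      using l T by (simp add: p_rank_one e_idem flip: scalars(2))
  qed (use T in \<open>auto simp: M_star\<close>)
  finally show ?thesis
    using T scalars(3) by (simp only:) (intro M.pos_finsum M.pos_smult M.pos_star_mult, auto)
qed

lemma P_expectation: "conditional_expectation M P p"
proof (rule M.conditional_expectationI[OF P_subalgebra])
  show "p \<in> carrier M \<rightarrow>\<^sub>E P" using p_module_map p_P by (auto simp: D.maps_def)
  show "p (T \<cdot> S) = p T \<cdot> S" if "T \<in> carrier M" and S: "S \<in> P" for T S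
  proof -
    have T: "T \<in> maps" using that by simp
    note Sm = P_maps[OF S]
    have "p (star M (star M S \<cdot> star M T)) = star M (p (star M S \<cdot> star M T))"
      using Sm T by (intro p_star) (simp add: M_star)
    also have "\<dots> = star M (star M S \<cdot> star M (p T))"
      using P_module[OF P_star[OF S], of "star M T"] T by (simp add: p_star M_star[OF T] flip: p_star[OF T])
    finally show ?thesis
      using Sm T M.star_mult[of "star M S" "star M T"] M.star_mult[of "star M S" "star M (p T)"]
        M.star_closed[of S] M.star_closed[of T] M.star_closed[of "p T"] by (simp add: M.star_star)
  qed
qed (simp_all add: p_add p_smult P_module p_pos P_iff)

definition N :: "('a \<Rightarrow> 'a) set" where
  "N = jones_basis (complex_of_real (sqrt (1 / Re s)))"

text \<open>
  \<open>p\<close> maps \<open>e\<^sub>1 v\<close> to \<open>s e v\<close>, and \<open>e\<^sub>1 e = e\<^sub>1\<close> turns this back into \<open>e\<^sub>1 v\<close> after multiplication with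
  \<open>l e\<^sub>1\<close>; the factor \<open>s\<^sup>-\<^sup>1\<close> comes from the scaling of the basis.
\<close>

lemma P_quasi_basis: "quasi_basis M p N"
proof -
  interpret Q: cond_exp M P p by unfold_locales (rule P_expectation)
  let ?r = "complex_of_real (sqrt (1 / Re s))"
  have rs: "?r * ?r * s = 1" and r0: "?r \<noteq> 0"
  proof -
    have "?r * ?r = complex_of_real (1 / Re s)" using scalars(3) by (simp flip: of_real_mult)
    moreover have "complex_of_real (1 / Re s) * complex_of_real (Re s) = 1" using scalars(3) by (simp flip: of_real_mult)
    ultimately show "?r * ?r * s = 1" by (simp only: scalars(2)[symmetric])
    show "?r \<noteq> 0" using scalars(3) by simp
  qed
  show ?thesis
  proof (rule Q.quasi_basisI)
    show "finite N" "N \<subseteq> carrier M" unfolding N_def by (rule jones_basis_finite)+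
    fix T assume "T \<in> carrier M"
    then have T: "T \<in> maps" by simp
    have "(\<Oplus>\<^bsub>M\<^esub>n\<in>N. n \<cdot> p (star M n \<cdot> T)) = (\<Oplus>\<^bsub>M\<^esub>l\<in>L. emb l \<cdot> e1 \<cdot> emb (star A (adj T l)))"
      unfolding N_def
    proof (rule jones_basis_finsum[OF r0])
      fix l assume l: "l \<in> L"
      let ?v = "emb (star A (adj T l))"
      have "p (e1 \<cdot> ?v) = s \<odot>\<^bsub>M\<^esub> (e \<cdot> ?v)"
        using p_rank_one[of "\<one>" "star A (adj T l)"] l T by (simp add: emb_one)
      then have "p (star M (?r \<odot>\<^bsub>M\<^esub> (emb l \<cdot> e1)) \<cdot> T) = (?r * s) \<odot>\<^bsub>M\<^esub> (e \<cdot> ?v)"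
        unfolding jones_basis_star[OF l] using l T by (simp add: M.smult_mult_left p_smult e1_emb_maps)
      then have "(?r \<odot>\<^bsub>M\<^esub> (emb l \<cdot> e1)) \<cdot> p (star M (?r \<odot>\<^bsub>M\<^esub> (emb l \<cdot> e1)) \<cdot> T)
          = (?r * ?r * s) \<odot>\<^bsub>M\<^esub> (emb l \<cdot> (e1 \<cdot> e) \<cdot> ?v)"
        using l T by (simp add: M.smult_mult_left M.smult_mult_right M.m_assoc mult_ac)
      then show "(?r \<odot>\<^bsub>M\<^esub> (emb l \<cdot> e1)) \<cdot> p (star M (?r \<odot>\<^bsub>M\<^esub> (emb l \<cdot> e1)) \<cdot> T)
          = emb l \<cdot> e1 \<cdot> ?v"
        unfolding rs e1_e using l T by simp
    qed (use T in auto)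
    then show "(\<Oplus>\<^bsub>M\<^esub>n\<in>N. n \<cdot> p (star M n \<cdot> T)) = T" using M_expand_left[OF T] by simp
  qed
qed

lemma P_irreducible: "relative_commutant P M = {c \<odot>\<^bsub>M\<^esub> \<one>\<^bsub>M\<^esub> | c. True}"
proof
  have "relative_commutant P M \<subseteq> relative_commutant (emb ` carrier A) M"
    using emb_P by (auto simp: relative_commutant_def)
  then show "relative_commutant P M \<subseteq> {c \<odot>\<^bsub>M\<^esub> \<one>\<^bsub>M\<^esub> | c. True}" using dual_irreducible by simp
  show "{c \<odot>\<^bsub>M\<^esub> \<one>\<^bsub>M\<^esub> | c. True} \<subseteq> relative_commutant P M"
    by (auto simp: relative_commutant_def M.smult_one_mult M.smult_mult_one P_maps)
qed

theorem P_inclusion: "inclusion M P p N"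
  by (intro inclusion.intro cond_exp.intro inclusion_axioms.intro cond_exp_axioms.intro M_cstar_algebra
      P_expectation P_quasi_basis P_irreducible M_nontrivial)

lemma P_index: "min_index M P = 1 / Re s"
  unfolding inclusion.min_index[OF P_inclusion]
proof (rule inclusion.index_eqI[OF P_inclusion])
  show "(\<Oplus>\<^bsub>M\<^esub>n\<in>N. n \<cdot> star M n) = of_real (1 / Re s) \<odot>\<^bsub>M\<^esub> \<one>\<^bsub>M\<^esub>"
    unfolding N_def using scalars(3) by (intro jones_basis_index) simp
qed

lemma p_jones: "jones_projection M P = p"
proof -
  have "p \<in> extensional (carrier M)" using p_module_map by (simp add: D.maps_def PiE_iff)
  then show ?thesis
    unfolding jones_projection_def inclusion.min_expectation[OF P_inclusion] by (simp add: extensional_restrict)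
qed

text \<open>
  \<open>E\<^sub>2(p)\<close> is computed in the quasi-basis of \<open>A\<^sub>1\<close> over \<open>A\<close>: up to scalars its terms are
  \<open>p(l e\<^sub>1) e\<^sub>1 l\<^sup>* = s l e e\<^sub>1 l\<^sup>* = s l e\<^sub>1 l\<^sup>*\<close>.
\<close>

lemma p_trace: "tower_trace A B p = s"
proof -
  have "D.ptrace p = of_real (1 / index) \<odot>\<^bsub>M\<^esub> (\<Oplus>\<^bsub>M\<^esub>n\<in>L1. p n \<cdot> star M n)"
    unfolding D.ptrace_def dual_index ..
  also have "(\<Oplus>\<^bsub>M\<^esub>n\<in>L1. p n \<cdot> star M n)
      = (\<Oplus>\<^bsub>M\<^esub>l\<in>L. (s * complex_of_real index) \<odot>\<^bsub>M\<^esub> (emb (\<one>\<^bsub>M\<^esub> l) \<cdot> e1 \<cdot> emb (star A l)))"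
    unfolding L1_def
  proof (rule jones_basis_finsum[OF sqrt_index(2)])
    fix l assume l: "l \<in> L"
    let ?r = "complex_of_real (sqrt index)"
    have "p (emb l \<cdot> e1) = s \<odot>\<^bsub>M\<^esub> (emb l \<cdot> e)" using l by (simp add: p_left_emb p_e1 M.smult_mult_right)
    then have "p (?r \<odot>\<^bsub>M\<^esub> (emb l \<cdot> e1)) \<cdot> star M (?r \<odot>\<^bsub>M\<^esub> (emb l \<cdot> e1))
        = (s * (?r * ?r)) \<odot>\<^bsub>M\<^esub> (emb l \<cdot> (e \<cdot> e1) \<cdot> emb (star A l))"
      unfolding jones_basis_star[OF l] using l
      by (simp add: p_smult M.smult_mult_left M.smult_mult_right M.m_assoc mult_ac)
    then show "p (?r \<odot>\<^bsub>M\<^esub> (emb l \<cdot> e1)) \<cdot> star M (?r \<odot>\<^bsub>M\<^esub> (emb l \<cdot> e1))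
        = (s * complex_of_real index) \<odot>\<^bsub>M\<^esub> (emb (\<one>\<^bsub>M\<^esub> l) \<cdot> e1 \<cdot> emb (star A l))"
      unfolding sqrt_index e_e1 using l by (simp add: M_apply)
  qed (auto simp: M_apply)
  also have "\<dots> = (s * complex_of_real index) \<odot>\<^bsub>M\<^esub>
      (\<Oplus>\<^bsub>M\<^esub>l\<in>L. emb (\<one>\<^bsub>M\<^esub> l) \<cdot> e1 \<cdot> emb (star A l))"
    by (rule M.smult_finsum[symmetric]) (auto simp: M_apply)
  also have "(\<Oplus>\<^bsub>M\<^esub>l\<in>L. emb (\<one>\<^bsub>M\<^esub> l) \<cdot> e1 \<cdot> emb (star A l)) = \<one>\<^bsub>M\<^esub>" by (rule M_expand) simp
  finally have "D.ptrace p = s \<odot>\<^bsub>M\<^esub> \<one>\<^bsub>M\<^esub>" using index(2) by simp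
  then have "ptrace (D.ptrace p) = s \<odot> \<one>" by (simp add: ptrace_smult ptrace_one)
  then show ?thesis by (rule tower_trace_eq[OF p_module_map])
qed

lemma P_commutant: "P = {T \<in> carrier M. left_mult M T \<in> relative_commutant {p} D.M}"
proof -
  have "left_mult M T \<star> p = p \<star> left_mult M T \<longleftrightarrow> (\<forall>S\<in>maps. p (T \<cdot> S) = T \<cdot> p S)"
    if T: "T \<in> maps" for T
  proof
    assume eq: "left_mult M T \<star> p = p \<star> left_mult M T"
    show "\<forall>S\<in>maps. p (T \<cdot> S) = T \<cdot> p S"
    proof
      fix S assume "S \<in> maps"
      then show "p (T \<cdot> S) = T \<cdot> p S"
        using fun_cong[OF eq, of S] T by (simp add: D.M_apply D.emb_apply)
    qed
  next
    assume eq: "\<forall>S\<in>maps. p (T \<cdot> S) = T \<cdot> p S"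
    show "left_mult M T \<star> p = p \<star> left_mult M T"
      by (rule D.maps_ext) (use T eq p_module_map in \<open>auto simp: D.M_apply D.emb_apply\<close>)
  qed
  then show ?thesis by (auto simp: P_def relative_commutant_def)
qed

text \<open>
  \<open>p(T p(S)) = p(T) p(S)\<close>, because \<open>p(S)\<close> lies in \<open>P\<close>.
\<close>

lemma p_compression:
  "T \<in> maps \<Longrightarrow> p \<star> left_mult M T \<star> p = left_mult M (p T) \<star> p"
proof -
  assume T: "T \<in> maps"
  interpret Q: cond_exp M P p by unfold_locales (rule P_expectation)
  show ?thesis
    by (rule D.maps_ext)
       (use T p_module_map in \<open>auto simp: D.M_apply D.emb_apply Q.E_right p_P\<close>)
qed

end

section \<open>From biprojections to intermediate algebras\<close>

context inclusion
begin

interpretation D: inclusion M "emb ` carrier A" dual L1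
  by (rule dual_inclusion)

text \<open>
  Two projections that are positive multiples of each other coincide, so the description determines its
  object.
\<close>

lemma fourier_projection_eqI:
  assumes p: "projection D.M p" and t: "0 < t" and F: "fourier1 A B e = of_real t \<odot>\<^bsub>D.M\<^esub> p"
  shows "fourier_projection A B e = p"
  unfolding fourier_projection_def tower2_eq
proof (rule the_equality)
  show "projection D.M p \<and> (\<exists>t>0. fourier1 A B e = of_real t \<odot>\<^bsub>D.M\<^esub> p)" using assms by blast
  fix q assume q: "projection D.M q \<and> (\<exists>t>0. fourier1 A B e = of_real t \<odot>\<^bsub>D.M\<^esub> q)"
  then obtain r where r: "0 < r" "fourier1 A B e = of_real r \<odot>\<^bsub>D.M\<^esub> q" by blast
  have pm: "p \<in> D.maps" "p \<star> p = p" and qm: "q \<in> D.maps" "q \<star> q = q"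
    using p q by (auto simp: projection_def)
  have eq: "of_real r \<odot>\<^bsub>D.M\<^esub> q = of_real t \<odot>\<^bsub>D.M\<^esub> p" using F r by simp
  have "of_real (1 / r) \<odot>\<^bsub>D.M\<^esub> (of_real r \<odot>\<^bsub>D.M\<^esub> q)
      = of_real (1 / r) \<odot>\<^bsub>D.M\<^esub> (of_real t \<odot>\<^bsub>D.M\<^esub> p)" by (simp only: eq)
  then have q_eq: "q = of_real (t / r) \<odot>\<^bsub>D.M\<^esub> p" using pm qm r(1) by simp
  let ?k = "complex_of_real (t / r)"
  have "(?k * ?k) \<odot>\<^bsub>D.M\<^esub> p = ?k \<odot>\<^bsub>D.M\<^esub> p"
    using qm(2) pm unfolding q_eq by (simp add: D.M.smult_mult_left D.M.smult_mult_right)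
  then have "?k \<odot>\<^bsub>D.M\<^esub> (?k \<odot>\<^bsub>D.M\<^esub> p) = ?k \<odot>\<^bsub>D.M\<^esub> p" using pm by simp
  then have "?k \<odot>\<^bsub>D.M\<^esub> p = p" using D.M.smult_cancel[of "?k \<odot>\<^bsub>D.M\<^esub> p" p ?k] pm t r(1) by simp
  then show "q = p" using q_eq by simp
qed

text \<open>
  In a biprojection the scalar \<open>c\<close> with \<open>\<F>\<^sub>1(e) = c p\<close> is only complex. Positivity of \<open>s\<close>, which is a positive
  multiple of \<open>1/c\<close>, shows that \<open>c > 0\<close> and hence that \<open>p\<close> is \<open>[\<F>(e)]\<close>.
\<close>

lemma biprojection_pair:
  assumes bp: "biprojection A B e" and nz: "e \<noteq> \<zero>\<^bsub>M\<^esub>"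
  obtains s where "biprojection_pair A B E L e (fourier_projection A B e) s"
    "projection D.M (fourier_projection A B e)" "fourier_projection A B e \<in> commutant_A2 A B"
    "\<exists>t>0. fourier1 A B e = of_real t \<odot>\<^bsub>D.M\<^esub> fourier_projection A B e"
proof -
  obtain c p where e: "e \<in> commutant_B1 A B" "projection M e" and p: "projection D.M p"
    and F: "fourier1 A B e = c \<odot>\<^bsub>D.M\<^esub> p"
    using bp unfolding biprojection_def tower1_eq tower2_eq by blast
  note four = fourier1_apply[OF e(1)]
  have em: "e \<in> maps" using e(1) by (simp add: commutant_B1_eq)
  have pm: "p \<in> D.maps" and ps: "star D.M p = p" and pp: "p \<star> p = p"
    using p by (simp_all add: projection_def)
  have cp: "c \<odot>\<^bsub>M\<^esub> p (emb a \<cdot> e1 \<cdot> emb b) = of_real fourier_scale \<odot>\<^bsub>M\<^esub> (emb a \<cdot> e \<cdot> emb b)"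
    if "a \<in> carrier A" "b \<in> carrier A" for a b
    using four(3)[OF that] that unfolding F by (simp add: D.M_apply)
  have pc: "p T \<in> maps" if "T \<in> maps" for T using D.maps_closed[OF pm, of T] that by simp
  have c0: "c \<noteq> 0"
  proof
    assume "c = 0"
    then have "of_real fourier_scale \<odot>\<^bsub>M\<^esub> e = \<zero>\<^bsub>M\<^esub>"
      using cp[of "\<one>" "\<one>"] em pc[of e1] by (simp add: emb_one)
    then show False using M.smult_eq_zero[of e "complex_of_real fourier_scale"] em nz fourier_scale_pos by auto
  qed
  define s where "s = complex_of_real fourier_scale / c"
  have pair: "biprojection_pair A B E L e p s"
  proof (intro biprojection_pair.intro biprojection_pair_axioms.intro inclusion_axioms em pm nz)
    show "star M e = e" "e \<cdot> e = e" using e(2) by (simp_all add: projection_def)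
    show "e \<cdot> emb b = emb b \<cdot> e" if "b \<in> B" for b using e(1) that by (simp add: commutant_B1_eq)
    show "dual (star M (p S) \<cdot> T) = dual (star M S \<cdot> p T)" if "S \<in> maps" "T \<in> maps" for S T
      using D.adj_inner[OF pm, of S T] that ps D.M_star[OF pm] by simp
    show "p (p T) = p T" if "T \<in> maps" for T
      using fun_cong[OF pp, of T] that by (simp add: D.M_apply)
    show "s \<noteq> 0" using c0 fourier_scale_pos by (simp add: s_def)
    fix a b assume ab: "a \<in> carrier A" "b \<in> carrier A"
    have "c \<odot>\<^bsub>M\<^esub> p (emb a \<cdot> e1 \<cdot> emb b) = c \<odot>\<^bsub>M\<^esub> (s \<odot>\<^bsub>M\<^esub> (emb a \<cdot> e \<cdot> emb b))"
      using cp[OF ab] ab em c0 by (simp add: s_def)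
    then show "p (emb a \<cdot> e1 \<cdot> emb b) = s \<odot>\<^bsub>M\<^esub> (emb a \<cdot> e \<cdot> emb b)"
      by (rule M.smult_cancel[OF _ _ c0, rotated 2]) (use ab em pc in auto)
  qed
  define t where "t = fourier_scale / Re s"
  have rs: "0 < Re s" and s: "s = complex_of_real (Re s)"
    using biprojection_pair.scalars(2,3)[OF pair] by auto
  have t: "0 < t" using rs fourier_scale_pos by (simp add: t_def)
  have "c = complex_of_real fourier_scale / s" using c0 fourier_scale_pos by (simp add: s_def)
  then have "c = complex_of_real t" using s by (simp add: t_def)
  then have Ft: "fourier1 A B e = of_real t \<odot>\<^bsub>D.M\<^esub> p" using F by simp
  then have fp: "fourier_projection A B e = p" by (rule fourier_projection_eqI[OF p t])
  have "p = (1 / c) \<odot>\<^bsub>D.M\<^esub> fourier1 A B e" using F c0 pm by simp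
  then have "p \<in> commutant_A2 A B"
    using cstar_subalgebraD(9)[OF commutant_A2_subalgebra four(1)] by metis
  then show ?thesis using that pair p t Ft unfolding fp by blast
qed

end

theorem theorem4p24:
  fixes A :: "'a cstar" and B :: "'a set" and E :: "'a \<Rightarrow> 'a"
    and A\<^sub>1 :: "('a \<Rightarrow> 'a) cstar" and A\<^sub>2 :: "(('a \<Rightarrow> 'a) \<Rightarrow> 'a \<Rightarrow> 'a) cstar"
    and e :: "'a \<Rightarrow> 'a" and f :: "('a \<Rightarrow> 'a) \<Rightarrow> 'a \<Rightarrow> 'a" and P :: "('a \<Rightarrow> 'a) set"
  assumes "cstar_algebra A"
    and "cstar_subalgebra B A"
    and "simple_cstar A"
    and "simple_cstar (A\<lparr>carrier := B\<rparr>)"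
    and "relative_commutant B A = {c \<odot>\<^bsub>A\<^esub> \<one>\<^bsub>A\<^esub> | c. True}"
    and "finite_index_expectation A B E"
    and A1: "A\<^sub>1 = tower1 A B"
    and A2: "A\<^sub>2 = tower2 A B"
    and "biprojection A B e"
    and "e \<noteq> \<zero>\<^bsub>A\<^sub>1\<^esub>"
    and f: "f = fourier_projection A B e"
    and P: "P = {x \<in> carrier A\<^sub>1. incl12 A B x \<in> relative_commutant {f} A\<^sub>2}"
  shows "projection A\<^sub>2 f \<and> f \<in> commutant_A2 A B \<and>
      (\<exists>t>0. fourier1 A B e = of_real t \<odot>\<^bsub>A\<^sub>2\<^esub> f) \<and>
    cstar_subalgebra P A\<^sub>1 \<and> image1 A (carrier A) \<subseteq> P \<and>
    (\<exists>E\<^sub>P. conditional_expectation A\<^sub>1 P E\<^sub>P \<and>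
      (\<forall>x\<in>carrier A\<^sub>1. f \<otimes>\<^bsub>A\<^sub>2\<^esub> incl12 A B x \<otimes>\<^bsub>A\<^sub>2\<^esub> f = incl12 A B (E\<^sub>P x) \<otimes>\<^bsub>A\<^sub>2\<^esub> f)) \<and>
    P = complex_span A\<^sub>1 {left_mult A a \<otimes>\<^bsub>A\<^sub>1\<^esub> e \<otimes>\<^bsub>A\<^sub>1\<^esub> left_mult A b | a b.
          a \<in> carrier A \<and> b \<in> carrier A} \<and>
    (\<exists>!F. minimal_expectation A\<^sub>1 P F) \<and>
    f = jones_projection A\<^sub>1 P \<and>
    complex_of_real (min_index A\<^sub>1 P) = inverse (tower_trace A B f)"
proof -
  obtain L where ce: "conditional_expectation A B E" and qb: "quasi_basis A E L"
    using \<open>finite_index_expectation A B E\<close> by (auto simp: finite_index_expectation_def)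
  interpret inclusion A B E L
    using \<open>cstar_algebra A\<close> ce qb \<open>simple_cstar A\<close> \<open>relative_commutant B A = _\<close>
    by (intro inclusion.intro cond_exp.intro inclusion_axioms.intro cond_exp_axioms.intro)
      (simp_all add: simple_cstar_def)
  have A\<^sub>1: "A\<^sub>1 = M" and A\<^sub>2: "A\<^sub>2 = adjointable_maps M (emb ` carrier A) dual"
    by (simp_all add: A1 A2 tower1_eq tower2_eq)
  obtain s where pair: "biprojection_pair A B E L e f s"
    and proj: "projection A\<^sub>2 f" and comm: "f \<in> commutant_A2 A B"
    and scale: "\<exists>t>0. fourier1 A B e = of_real t \<odot>\<^bsub>A\<^sub>2\<^esub> f"
    using biprojection_pair[OF \<open>biprojection A B e\<close>] \<open>e \<noteq> _\<close> unfolding f A\<^sub>1 A\<^sub>2 by blast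
  interpret F: biprojection_pair A B E L e f s by (rule pair)
  interpret D: inclusion M "emb ` carrier A" dual L1 by (rule dual_inclusion)
  interpret Q: inclusion M F.P f F.N by (rule F.P_inclusion)
  have P_eq: "P = F.P" unfolding P A\<^sub>1 A\<^sub>2 incl12_eq by (rule F.P_commutant[symmetric])
  have "min_index M F.P = 1 / Re s" by (rule F.P_index)
  moreover have "tower_trace A B f = complex_of_real (Re s)" using F.p_trace F.scalars(2) by simp
  ultimately have index: "complex_of_real (min_index A\<^sub>1 P) = inverse (tower_trace A B f)"
    unfolding A\<^sub>1 P_eq by (simp add: inverse_eq_divide)
  have E\<^sub>P: "conditional_expectation A\<^sub>1 P f \<and>
      (\<forall>x\<in>carrier A\<^sub>1. f \<otimes>\<^bsub>A\<^sub>2\<^esub> incl12 A B x \<otimes>\<^bsub>A\<^sub>2\<^esub> f = incl12 A B (f x) \<otimes>\<^bsub>A\<^sub>2\<^esub> f)"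
    unfolding A\<^sub>1 A\<^sub>2 P_eq incl12_eq using F.P_expectation F.p_compression by simp
  have "image1 A (carrier A) \<subseteq> P" unfolding P_eq image1_eq using F.emb_P by blast
  moreover have "cstar_subalgebra P A\<^sub>1" unfolding A\<^sub>1 P_eq by (rule F.P_subalgebra)
  moreover have "\<exists>!G. minimal_expectation A\<^sub>1 P G" unfolding A\<^sub>1 P_eq Q.minimal_expectation_iff by blast
  moreover have "f = jones_projection A\<^sub>1 P" unfolding A\<^sub>1 P_eq by (rule F.p_jones[symmetric])
  moreover have "P = complex_span A\<^sub>1 {left_mult A a \<otimes>\<^bsub>A\<^sub>1\<^esub> e \<otimes>\<^bsub>A\<^sub>1\<^esub> left_mult A b | a b.
      a \<in> carrier A \<and> b \<in> carrier A}"
    unfolding A\<^sub>1 P_eq by (rule F.P_span)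
  ultimately show ?thesis using proj comm scale E\<^sub>P index by blast
qed

end
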